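(* Let $m\ge2$ and $1\le p\le 2$. There is no non-empty open set $\Omega\subset\mathbb{R}^m$ with $|\Omega|<\infty$ such that $F_p(\Omega)=\mathfrak{F}_p$; that is, the supremum defining $\mathfrak{F}_p$ is not attained.
   Context: For a non-empty open $\Omega\subset\mathbb{R}^m$ with $|\Omega|<\infty$, $\lambda_1(\Omega)=\inf_{\varphi\in H_0^1(\Omega)\setminus\{0\}}\int_\Omega|D\varphi|^2/\int_\Omega\varphi^2$, $v_\Omega$ is the unique solution of $-\Delta v=1$, $v\in H_0^1(\Omega)$, $F_p(\Omega)=\|v_\Omega\|_{L^p(\Omega)}\lambda_1(\Omega)/|\Omega|^{1/p}$, and $\mathfrak{F}_p=\sup\{F_p(\Omega):\Omega\text{ open in }\mathbb{R}^m,\ 0<|\Omega|<\infty\}$. *)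

theory Defs
  imports "HOL-Analysis.Analysis"
begin

fun Ck :: "nat \<Rightarrow> ('a::euclidean_space \<Rightarrow> real) \<Rightarrow> bool" where
  "Ck 0 f = continuous_on UNIV f"
| "Ck (Suc k) f = (continuous_on UNIV f \<and>
     (\<exists>f'. (\<forall>x. (f has_derivative f' x) (at x)) \<and> (\<forall>h. Ck k (\<lambda>x. f' x h))))"

definition smooth :: "('a::euclidean_space \<Rightarrow> real) \<Rightarrow> bool" where
  "smooth f \<longleftrightarrow> (\<forall>k. Ck k f)"

definition test_fun :: "'a::euclidean_space set \<Rightarrow> ('a \<Rightarrow> real) \<Rightarrow> bool" where
  "test_fun \<Omega> \<phi> \<longleftrightarrow> smooth \<phi> \<and> compact (closure {x. \<phi> x \<noteq> 0})
      \<and> closure {x. \<phi> x \<noteq> 0} \<subseteq> \<Omega>"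

definition grad :: "('a::euclidean_space \<Rightarrow> real) \<Rightarrow> 'a \<Rightarrow> 'a" where
  "grad f x = (\<Sum>b\<in>Basis. frechet_derivative f (at x) b *\<^sub>R b)"

text \<open>\<open>H01 \<Omega> u g\<close>: u belongs to H_0^1(Omega) (closure of C_c^infinity(Omega) in the H^1 norm)
  and g is its (weak) gradient.\<close>
definition H01 :: "'a::euclidean_space set \<Rightarrow> ('a \<Rightarrow> real) \<Rightarrow> ('a \<Rightarrow> 'a) \<Rightarrow> bool" where
  "H01 \<Omega> u g \<longleftrightarrow>
     u \<in> borel_measurable lebesgue \<and> g \<in> borel_measurable lebesgue \<and>
     integrable lebesgue (\<lambda>x. (u x)\<^sup>2) \<and> integrable lebesgue (\<lambda>x. (norm (g x))\<^sup>2) \<and>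
     (\<exists>\<phi>::nat \<Rightarrow> 'a \<Rightarrow> real. (\<forall>n. test_fun \<Omega> (\<phi> n)) \<and>
        (\<lambda>n. LINT x|lebesgue. (\<phi> n x - u x)\<^sup>2) \<longlonglongrightarrow> 0 \<and>
        (\<lambda>n. LINT x|lebesgue. (norm (grad (\<phi> n) x - g x))\<^sup>2) \<longlonglongrightarrow> 0)"

definition lambda1 :: "'a::euclidean_space set \<Rightarrow> real" where
  "lambda1 \<Omega> = Inf {(LINT x|lebesgue. (norm (g x))\<^sup>2) / (LINT x|lebesgue. (u x)\<^sup>2) | u g.
       H01 \<Omega> u g \<and> (LINT x|lebesgue. (u x)\<^sup>2) \<noteq> 0}"

text \<open>Weak solution of -Delta v = 1, v in H_0^1(Omega).\<close>
definition is_torsion :: "'a::euclidean_space set \<Rightarrow> ('a \<Rightarrow> real) \<Rightarrow> bool" where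
  "is_torsion \<Omega> v \<longleftrightarrow> (\<exists>gv. H01 \<Omega> v gv \<and>
     (\<forall>\<phi>. test_fun \<Omega> \<phi> \<longrightarrow>
        (LINT x|lebesgue. gv x \<bullet> grad \<phi> x) = (LINT x|lebesgue. \<phi> x)))"

definition torsion :: "'a::euclidean_space set \<Rightarrow> 'a \<Rightarrow> real" where
  "torsion \<Omega> = (SOME v. is_torsion \<Omega> v)"

definition Lp_norm_on :: "real \<Rightarrow> 'a::euclidean_space set \<Rightarrow> ('a \<Rightarrow> real) \<Rightarrow> real" where
  "Lp_norm_on p \<Omega> f = (LINT x|lebesgue. indicator \<Omega> x * \<bar>f x\<bar> powr p) powr (1 / p)"

definition Fp :: "real \<Rightarrow> 'a::euclidean_space set \<Rightarrow> real" where
  "Fp p \<Omega> = Lp_norm_on p \<Omega> (torsion \<Omega>) * lambda1 \<Omega> / (measure lebesgue \<Omega>) powr (1 / p)"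

definition Fsup :: "'a::euclidean_space itself \<Rightarrow> real \<Rightarrow> ereal" where
  "Fsup _ p = (SUP \<Omega> \<in> {\<Omega>::'a set. open \<Omega> \<and> 0 < emeasure lebesgue \<Omega> \<and> emeasure lebesgue \<Omega> < \<infinity>}.
                  ereal (Fp p \<Omega>))"

end

theory Submission
  imports Defs
begin

text \<open>
  Every \<open>\<Omega>\<close> satisfies \<open>F\<^sub>p(\<Omega>) < 1\<close>: power means give \<open>F\<^sub>p \<le> F\<^sub>2\<close>, and
  \<open>\<lambda>\<^sub>1 \<integral>v\<^sup>2 \<le> \<integral>|\<nabla>v|\<^sup>2 = \<integral>v \<le> |\<Omega>|\<^sup>1\<^sup>/\<^sup>2 \<parallel>v\<parallel>\<^sub>2\<close> gives \<open>F\<^sub>2 \<le> 1\<close>, with equality only if the torsion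
  function \<open>v\<close> is constant on \<open>\<Omega>\<close>, which contradicts \<open>-\<Delta>v = 1\<close>.

  The supremum is nevertheless at least \<open>1\<close>. Remove small balls around the points of the integer lattice and
  let \<open>\<mu>\<close> be the infimum of the Rayleigh quotient over test functions on this perforated space. It is positive, and
  it tends to \<open>0\<close> with the radius because points have zero capacity in dimension at least two. For a near-minimizer
  \<open>\<phi>\<close>, the function \<open>u = (\<Sum>\<^sub>k \<phi>(x - k)\<^sup>2)\<^sup>1\<^sup>/\<^sup>2\<close>, summed over the lattice points \<open>k\<close> of a large box, has Rayleigh
  quotient close to \<open>\<mu>\<close>, and is nearly constant since its energy is small. On the perforated box
  \<open>\<lambda>\<^sub>1 \<ge> \<mu>\<close>, and the torsional rigidity is at least \<open>(\<integral>u)\<^sup>2 / \<integral>|\<nabla>u|\<^sup>2\<close>, so \<open>F\<^sub>p \<ge> F\<^sub>1\<close> is close to \<open>1\<close>.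
\<close>

section \<open>Smooth functions\<close>

text \<open>The quotient is scale invariant, so unit lattice spacing with \<open>\<mu>\<close>
  tending to \<open>0\<close> stands for a fixed eigenvalue and ever finer perforations. In that
  regime the perforated \<open>-\<Delta>\<close> acts like multiplication by \<open>\<mu>\<close>,
  the torsion function is close to the constant \<open>1 / \<mu>\<close>, and \<open>Fp\<close> is
  close to \<open>1\<close>. The difficulty is to see this on bounded pieces, using test functions
  only. The number \<open>\<mu>\<close> does two jobs: a test function on a piece is one on the
  whole perforated space, so \<open>\<mu>\<close> bounds \<open>lambda1\<close> of every piece from
  below, and \<open>\<phi>\<close> nearly attains it. Adding squares of translates makes the
  bookkeeping additive: for \<open>n\<close> lattice points, \<open>A = mass \<phi>\<close> and
  \<open>E = dirichlet \<phi>\<close>, the energy of \<open>u\<close> is at most \<open>n E\<close>,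
  its mass about \<open>n A\<close>, and its mass on each unit cell at most \<open>A\<close>;
  together these force the integral of \<open>u\<close> up to about \<open>n * sqrt A\<close>. As
  the volume is about \<open>n\<close>, the lower bound for \<open>Fp\<close> is about
  \<open>\<mu> (n^2 A) / (n E n) = \<mu> A / E\<close>, near \<open>1\<close>; the amplitude of
  \<open>\<phi>\<close> cancels. Dimension two matters for the capacity of points: on the line,
  \<open>\<mu>\<close> would stay above a positive constant.\<close>

lemma Ck_cont: "Ck k f \<Longrightarrow> continuous_on UNIV f"
  by (cases k) auto

lemma Ck_SucI:
  assumes "\<And>x. (f has_derivative f' x) (at x)" "\<And>h. Ck k (\<lambda>x. f' x h)"
  shows "Ck (Suc k) f"
proof -
  have "continuous_on UNIV f"
    using assms(1) by (meson continuous_at_imp_continuous_on has_derivative_continuous)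
  then show ?thesis using assms by auto
qed

lemma Ck_SucE:
  assumes "Ck (Suc k) f"
  obtains f' where "\<And>x. (f has_derivative f' x) (at x)" "\<And>h. Ck k (\<lambda>x. f' x h)"
  using assms by auto

lemma Ck_Suc_imp_Ck: "Ck (Suc k) f \<Longrightarrow> Ck k f"
proof (induction k arbitrary: f)
  case (Suc k)
  obtain f' where f: "\<And>x. (f has_derivative f' x) (at x)" "\<And>h. Ck (Suc k) (\<lambda>x. f' x h)"
    using Suc.prems by (rule Ck_SucE) (rule that)
  show ?case by (rule Ck_SucI, rule f(1), rule Suc.IH, rule f(2))
qed auto

lemma Ck_const [simp]: "Ck k (\<lambda>x. c)"
proof (induction k arbitrary: c)
  case (Suc k)
  then show ?case by (intro Ck_SucI[where f' = "\<lambda>_ _. 0"]) auto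
qed auto

lemma Ck_inner: "Ck k (\<lambda>x. x \<bullet> b)"
proof (cases k)
  case (Suc k)
  then show ?thesis
    by (auto intro!: Ck_SucI[where f' = "\<lambda>_ h. h \<bullet> b"] derivative_eq_intros simp del: Ck.simps)
qed (auto intro: continuous_intros)

lemma Ck_add: "Ck k f \<Longrightarrow> Ck k g \<Longrightarrow> Ck k (\<lambda>x. f x + g x)"
proof (induction k arbitrary: f g)
  case (Suc k)
  obtain f' where f: "\<And>x. (f has_derivative f' x) (at x)" "\<And>h. Ck k (\<lambda>x. f' x h)"
    using Suc.prems(1) by (rule Ck_SucE) (rule that)
  obtain g' where g: "\<And>x. (g has_derivative g' x) (at x)" "\<And>h. Ck k (\<lambda>x. g' x h)"
    using Suc.prems(2) by (rule Ck_SucE) (rule that)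
  show ?case
    by (rule Ck_SucI[where f' = "\<lambda>x h. f' x h + g' x h"]) (auto intro!: derivative_eq_intros f g Suc.IH)
qed (auto intro: continuous_intros)

lemma Ck_mult: "Ck k f \<Longrightarrow> Ck k g \<Longrightarrow> Ck k (\<lambda>x. f x * g x)"
proof (induction k arbitrary: f g)
  case (Suc k)
  obtain f' where f: "\<And>x. (f has_derivative f' x) (at x)" "\<And>h. Ck k (\<lambda>x. f' x h)"
    using Suc.prems(1) by (rule Ck_SucE) (rule that)
  obtain g' where g: "\<And>x. (g has_derivative g' x) (at x)" "\<And>h. Ck k (\<lambda>x. g' x h)"
    using Suc.prems(2) by (rule Ck_SucE) (rule that)
  show ?case
    using Suc.prems[THEN Ck_Suc_imp_Ck]
    by (intro Ck_SucI[where f' = "\<lambda>x h. f x * g' x h + f' x h * g x"])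
      (auto intro!: derivative_eq_intros Ck_add f g Suc.IH simp del: Ck.simps)
qed (auto intro: continuous_intros)

lemma Ck_affine: "Ck k f \<Longrightarrow> Ck k (\<lambda>x. f (c *\<^sub>R x + a))"
proof (induction k arbitrary: f)
  case 0
  then show ?case
    by (auto intro!: continuous_on_compose2[of UNIV f] continuous_intros)
next
  case (Suc k)
  obtain f' where f: "\<And>x. (f has_derivative f' x) (at x)" "\<And>h. Ck k (\<lambda>x. f' x h)"
    using Suc.prems(1) by (rule Ck_SucE) (rule that)
  have "((\<lambda>x. f (c *\<^sub>R x + a)) has_derivative (\<lambda>h. f' (c *\<^sub>R x + a) (c *\<^sub>R h))) (at x)" for x
    by (rule has_derivative_compose[where f = "\<lambda>x. c *\<^sub>R x + a", OF _ f(1)])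
       (auto intro!: derivative_eq_intros)
  then show ?case
    by (rule Ck_SucI) (rule Suc.IH f)+
qed

text \<open>Differentiation lowers the exponent to \<open>a - 1\<close>, so the induction must range
  over all exponents. Exponent \<open>-1\<close> later gives reciprocals and \<open>1 / 2\<close>
  square roots of positive smooth functions.\<close>

lemma Ck_powr:
  "Ck k f \<Longrightarrow> (\<And>x. 0 < f x) \<Longrightarrow> Ck k (\<lambda>x. f x powr a)"
proof (induction k arbitrary: f a)
  case 0
  then show ?case by (auto intro!: continuous_on_powr simp: less_imp_neq[symmetric])
next
  case (Suc k)
  obtain f' where f: "\<And>x. (f has_derivative f' x) (at x)" "\<And>h. Ck k (\<lambda>x. f' x h)"
    using Suc.prems(1) by (rule Ck_SucE) (rule that)
  have "((\<lambda>x. f x powr a) has_derivative (\<lambda>h. (a * f x powr (a - 1)) * f' x h)) (at x)" for x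
    by (rule DERIV_compose_FDERIV[where g = f and f = "\<lambda>t. t powr a", OF _ f(1), THEN has_derivative_eq_rhs])
       (auto intro!: has_real_derivative_powr Suc.prems)
  then show ?case
    by (rule Ck_SucI)
       (intro Ck_mult Suc.IH Ck_const f Suc.prems Ck_Suc_imp_Ck)+
qed

text \<open>The functions \<open>t\<^sup>-\<^sup>n e\<^sup>-\<^sup>1\<^sup>/\<^sup>t\<close>, extended by \<open>0\<close>, span a space closed under differentiation.\<close>

definition flat :: "nat \<Rightarrow> real \<Rightarrow> real" where
  "flat n t = (if t \<le> 0 then 0 else exp (- (1 / t)) / t ^ n)"

lemma exp_ge_power_div_fact:
  fixes x :: real assumes "0 \<le> x" shows "x ^ n / fact n \<le> exp x"
proof -
  have "(\<Sum>k\<in>{n}. x ^ k /\<^sub>R fact k) \<le> (\<Sum>k. x ^ k /\<^sub>R fact k)"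
    by (rule sum_le_suminf[OF summable_exp_generic]) (use assms in auto)
  then show ?thesis by (simp add: exp_def divide_inverse mult.commute)
qed

text \<open>One term of the exponential series suffices:
  \<open>(1/t)^(n+2) / fact (n+2) \<le> exp (1/t)\<close>. The two extra powers of \<open>t\<close>
  are what make the difference quotient at \<open>0\<close> vanish in the limit.\<close>

lemma flat_bound:
  assumes "t \<ge> 0" shows "flat n t \<le> fact (n + 2) * t\<^sup>2"
proof (cases "t = 0")
  case False
  then have t: "t > 0" using assms by simp
  have "(1 / t) ^ (n + 2) / F \<le> exp (1 / t) \<Longrightarrow> 0 < F \<Longrightarrow> flat n t \<le> F * t\<^sup>2" for F
    using t by (simp add: flat_def exp_minus field_simps power_add power2_eq_square)
  from this[OF exp_ge_power_div_fact] show ?thesis using t by simp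
qed (simp add: flat_def)

lemma flat_nonneg: "0 \<le> flat n t"
  by (simp add: flat_def)

lemma DERIV_flat: "DERIV (flat n) t :> flat (n + 2) t - of_nat n * flat (n + 1) t"
proof -
  consider "t > 0" | "t < 0" | "t = 0" by linarith
  then show ?thesis
  proof cases
    case 1
    have "DERIV (\<lambda>t. exp (- (1 / t)) / t ^ n) t :> flat (n + 2) t - of_nat n * flat (n + 1) t"
      using 1
      apply (cases n)
       apply (auto intro!: derivative_eq_intros simp: flat_def power2_eq_square)
      apply (simp add: field_simps)
      apply (metis One_nat_def power_eq_if)
      done
    then show ?thesis
      by (rule has_field_derivative_transform_within_open[where S = "{0<..}"]) (use 1 in \<open>auto simp: flat_def\<close>)
  next
    case 2
    have "DERIV (\<lambda>t. 0) t :> flat (n + 2) t - of_nat n * flat (n + 1) t"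
      using 2 by (simp add: flat_def)
    then show ?thesis
      by (rule has_field_derivative_transform_within_open[where S = "{..<0}"]) (use 2 in \<open>auto simp: flat_def\<close>)
  next
    case 3
    \<comment> \<open>The quadratic bound makes the difference quotient at \<open>0\<close> of order
      \<open>\<bar>h\<bar>\<close>, so the derivative is \<open>0\<close>, which is also the value
      of the formula there.\<close>
    have "((\<lambda>h. flat n h / h) \<longlongrightarrow> 0) (at 0)"
    proof (rule Lim_null_comparison[where g = "\<lambda>h. fact (n + 2) * \<bar>h\<bar>"])
      have "norm (flat n h / h) \<le> fact (n + 2) * \<bar>h\<bar>" if "h \<noteq> 0" for h
      proof (cases "h > 0")
        case True
        then show ?thesis using flat_bound[of h n] flat_nonneg[of n h]
          by (simp add: divide_le_eq power2_eq_square mult.assoc)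
      qed (simp add: flat_def abs_if mult_nonneg_nonpos)
      then show "\<forall>\<^sub>F h in at 0. norm (flat n h / h) \<le> fact (n + 2) * \<bar>h\<bar>"
        by (simp add: eventually_at_filter)
      show "((\<lambda>h. fact (n + 2) * \<bar>h\<bar>) \<longlongrightarrow> 0) (at (0::real))"
        by (auto intro!: tendsto_eq_intros)
    qed
    then show ?thesis using 3 by (simp add: DERIV_def flat_def)
  qed
qed

text \<open>The index \<open>n\<close> is generalized together with \<open>f\<close>, because the
  derivative of \<open>flat n\<close> involves \<open>flat (n + 1)\<close> and
  \<open>flat (n + 2)\<close>.\<close>

lemma Ck_flat: "Ck k f \<Longrightarrow> Ck k (\<lambda>x. flat n (f x))"
proof (induction k arbitrary: f n)
  case 0
  have "continuous_on UNIV (flat n)"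
    using DERIV_flat DERIV_isCont by (blast intro: continuous_at_imp_continuous_on)
  then show ?case using 0 by (auto intro: continuous_on_compose2)
next
  case (Suc k)
  obtain f' where f: "\<And>x. (f has_derivative f' x) (at x)" "\<And>h. Ck k (\<lambda>x. f' x h)"
    using Suc.prems(1) by (rule Ck_SucE) (rule that)
  have "((\<lambda>x. flat n (f x)) has_derivative (\<lambda>h. (flat (n + 2) (f x) + (- of_nat n) * flat (n + 1) (f x)) * f' x h)) (at x)" for x
    by (rule DERIV_compose_FDERIV[where g = f and f = "flat n", OF DERIV_flat f(1), THEN has_derivative_eq_rhs])
       (auto simp: algebra_simps)
  then show ?case
    by (rule Ck_SucI)
       (intro Ck_mult Ck_add Suc.IH Ck_const f Suc.prems Ck_Suc_imp_Ck)+
qed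

lemma smooth_const [simp]: "smooth (\<lambda>x. c)"
  unfolding smooth_def using Ck_const by blast

lemma smooth_add: "smooth f \<Longrightarrow> smooth g \<Longrightarrow> smooth (\<lambda>x. f x + g x)"
  unfolding smooth_def using Ck_add by blast

lemma smooth_mult: "smooth f \<Longrightarrow> smooth g \<Longrightarrow> smooth (\<lambda>x. f x * g x)"
  unfolding smooth_def using Ck_mult by blast

lemma smooth_affine: "smooth f \<Longrightarrow> smooth (\<lambda>x. f (c *\<^sub>R x + a))"
  unfolding smooth_def using Ck_affine by blast

lemma smooth_powr: "smooth f \<Longrightarrow> (\<And>x. 0 < f x) \<Longrightarrow> smooth (\<lambda>x. f x powr e)"
  unfolding smooth_def using Ck_powr by blast

lemma smooth_flat: "smooth f \<Longrightarrow> smooth (\<lambda>x. flat n (f x))"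
  unfolding smooth_def using Ck_flat by blast

lemma smooth_inner: "smooth (\<lambda>x. x \<bullet> b)"
  unfolding smooth_def using Ck_inner by blast

lemma smooth_diff: "smooth f \<Longrightarrow> smooth g \<Longrightarrow> smooth (\<lambda>x. f x - g x)"
  using smooth_add[OF _ smooth_mult[OF smooth_const[of "-1"]], of f g] by simp

lemma smooth_sum:
  assumes "\<And>i. i \<in> I \<Longrightarrow> smooth (f i)" shows "smooth (\<lambda>x. \<Sum>i\<in>I. f i x)"
  using assms
proof (induction I rule: infinite_finite_induct)
  case (insert i I)
  have "smooth (\<lambda>x. f i x + (\<Sum>i\<in>I. f i x))"
    by (rule smooth_add) (simp_all add: insert)
  then show ?case using insert by simp
qed simp_all

lemma smooth_norm2: "smooth (\<lambda>x::'a::euclidean_space. (norm x)\<^sup>2)"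
proof -
  have "(norm x)\<^sup>2 = (\<Sum>b\<in>Basis. (x \<bullet> b) * (x \<bullet> b))" for x :: 'a
    unfolding power2_norm_eq_inner by (rule euclidean_inner)
  moreover have "smooth (\<lambda>x::'a. \<Sum>b\<in>Basis. (x \<bullet> b) * (x \<bullet> b))"
    by (rule smooth_sum, rule smooth_mult) (rule smooth_inner)+
  ultimately show ?thesis by simp
qed

section \<open>Gradients and their calculus\<close>

lemma grad_eqI:
  assumes "(f has_derivative (\<lambda>h. g \<bullet> h)) (at x)"
  shows "grad f x = g"
proof -
  have "frechet_derivative f (at x) = (\<lambda>h. g \<bullet> h)"
    by (rule frechet_derivative_at[OF assms, symmetric])
  then show ?thesis by (simp add: grad_def euclidean_representation)
qed

lemma differentiable_has_grad:
  assumes "f differentiable (at x)"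
  shows "(f has_derivative (\<lambda>h. grad f x \<bullet> h)) (at x)"
proof -
  let ?D = "frechet_derivative f (at x)"
  have D: "(f has_derivative ?D) (at x)"
    using assms by (simp add: frechet_derivative_works)
  have "?D h = grad f x \<bullet> h" for h
  proof -
    have "?D h = ?D (\<Sum>b\<in>Basis. (h \<bullet> b) *\<^sub>R b)" by (simp add: euclidean_representation)
    also have "\<dots> = (\<Sum>b\<in>Basis. (h \<bullet> b) * ?D b)"
      using has_derivative_linear[OF D] by (simp add: linear_sum linear_scale)
    also have "\<dots> = grad f x \<bullet> h"
      by (simp add: grad_def inner_sum_left inner_commute[of h] mult.commute)
    finally show ?thesis .
  qed
  then have "?D = (\<lambda>h. grad f x \<bullet> h)" by (rule ext)
  then show ?thesis using D by simp
qed

lemma smooth_differentiable: "smooth f \<Longrightarrow> f differentiable (at x)"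
  unfolding smooth_def differentiable_def using Ck.simps(2)[of 0 f] by blast

lemma smooth_has_grad: "smooth f \<Longrightarrow> (f has_derivative (\<lambda>h. grad f x \<bullet> h)) (at x)"
  by (intro differentiable_has_grad smooth_differentiable)

lemma smooth_continuous: "smooth f \<Longrightarrow> continuous_on S f"
  by (meson smooth_def Ck_cont continuous_on_subset subset_UNIV)

text \<open>The definition of \<open>Ck\<close> provides a derivative separately for each order;
  uniqueness of derivatives identifies them all with \<open>grad f\<close>, so one function has
  every order of smoothness.\<close>

lemma smooth_grad_inner:
  assumes "smooth f" shows "smooth (\<lambda>x. grad f x \<bullet> h)"
  unfolding smooth_def
proof
  fix k
  have "Ck (Suc k) f" using assms by (simp add: smooth_def del: Ck.simps)
  then obtain f' where f: "\<And>x. (f has_derivative f' x) (at x)" "\<And>h. Ck k (\<lambda>x. f' x h)"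
    by (rule Ck_SucE) (rule that)
  have "f' x h = grad f x \<bullet> h" for x
    using has_derivative_unique[OF f(1) smooth_has_grad[OF assms]] by (rule fun_cong)
  then show "Ck k (\<lambda>x. grad f x \<bullet> h)" using f(2)[of h] by simp
qed

lemma smooth_continuous_grad: "smooth f \<Longrightarrow> continuous_on S (grad f)"
  by (subst continuous_on_componentwise) (intro ballI smooth_continuous smooth_grad_inner)

lemma grad_add: "smooth f \<Longrightarrow> smooth g \<Longrightarrow> grad (\<lambda>x. f x + g x) x = grad f x + grad g x"
  using has_derivative_add[OF smooth_has_grad smooth_has_grad, of f g x]
  by (intro grad_eqI) (simp add: inner_left_distrib)

lemma grad_diff: "smooth f \<Longrightarrow> smooth g \<Longrightarrow> grad (\<lambda>x. f x - g x) x = grad f x - grad g x"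
  using has_derivative_diff[OF smooth_has_grad smooth_has_grad, of f g x]
  by (intro grad_eqI) (simp add: inner_diff_left)

lemma grad_mult:
  "smooth f \<Longrightarrow> smooth g \<Longrightarrow> grad (\<lambda>x. f x * g x) x = f x *\<^sub>R grad g x + g x *\<^sub>R grad f x"
  using has_derivative_mult[OF smooth_has_grad smooth_has_grad, of f g x]
  by (intro grad_eqI) (simp add: inner_left_distrib mult.commute)

lemma grad_cmult: "smooth f \<Longrightarrow> grad (\<lambda>x. c * f x) x = c *\<^sub>R grad f x"
  using has_derivative_scaleR_right[OF smooth_has_grad[of f x], of c]
  by (intro grad_eqI) simp

lemma grad_sum:
  "(\<And>i. i \<in> I \<Longrightarrow> smooth (f i)) \<Longrightarrow> grad (\<lambda>x. \<Sum>i\<in>I. f i x) x = (\<Sum>i\<in>I. grad (f i) x)"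
  using has_derivative_sum[OF smooth_has_grad, of I f x]
  by (intro grad_eqI) (simp add: inner_sum_left)

lemma grad_affine: "smooth f \<Longrightarrow> grad (\<lambda>x. f (c *\<^sub>R x + a)) x = c *\<^sub>R grad f (c *\<^sub>R x + a)"
proof (rule grad_eqI)
  assume f: "smooth f"
  show "((\<lambda>x. f (c *\<^sub>R x + a)) has_derivative (\<lambda>h. c *\<^sub>R grad f (c *\<^sub>R x + a) \<bullet> h)) (at x)"
    by (rule has_derivative_compose[where f = "\<lambda>x. c *\<^sub>R x + a", OF _ smooth_has_grad[OF f], THEN has_derivative_eq_rhs])
       (auto intro!: derivative_eq_intros)
qed

section \<open>Square-integrable functions\<close>

text \<open>A predicate on functions rather than a quotient space. It is generic in the measure and
  in the Euclidean range, so that functions and gradients, over \<open>lebesgue\<close> and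
  \<open>lborel\<close>, share the same Hilbert space lemmas.\<close>

definition L2 :: "'a measure \<Rightarrow> ('a \<Rightarrow> 'b::euclidean_space) \<Rightarrow> bool" where
  "L2 M f \<longleftrightarrow> f \<in> borel_measurable M \<and> integrable M (\<lambda>x. (norm (f x))\<^sup>2)"

lemma L2_measurable [measurable_dest]: "L2 M f \<Longrightarrow> f \<in> borel_measurable M"
  and L2_integrable_norm: "L2 M f \<Longrightarrow> integrable M (\<lambda>x. (norm (f x))\<^sup>2)"
  by (auto simp: L2_def)

lemma L2_integrable_inner:
  assumes "L2 M f" "L2 M g" shows "integrable M (\<lambda>x. f x \<bullet> g x)"
proof (rule Bochner_Integration.integrable_bound)
  show "integrable M (\<lambda>x. (norm (f x))\<^sup>2 + (norm (g x))\<^sup>2)"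
    using assms by (auto simp: L2_def)
  show "(\<lambda>x. f x \<bullet> g x) \<in> borel_measurable M" using assms by (auto simp: L2_def)
  have "\<bar>f x \<bullet> g x\<bar> \<le> (norm (f x))\<^sup>2 + (norm (g x))\<^sup>2" for x
  proof -
    have "\<bar>f x \<bullet> g x\<bar> \<le> norm (f x) * norm (g x)" by (rule Cauchy_Schwarz_ineq2)
    also have "\<dots> \<le> (norm (f x))\<^sup>2 + (norm (g x))\<^sup>2"
      using sum_squares_bound[of "norm (f x)" "norm (g x)"]
        mult_nonneg_nonneg[OF norm_ge_zero norm_ge_zero, of "f x" "g x"] by linarith
    finally show ?thesis .
  qed
  then show "AE x in M. norm (f x \<bullet> g x) \<le> norm ((norm (f x))\<^sup>2 + (norm (g x))\<^sup>2)"
    by simp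
qed

lemma norm2_add_scale:
  "(norm (a + t *\<^sub>R b))\<^sup>2 = (norm a)\<^sup>2 + 2 * t * (a \<bullet> b) + t\<^sup>2 * (norm b)\<^sup>2"
  unfolding power2_norm_eq_inner
  by (simp add: inner_add_left inner_add_right inner_commute[of b a] power2_eq_square algebra_simps)

lemma L2_add_scale:
  assumes "L2 M f" "L2 M g"
  shows "L2 M (\<lambda>x. f x + t *\<^sub>R g x)"
  using assms L2_integrable_inner[OF assms] by (auto simp: L2_def norm2_add_scale)

lemma L2_norm_add_scale:
  assumes "L2 M f" "L2 M g"
  shows "(LINT x|M. (norm (f x + t *\<^sub>R g x))\<^sup>2) =
    (LINT x|M. (norm (f x))\<^sup>2) + 2 * t * (LINT x|M. f x \<bullet> g x) + t\<^sup>2 * (LINT x|M. (norm (g x))\<^sup>2)"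
  using assms L2_integrable_inner[OF assms] by (simp add: L2_def norm2_add_scale)

lemma L2_diff: "L2 M f \<Longrightarrow> L2 M g \<Longrightarrow> L2 M (\<lambda>x. f x - g x)"
  using L2_add_scale[of M f g "-1"] by simp

text \<open>Serves twice: it yields Cauchy-Schwarz, and with \<open>A = 0\<close> it says that a
  vanishing minimum at \<open>t = 0\<close> has vanishing first variation.\<close>

lemma quadratic_nonneg_imp_discriminant:
  fixes A B C :: real
  assumes "\<And>t. 0 \<le> A + 2 * t * B + t\<^sup>2 * C" "0 \<le> C"
  shows "B\<^sup>2 \<le> A * C"
proof (cases "C = 0")
  case True
  have "B = 0"
  proof (rule ccontr)
    assume "B \<noteq> 0"
    \<comment> \<open>For this \<open>t\<close> the expression, now linear in \<open>t\<close>,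
      equals \<open>-1\<close>.\<close>
    then show False using assms(1)[of "-(A+1)/(2*B)"] True by (simp add: field_simps)
  qed
  then show ?thesis using True by simp
next
  case False
  then have "0 < C" using assms by simp
  then show ?thesis using assms(1)[of "-B/C"] by (simp add: field_simps power2_eq_square)
qed

lemma L2_Cauchy_Schwarz:
  assumes "L2 M f" "L2 M g"
  shows "(LINT x|M. f x \<bullet> g x)\<^sup>2 \<le> (LINT x|M. (norm (f x))\<^sup>2) * (LINT x|M. (norm (g x))\<^sup>2)"
proof (rule quadratic_nonneg_imp_discriminant)
  fix t
  have "0 \<le> (LINT x|M. (norm (f x + t *\<^sub>R g x))\<^sup>2)" by simp
  then show "0 \<le> (LINT x|M. (norm (f x))\<^sup>2) + 2 * t * (LINT x|M. f x \<bullet> g x) + t\<^sup>2 * (LINT x|M. (norm (g x))\<^sup>2)"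
    by (simp add: L2_norm_add_scale[OF assms])
qed simp

lemma L2_inner_tendsto:
  assumes "\<And>n. L2 M (f n)" "L2 M g" "L2 M h"
    and lim: "(\<lambda>n. LINT x|M. (norm (f n x - g x))\<^sup>2) \<longlonglongrightarrow> 0"
  shows "(\<lambda>n. LINT x|M. f n x \<bullet> h x) \<longlonglongrightarrow> (LINT x|M. g x \<bullet> h x)"
proof -
  have "(\<lambda>n. (LINT x|M. f n x \<bullet> h x) - (LINT x|M. g x \<bullet> h x)) \<longlonglongrightarrow> 0"
  proof (rule Lim_null_comparison)
    have "((LINT x|M. f n x \<bullet> h x) - (LINT x|M. g x \<bullet> h x))\<^sup>2 \<le>
        (LINT x|M. (norm (f n x - g x))\<^sup>2) * (LINT x|M. (norm (h x))\<^sup>2)" for n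
      using L2_Cauchy_Schwarz[OF L2_diff[OF assms(1,2)] assms(3), of n] assms(1-3)
      by (simp add: inner_diff_left L2_integrable_inner)
    then show "\<forall>\<^sub>F n in sequentially. norm ((LINT x|M. f n x \<bullet> h x) - (LINT x|M. g x \<bullet> h x))
        \<le> sqrt ((LINT x|M. (norm (f n x - g x))\<^sup>2) * (LINT x|M. (norm (h x))\<^sup>2))"
      by (simp add: real_le_rsqrt)
    show "(\<lambda>n. sqrt ((LINT x|M. (norm (f n x - g x))\<^sup>2) * (LINT x|M. (norm (h x))\<^sup>2))) \<longlonglongrightarrow> 0"
      using tendsto_real_sqrt[OF tendsto_mult_left_zero[OF lim]] by simp
  qed
  then show ?thesis by (simp add: LIM_zero_iff)
qed

lemma L2_norm_tendsto:
  assumes "\<And>n. L2 M (f n)" "L2 M g"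
    and lim: "(\<lambda>n. LINT x|M. (norm (f n x - g x))\<^sup>2) \<longlonglongrightarrow> 0"
  shows "(\<lambda>n. LINT x|M. (norm (f n x))\<^sup>2) \<longlonglongrightarrow> (LINT x|M. (norm (g x))\<^sup>2)"
proof -
  have "(LINT x|M. (norm (f n x))\<^sup>2) = (LINT x|M. (norm (f n x - g x))\<^sup>2) + 2 * (LINT x|M. f n x \<bullet> g x)
      - (LINT x|M. (norm (g x))\<^sup>2)" for n
    using L2_norm_add_scale[OF assms(1)[of n] assms(2), of "-1"] by simp
  moreover have "(\<lambda>n. (LINT x|M. (norm (f n x - g x))\<^sup>2) + 2 * (LINT x|M. f n x \<bullet> g x)
      - (LINT x|M. (norm (g x))\<^sup>2)) \<longlonglongrightarrow> 0 + 2 * (LINT x|M. g x \<bullet> g x) - (LINT x|M. (norm (g x))\<^sup>2)"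
    by (intro tendsto_intros lim L2_inner_tendsto assms)
  ultimately show ?thesis by (simp add: power2_norm_eq_inner)
qed

lemma ennreal_le_suminf: "h k \<le> suminf h" for h :: "nat \<Rightarrow> ennreal"
  using sum_le_suminf[of h "{k}"] by simp

text \<open>Riesz-Fischer: a rapidly Cauchy subsequence converges almost everywhere, and Fatou's
  lemma upgrades this to convergence of the whole sequence in mean square.\<close>

lemma L2_complete:
  fixes f :: "nat \<Rightarrow> 'a \<Rightarrow> 'b::euclidean_space"
  assumes L2: "\<And>n. L2 M (f n)"
    and cauchy: "\<And>e. 0 < e \<Longrightarrow> \<exists>N. \<forall>m\<ge>N. \<forall>n\<ge>N. (LINT x|M. (norm (f m x - f n x))\<^sup>2) < e"
  obtains g where "L2 M g" "(\<lambda>n. LINT x|M. (norm (f n x - g x))\<^sup>2) \<longlonglongrightarrow> 0"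
proof -
  define D where "D m n = (LINT x|M. (norm (f m x - f n x))\<^sup>2)" for m n
  have [measurable]: "f n \<in> borel_measurable M" for n using L2 by (rule L2_measurable)
  have int: "integrable M (\<lambda>x. (norm (f m x - f n x))\<^sup>2)" for m n
    by (intro L2_integrable_norm L2_diff L2)
  have nnD: "(\<integral>\<^sup>+x. ennreal ((norm (f m x - f n x))\<^sup>2) \<partial>M) = ennreal (D m n)" for m n
    unfolding D_def by (rule nn_integral_eq_integral[OF int]) simp
  have "\<forall>k::nat. \<exists>N. \<forall>m\<ge>N. \<forall>n\<ge>N. D m n < (1/4) ^ k"
    using cauchy by (simp add: D_def)
  then obtain N where N: "\<And>k m n. m \<ge> N k \<Longrightarrow> n \<ge> N k \<Longrightarrow> D m n < (1/4) ^ k"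
    by metis
  define r where "r = rec_nat (N 0) (\<lambda>k i. max (Suc i) (N (Suc k)))"
  have r_Suc: "r (Suc k) = max (Suc (r k)) (N (Suc k))" for k by (simp add: r_def)
  have rN: "r k \<ge> N k" for k by (cases k) (auto simp: r_def)
  have r_mono: "strict_mono r" by (rule strict_monoI_Suc) (simp add: r_Suc)
  have Dr: "D (r (Suc k)) (r k) < (1/4) ^ k" for k
    by (rule N) (use rN[of k] r_Suc[of k] in auto)
  \<comment> \<open>Increments with squared norm below \<open>(1/4)^k\<close> can carry the weight
    \<open>2^k\<close> and still have a finite total integral. Finiteness of \<open>S x\<close> then
    bounds the \<open>k\<close>-th increment at \<open>x\<close> by a multiple of
    \<open>sqrt (1/2) ^ k\<close>, which is summable.\<close>
  define S where "S x = (\<Sum>k. ennreal (2 ^ k * (norm (f (r (Suc k)) x - f (r k) x))\<^sup>2))" for x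
  have "(\<integral>\<^sup>+x. S x \<partial>M) = (\<Sum>k. \<integral>\<^sup>+x. ennreal (2 ^ k * (norm (f (r (Suc k)) x - f (r k) x))\<^sup>2) \<partial>M)"
    unfolding S_def by (rule nn_integral_suminf) measurable
  also have "\<dots> = (\<Sum>k. ennreal (2 ^ k * D (r (Suc k)) (r k)))"
    by (simp add: ennreal_mult nn_integral_cmult nnD D_def)
  also have "\<dots> \<le> (\<Sum>k. ennreal ((1/2) ^ k))"
  proof (rule suminf_le)
    fix k
    have "2 ^ k * D (r (Suc k)) (r k) \<le> 2 ^ k * (1/4) ^ k"
      using Dr[of k] by (intro mult_left_mono) auto
    also have "\<dots> = (1/2) ^ k" by (simp flip: power_mult_distrib)
    finally show "ennreal (2 ^ k * D (r (Suc k)) (r k)) \<le> ennreal ((1/2) ^ k)" by (rule ennreal_leI)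
  qed auto
  also have "\<dots> = ennreal (\<Sum>k. (1/2) ^ k)"
    by (rule suminf_ennreal2) (auto intro: summable_geometric)
  also have "\<dots> < \<infinity>" by simp
  finally have "(\<integral>\<^sup>+x. S x \<partial>M) \<noteq> \<infinity>" by simp
  moreover have "S \<in> borel_measurable M" unfolding S_def[abs_def] by measurable
  ultimately have AE_S: "AE x in M. S x \<noteq> \<infinity>" by (rule nn_integral_PInf_AE[rotated])
  have conv: "convergent (\<lambda>k. f (r k) x)" if Sx: "S x \<noteq> \<infinity>" for x
  proof -
    obtain c where c: "S x = ennreal c" "c \<ge> 0" using Sx by (cases "S x") auto
    have bd: "norm (f (r (Suc k)) x - f (r k) x) \<le> sqrt c * (sqrt (1/2)) ^ k" for k
    proof -
      have "ennreal (2 ^ k * (norm (f (r (Suc k)) x - f (r k) x))\<^sup>2) \<le> S x"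
        unfolding S_def by (rule ennreal_le_suminf)
      then have "2 ^ k * (norm (f (r (Suc k)) x - f (r k) x))\<^sup>2 \<le> c"
        by (simp only: c(1) ennreal_le_iff[OF c(2)])
      then have "(norm (f (r (Suc k)) x - f (r k) x))\<^sup>2 \<le> c * (1/2) ^ k"
        by (simp add: field_simps)
      then have "norm (f (r (Suc k)) x - f (r k) x) \<le> sqrt (c * (1/2) ^ k)"
        by (rule real_le_rsqrt)
      then show ?thesis by (simp add: real_sqrt_mult real_sqrt_power)
    qed
    have "summable (\<lambda>k. sqrt c * (sqrt (1/2)) ^ k)"
      by (intro summable_mult summable_geometric) simp
    then have "summable (\<lambda>k. f (r (Suc k)) x - f (r k) x)"
      by (rule summable_comparison_test'[where N = 0]) (rule bd)
    then have "(\<lambda>n. \<Sum>k<n. f (r (Suc k)) x - f (r k) x) \<longlonglongrightarrow> (\<Sum>k. f (r (Suc k)) x - f (r k) x)"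
      by (rule summable_LIMSEQ)
    then have "(\<lambda>n. f (r n) x - f (r 0) x) \<longlonglongrightarrow> (\<Sum>k. f (r (Suc k)) x - f (r k) x)"
      by (simp only: sum_lessThan_telescope[of "\<lambda>k. f (r k) x"])
    from tendsto_add[OF this tendsto_const[of "f (r 0) x"]] show ?thesis
      by (auto simp: convergent_def)
  qed
  define g where "g x = lim (\<lambda>k. f (r k) x)" for x
  have [measurable]: "g \<in> borel_measurable M" unfolding g_def[abs_def] by measurable
  have glim: "AE x in M. (\<lambda>k. f (r k) x) \<longlonglongrightarrow> g x"
    using AE_S by eventually_elim (use conv in \<open>simp add: g_def convergent_LIMSEQ_iff\<close>)
  \<comment> \<open>Fatou along the subsequence turns the Cauchy bound for a fixed \<open>m\<close>
    into a bound on the distance to \<open>g\<close>. It is used once with \<open>e = 1\<close> to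
    put \<open>g\<close> into \<open>L2\<close>, and again for the convergence.\<close>
  have fatou: "(\<integral>\<^sup>+x. ennreal ((norm (f m x - g x))\<^sup>2) \<partial>M) \<le> ennreal e"
    if e: "0 < e" and m: "\<And>n. n \<ge> K \<Longrightarrow> D m n \<le> e" for m e K
  proof -
    have "(\<integral>\<^sup>+x. ennreal ((norm (f m x - g x))\<^sup>2) \<partial>M) =
        (\<integral>\<^sup>+x. liminf (\<lambda>k. ennreal ((norm (f m x - f (r k) x))\<^sup>2)) \<partial>M)"
    proof (rule nn_integral_cong_AE)
      show "AE x in M. ennreal ((norm (f m x - g x))\<^sup>2) = liminf (\<lambda>k. ennreal ((norm (f m x - f (r k) x))\<^sup>2))"
        using glim
      proof eventually_elim
        case (elim x)
        have "(\<lambda>k. ennreal ((norm (f m x - f (r k) x))\<^sup>2)) \<longlonglongrightarrow> ennreal ((norm (f m x - g x))\<^sup>2)"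
          by (intro tendsto_ennrealI tendsto_intros elim)
        from lim_imp_Liminf[OF trivial_limit_sequentially this] show ?case by (rule sym)
      qed
    qed
    also have "\<dots> \<le> liminf (\<lambda>k. \<integral>\<^sup>+x. ennreal ((norm (f m x - f (r k) x))\<^sup>2) \<partial>M)"
      by (rule nn_integral_liminf) measurable
    also have "\<dots> = liminf (\<lambda>k. ennreal (D m (r k)))" by (simp add: nnD)
    also have "\<dots> \<le> liminf (\<lambda>k. ennreal e)"
    proof (rule Liminf_mono)
      have "\<forall>\<^sub>F k in sequentially. r k \<ge> K"
        using filterlim_subseq[OF r_mono] by (simp add: filterlim_at_top)
      then show "\<forall>\<^sub>F k in sequentially. ennreal (D m (r k)) \<le> ennreal e"
        by eventually_elim (simp add: m ennreal_leI)
    qed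
    also have "\<dots> = ennreal e" by (simp add: Liminf_const)
    finally show ?thesis .
  qed
  have intg: "integrable M (\<lambda>x. (norm (f (N 0) x - g x))\<^sup>2)"
  proof (rule integrableI_bounded)
    have "(\<integral>\<^sup>+x. ennreal ((norm (f (N 0) x - g x))\<^sup>2) \<partial>M) \<le> ennreal 1"
      by (rule fatou[where K = "N 0"]) (use N[of 0 "N 0"] in \<open>auto intro: less_imp_le\<close>)
    also have "\<dots> < \<infinity>" by simp
    finally show "(\<integral>\<^sup>+x. ennreal (norm ((norm (f (N 0) x - g x))\<^sup>2)) \<partial>M) < \<infinity>" by simp
  qed measurable
  then have "L2 M (\<lambda>x. f (N 0) x - g x)" by (simp add: L2_def)
  from L2_diff[OF L2[of "N 0"] this] have g: "L2 M g" by simp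
  moreover have "(\<lambda>n. LINT x|M. (norm (f n x - g x))\<^sup>2) \<longlonglongrightarrow> 0"
  proof (rule LIMSEQ_I)
    fix e :: real assume "0 < e"
    then obtain K where K: "\<And>m n. m \<ge> K \<Longrightarrow> n \<ge> K \<Longrightarrow> D m n < e / 2"
      using cauchy[of "e / 2"] by (auto simp: D_def)
    have "norm ((LINT x|M. (norm (f n x - g x))\<^sup>2) - 0) < e" if "n \<ge> K" for n
    proof -
      have "ennreal (LINT x|M. (norm (f n x - g x))\<^sup>2) = (\<integral>\<^sup>+x. ennreal ((norm (f n x - g x))\<^sup>2) \<partial>M)"
        by (intro nn_integral_eq_integral[symmetric] L2_integrable_norm L2_diff L2 g) auto
      also have "\<dots> \<le> ennreal (e / 2)"
        by (rule fatou[where K = K]) (use \<open>0 < e\<close> that K in \<open>auto intro: less_imp_le\<close>)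
      finally show ?thesis using \<open>0 < e\<close> by simp
    qed
    then show "\<exists>no. \<forall>n\<ge>no. norm ((LINT x|M. (norm (f n x - g x))\<^sup>2) - 0) < e" by blast
  qed
  ultimately show ?thesis by (rule that)
qed

section \<open>Test functions\<close>

text \<open>These functions are Borel, so their integrals over \<open>lebesgue\<close> and
  \<open>lborel\<close> agree. This is the bridge between the definitions, stated over
  \<open>lebesgue\<close>, and changes of variables and Fubini arguments over
  \<open>lborel\<close>.\<close>

definition cont_csupp :: "('a::euclidean_space \<Rightarrow> 'b::euclidean_space) \<Rightarrow> bool" where
  "cont_csupp f \<longleftrightarrow> continuous_on UNIV f \<and> (\<exists>S. compact S \<and> (\<forall>x. x \<notin> S \<longrightarrow> f x = 0))"

lemma cont_csupp_measurable: "cont_csupp f \<Longrightarrow> f \<in> borel_measurable borel"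
  by (simp add: cont_csupp_def borel_measurable_continuous_onI)

lemma cont_csupp_integrable_lborel:
  assumes "cont_csupp f" shows "integrable lborel f"
proof -
  obtain S where S: "compact S" "\<And>x. x \<notin> S \<Longrightarrow> f x = 0" and f: "continuous_on UNIV f"
    using assms by (auto simp: cont_csupp_def)
  have "integrable lborel (\<lambda>x. indicator S x *\<^sub>R f x)"
    by (intro borel_integrable_compact S continuous_on_subset[OF f]) auto
  also have "(\<lambda>x. indicator S x *\<^sub>R f x) = f"
    using S(2) by (auto simp: indicator_def)
  finally show ?thesis .
qed

lemma cont_csupp_integrable: "cont_csupp f \<Longrightarrow> integrable lebesgue f"
  using cont_csupp_integrable_lborel cont_csupp_measurable by (subst integrable_completion) auto

lemma cont_csupp_lebesgue_lborel: "cont_csupp f \<Longrightarrow> (LINT x|lebesgue. f x) = (LINT x|lborel. f x)"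
  using cont_csupp_measurable by (subst integral_completion) auto

lemma cont_csupp_bounded:
  assumes "cont_csupp f" obtains B where "0 \<le> B" "\<And>x. norm (f x) \<le> B"
proof -
  obtain S where S: "compact S" "\<And>x. x \<notin> S \<Longrightarrow> f x = 0" and f: "continuous_on UNIV f"
    using assms by (auto simp: cont_csupp_def)
  have "compact (f ` S)"
    by (intro compact_continuous_image S continuous_on_subset[OF f]) auto
  then obtain B where B: "0 < B" "\<And>y. y \<in> f ` S \<Longrightarrow> norm y \<le> B"
    using compact_imp_bounded bounded_pos by metis
  have "norm (f x) \<le> B" for x
    using B S(2)[of x] by (cases "x \<in> S") auto
  with B(1) show ?thesis by (intro that[of B]) auto
qed

lemma cont_csupp_compose:
  assumes f: "cont_csupp f" and g: "continuous_on UNIV g"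
    and 0: "\<And>x. f x = 0 \<Longrightarrow> g x = 0"
  shows "cont_csupp g"
  using assms unfolding cont_csupp_def by metis

lemma cont_csupp_add:
  assumes "cont_csupp f" "cont_csupp g" shows "cont_csupp (\<lambda>x. f x + g x)"
proof -
  obtain S where S: "compact S" "\<And>x. x \<notin> S \<Longrightarrow> f x = 0" and f: "continuous_on UNIV f"
    using assms(1) by (auto simp: cont_csupp_def)
  obtain T where T: "compact T" "\<And>x. x \<notin> T \<Longrightarrow> g x = 0" and g: "continuous_on UNIV g"
    using assms(2) by (auto simp: cont_csupp_def)
  show ?thesis unfolding cont_csupp_def
    by (intro conjI continuous_intros f g exI[of _ "S \<union> T"] compact_Un S T allI impI) (simp add: S T)
qed

lemma cont_csupp_affine:
  assumes "cont_csupp f" "c \<noteq> 0" shows "cont_csupp (\<lambda>x. f (c *\<^sub>R x + a))"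
proof -
  obtain S where S: "compact S" "\<And>x. x \<notin> S \<Longrightarrow> f x = 0" and f: "continuous_on UNIV f"
    using assms(1) by (auto simp: cont_csupp_def)
  let ?T = "(\<lambda>y. (1 / c) *\<^sub>R (y - a)) ` S"
  have "compact ?T" by (intro compact_continuous_image S continuous_intros)
  moreover have "f (c *\<^sub>R x + a) = 0" if x: "x \<notin> ?T" for x
  proof (rule S(2), rule notI)
    assume "c *\<^sub>R x + a \<in> S"
    then have "(1 / c) *\<^sub>R ((c *\<^sub>R x + a) - a) \<in> ?T" by (rule imageI)
    then show False using x assms(2) by simp
  qed
  moreover have "continuous_on UNIV (\<lambda>x. f (c *\<^sub>R x + a))"
    by (intro continuous_on_compose2[OF f] continuous_intros) auto
  ultimately show ?thesis unfolding cont_csupp_def by blast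
qed

lemma lborel_integral_affine:
  fixes f :: "'a::euclidean_space \<Rightarrow> 'b::euclidean_space"
  assumes "c \<noteq> 0" and [measurable]: "f \<in> borel_measurable borel"
  shows "(LINT x|lborel. f x) = \<bar>c\<bar> ^ DIM('a) *\<^sub>R (LINT x|lborel. f (c *\<^sub>R x + a))"
proof -
  have "(LINT x|lborel. f x) = (LINT x|density (distr lborel borel (\<lambda>x. a + c *\<^sub>R x)) (\<lambda>_. \<bar>c\<bar>^DIM('a)). f x)"
    using lborel_affine[OF assms(1), of a] by simp
  also have "\<dots> = (LINT x|distr lborel borel (\<lambda>x. a + c *\<^sub>R x). \<bar>c\<bar> ^ DIM('a) *\<^sub>R f x)"
    by (subst integral_density) auto
  also have "\<dots> = (LINT x|lborel. \<bar>c\<bar> ^ DIM('a) *\<^sub>R f (a + c *\<^sub>R x))"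
    by (rule integral_distr) auto
  finally show ?thesis by (simp add: add.commute)
qed

lemma cont_csupp_integral_affine:
  fixes f :: "'a::euclidean_space \<Rightarrow> real"
  assumes "cont_csupp f" "c > 0"
  shows "(LINT x|lebesgue. f (c *\<^sub>R x + a)) = (LINT x|lebesgue. f x) / c ^ DIM('a)"
  using assms lborel_integral_affine[OF _ cont_csupp_measurable[OF assms(1)], of c a]
  by (simp add: cont_csupp_lebesgue_lborel cont_csupp_affine)

lemma cont_csupp_integral_translate:
  fixes f :: "'a::euclidean_space \<Rightarrow> real"
  assumes "cont_csupp f"
  shows "(LINT x|lebesgue. f (x + a)) = (LINT x|lebesgue. f x)"
  using cont_csupp_integral_affine[OF assms, of 1 a] by simp

lemma cont_csupp_translate: "cont_csupp f \<Longrightarrow> cont_csupp (\<lambda>x. f (x + a))"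
  using cont_csupp_affine[of f 1 a] by simp

text \<open>If the integral vanished, the zero set would have full measure; being closed, it would
  be the whole space.\<close>

lemma cont_csupp_integral_pos:
  fixes f :: "'a::euclidean_space \<Rightarrow> real"
  assumes f: "cont_csupp f" and nonneg: "\<And>x. 0 \<le> f x" and a: "0 < f a"
  shows "0 < (LINT x|lebesgue. f x)"
proof (rule ccontr)
  assume "\<not> ?thesis"
  then have "(LINT x|lebesgue. f x) = 0"
    using nonneg by (simp add: order_antisym_conv not_less)
  then have "AE x in lebesgue. f x = 0"
    using integral_nonneg_eq_0_iff_AE[OF cont_csupp_integrable[OF f]] nonneg by simp
  then have "AE x in lebesgue. x \<in> {x. f x = 0}" by simp
  moreover have "closed {x. f x = 0}"
    using f by (intro closed_Collect_eq continuous_on_const) (auto simp: cont_csupp_def)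
  ultimately have "a \<in> {x. f x = 0}" by (intro mem_closed_if_AE_lebesgue)
  then show False using a by simp
qed

text \<open>Any compact set carrying the function may replace the closure of its support; this form
  is stable under sums and products and is used throughout.\<close>

lemma test_fun_iff:
  "test_fun \<Omega> \<phi> \<longleftrightarrow> smooth \<phi> \<and> (\<exists>S. compact S \<and> S \<subseteq> \<Omega> \<and> (\<forall>x. x \<notin> S \<longrightarrow> \<phi> x = 0))"
proof
  assume "test_fun \<Omega> \<phi>"
  then show "smooth \<phi> \<and> (\<exists>S. compact S \<and> S \<subseteq> \<Omega> \<and> (\<forall>x. x \<notin> S \<longrightarrow> \<phi> x = 0))"
    unfolding test_fun_def using closure_subset[of "{x. \<phi> x \<noteq> 0}"] by blast
next
  assume "smooth \<phi> \<and> (\<exists>S. compact S \<and> S \<subseteq> \<Omega> \<and> (\<forall>x. x \<notin> S \<longrightarrow> \<phi> x = 0))"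
  then obtain S where S: "smooth \<phi>" "compact S" "S \<subseteq> \<Omega>" "\<And>x. x \<notin> S \<Longrightarrow> \<phi> x = 0" by blast
  have sub: "closure {x. \<phi> x \<noteq> 0} \<subseteq> S"
    by (rule closure_minimal) (use S compact_imp_closed in auto)
  then have "compact (closure {x. \<phi> x \<noteq> 0})"
    by (metis S(2) closed_closure closed_Int_compact inf.absorb1)
  then show "test_fun \<Omega> \<phi>" unfolding test_fun_def using S(1,3) sub by auto
qed

lemma test_fun_smooth: "test_fun \<Omega> \<phi> \<Longrightarrow> smooth \<phi>"
  by (simp add: test_fun_def)

lemma test_fun_mono: "test_fun A \<phi> \<Longrightarrow> A \<subseteq> B \<Longrightarrow> test_fun B \<phi>"
  by (auto simp: test_fun_def)

lemma test_fun_zero_outside: "test_fun \<Omega> \<phi> \<Longrightarrow> x \<notin> \<Omega> \<Longrightarrow> \<phi> x = 0"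
  by (auto simp: test_fun_iff)

lemma test_fun_compose:
  assumes "test_fun \<Omega> \<phi>" "smooth \<psi>" "\<And>x. \<phi> x = 0 \<Longrightarrow> \<psi> x = 0"
  shows "test_fun \<Omega> \<psi>"
  using assms unfolding test_fun_iff by metis

lemma test_fun_add:
  assumes "test_fun \<Omega> f" "test_fun \<Omega> g" shows "test_fun \<Omega> (\<lambda>x. f x + g x)"
proof -
  obtain S where S: "compact S" "S \<subseteq> \<Omega>" "\<And>x. x \<notin> S \<Longrightarrow> f x = 0" and f: "smooth f"
    using assms(1) by (auto simp: test_fun_iff)
  obtain T where T: "compact T" "T \<subseteq> \<Omega>" "\<And>x. x \<notin> T \<Longrightarrow> g x = 0" and g: "smooth g"
    using assms(2) by (auto simp: test_fun_iff)
  show ?thesis unfolding test_fun_iff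
    by (intro conjI smooth_add f g exI[of _ "S \<union> T"] compact_Un S T allI impI Un_least) (simp add: S T)
qed

lemma test_fun_cmult: "test_fun \<Omega> f \<Longrightarrow> test_fun \<Omega> (\<lambda>x. c * f x)"
  by (rule test_fun_compose) (auto intro: smooth_mult smooth_const test_fun_smooth)

lemma test_fun_diff:
  assumes "test_fun \<Omega> f" "test_fun \<Omega> g" shows "test_fun \<Omega> (\<lambda>x. f x - g x)"
  using test_fun_add[OF assms(1) test_fun_cmult[OF assms(2), of "-1"]] by simp

lemma test_fun_sum:
  assumes "finite I" "\<And>i. i \<in> I \<Longrightarrow> test_fun \<Omega> (f i)" shows "test_fun \<Omega> (\<lambda>x. \<Sum>i\<in>I. f i x)"
  using assms
proof (induction I rule: finite_induct)
  case empty
  show ?case by (auto simp: test_fun_iff intro!: exI[of _ "{}"])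
next
  case (insert i I)
  have "test_fun \<Omega> (\<lambda>x. f i x + (\<Sum>i\<in>I. f i x))"
    by (rule test_fun_add) (simp_all add: insert)
  then show ?case using insert by simp
qed

lemma test_fun_cont_csupp: "test_fun \<Omega> \<phi> \<Longrightarrow> cont_csupp \<phi>"
  unfolding test_fun_iff cont_csupp_def using smooth_continuous by blast

lemma grad_eq_0_outside:
  assumes "closed S" "\<And>x. x \<notin> S \<Longrightarrow> \<phi> x = 0" "x \<notin> S"
  shows "grad \<phi> x = 0"
proof (rule grad_eqI)
  have "((\<lambda>_. 0) has_derivative (\<lambda>h. 0 \<bullet> h)) (at x)" by simp
  then show "(\<phi> has_derivative (\<lambda>h. 0 \<bullet> h)) (at x)"
    by (rule has_derivative_transform_within_open[where s = "- S"]) (use assms in auto)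
qed

lemma test_fun_grad_inner:
  assumes "test_fun \<Omega> f" shows "test_fun \<Omega> (\<lambda>x. grad f x \<bullet> h)"
proof -
  obtain S where S: "compact S" "S \<subseteq> \<Omega>" "\<And>x. x \<notin> S \<Longrightarrow> f x = 0" and f: "smooth f"
    using assms by (auto simp: test_fun_iff)
  have "\<forall>x. x \<notin> S \<longrightarrow> grad f x \<bullet> h = 0"
    using grad_eq_0_outside[OF compact_imp_closed[OF S(1)] S(3)] by simp
  then show ?thesis
    unfolding test_fun_iff using smooth_grad_inner[OF f] S(1,2) by blast
qed

lemma test_fun_cont_csupp_grad:
  assumes "test_fun \<Omega> \<phi>" shows "cont_csupp (grad \<phi>)"
proof -
  obtain S where S: "compact S" "\<And>x. x \<notin> S \<Longrightarrow> \<phi> x = 0" and f: "smooth \<phi>"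
    using assms by (auto simp: test_fun_iff)
  have "\<forall>x. x \<notin> S \<longrightarrow> grad \<phi> x = 0"
    using grad_eq_0_outside[OF compact_imp_closed[OF S(1)] S(2)] by simp
  then show ?thesis
    unfolding cont_csupp_def using smooth_continuous_grad[OF f] S(1) by blast
qed

lemma cont_csupp_L2:
  fixes f :: "'a::euclidean_space \<Rightarrow> 'b::euclidean_space"
  assumes "cont_csupp f" shows "L2 lebesgue f"
proof -
  have c: "continuous_on UNIV f" using assms by (simp add: cont_csupp_def)
  have "cont_csupp (\<lambda>x. (norm (f x))\<^sup>2)"
    by (rule cont_csupp_compose[OF assms]) (auto intro!: continuous_intros c)
  moreover have "f \<in> borel_measurable lebesgue"
    using cont_csupp_measurable[OF assms] by (simp add: measurable_completion)
  ultimately show ?thesis by (simp add: L2_def cont_csupp_integrable)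
qed

lemma test_fun_L2: "test_fun \<Omega> \<phi> \<Longrightarrow> L2 lebesgue \<phi>"
  and test_fun_L2_grad: "test_fun \<Omega> \<phi> \<Longrightarrow> L2 lebesgue (grad \<phi>)"
  by (auto intro: cont_csupp_L2 test_fun_cont_csupp test_fun_cont_csupp_grad)

lemma test_fun_integrable: "test_fun \<Omega> \<phi> \<Longrightarrow> integrable lebesgue \<phi>"
  by (intro cont_csupp_integrable test_fun_cont_csupp)

text \<open>The quotient \<open>a / (a + b)\<close>, where \<open>a\<close> is positive exactly for
  \<open>norm x < 2\<close> and \<open>b\<close> exactly for \<open>norm x > 1\<close>. The two
  regions cover the space, so the denominator never vanishes and its reciprocal is smooth.\<close>

lemma ex_cutoff:
  "\<exists>\<eta>::'a::euclidean_space \<Rightarrow> real. test_fun (cball 0 2) \<eta> \<and> (\<forall>x. 0 \<le> \<eta> x) \<and> (\<forall>x. norm x \<le> 1 \<longrightarrow> \<eta> x = 1)"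
proof -
  let ?a = "\<lambda>x::'a. flat 0 (4 - (norm x)\<^sup>2)"
  let ?b = "\<lambda>x::'a. flat 0 ((norm x)\<^sup>2 - 1)"
  define \<eta> where "\<eta> = (\<lambda>x::'a. ?a x * (?a x + ?b x) powr (-1))"
  have sa: "smooth ?a" by (intro smooth_flat smooth_diff smooth_const smooth_norm2)
  have sb: "smooth ?b" by (intro smooth_flat smooth_diff smooth_const smooth_norm2)
  have pos: "0 < ?a x + ?b x" for x
    by (cases "(norm x)\<^sup>2 < 4") (auto simp: flat_def add_nonneg_pos add_pos_nonneg)
  have s: "smooth \<eta>" unfolding \<eta>_def
    by (intro smooth_mult sa smooth_powr smooth_add sb pos)
  have z: "\<eta> x = 0" if "x \<notin> cball 0 2" for x
  proof -
    have "2\<^sup>2 < (norm x)\<^sup>2" using that by (intro power_strict_mono) auto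
    then show ?thesis by (simp add: \<eta>_def flat_def)
  qed
  have o: "\<eta> x = 1" if "norm x \<le> 1" for x
  proof -
    have "(norm x)\<^sup>2 \<le> 1" using that power_le_one[of "norm x" 2] by simp
    then show ?thesis using pos[of x] by (simp add: \<eta>_def flat_def powr_minus)
  qed
  have "test_fun (cball 0 2) \<eta>"
    unfolding test_fun_iff using s z by (auto intro!: exI[of _ "cball 0 2"])
  moreover have "\<forall>x. 0 \<le> \<eta> x" by (simp add: \<eta>_def flat_nonneg)
  ultimately show ?thesis using o by blast
qed

lemma test_fun_affine:
  assumes "test_fun \<Omega> \<phi>" "c \<noteq> 0"
  shows "test_fun ((\<lambda>y. (1 / c) *\<^sub>R (y - a)) ` \<Omega>) (\<lambda>x. \<phi> (c *\<^sub>R x + a))"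
proof -
  obtain S where S: "compact S" "S \<subseteq> \<Omega>" "\<And>x. x \<notin> S \<Longrightarrow> \<phi> x = 0" and f: "smooth \<phi>"
    using assms(1) by (auto simp: test_fun_iff)
  let ?T = "(\<lambda>y. (1 / c) *\<^sub>R (y - a)) ` S"
  have "compact ?T" by (intro compact_continuous_image S continuous_intros)
  moreover have "\<phi> (c *\<^sub>R x + a) = 0" if x: "x \<notin> ?T" for x
  proof (rule S(3), rule notI)
    assume "c *\<^sub>R x + a \<in> S"
    then have "(1 / c) *\<^sub>R ((c *\<^sub>R x + a) - a) \<in> ?T" by (rule imageI)
    then show False using x assms(2) by simp
  qed
  moreover have "?T \<subseteq> (\<lambda>y. (1 / c) *\<^sub>R (y - a)) ` \<Omega>" using S(2) by (rule image_mono)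
  ultimately show ?thesis unfolding test_fun_iff using smooth_affine[OF f] by blast
qed

lemma ex_test_fun:
  fixes \<Omega> :: "'a::euclidean_space set"
  assumes "open \<Omega>" "a \<in> \<Omega>"
  obtains \<phi> where "test_fun \<Omega> \<phi>" "\<And>x. 0 \<le> \<phi> x" "\<phi> a = 1"
proof -
  obtain e where e: "0 < e" "cball a e \<subseteq> \<Omega>" using assms open_contains_cball by metis
  obtain \<eta> :: "'a \<Rightarrow> real" where \<eta>: "test_fun (cball 0 2) \<eta>" "\<And>x. 0 \<le> \<eta> x" "\<And>x. norm x \<le> 1 \<Longrightarrow> \<eta> x = 1"
    using ex_cutoff by blast
  \<comment> \<open>With this factor \<open>x \<mapsto> c *\<^sub>R (x - a)\<close> carries
    \<open>cball a e\<close> onto \<open>cball 0 2\<close>.\<close>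
  define c where "c = 2 / e"
  have c: "c \<noteq> 0" using e by (simp add: c_def)
  have "(\<lambda>y. (1 / c) *\<^sub>R (y - (- c *\<^sub>R a))) ` cball 0 2 \<subseteq> cball a e"
  proof (rule image_subsetI)
    fix y :: 'a assume y: "y \<in> cball 0 2"
    have "(1 / c) *\<^sub>R (y - (- c *\<^sub>R a)) = a + (e / 2) *\<^sub>R y"
      using e by (simp add: c_def algebra_simps)
    then show "(1 / c) *\<^sub>R (y - (- c *\<^sub>R a)) \<in> cball a e"
      using y e by (simp add: dist_norm)
  qed
  from test_fun_mono[OF test_fun_affine[OF \<eta>(1) c] subset_trans[OF this e(2)]]
  have "test_fun \<Omega> (\<lambda>x. \<eta> (c *\<^sub>R x + - c *\<^sub>R a))" .
  then show ?thesis by (rule that) (auto simp: \<eta>)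
qed

section \<open>Translations and integration by parts\<close>

text \<open>Dominated convergence: the difference quotients are bounded by the Lipschitz constant
  times \<open>norm h\<close> and vanish off one common compact set. The function
  \<open>\<Phi>\<close> is the identity for the integral of a derivative and the square for the
  translation estimate.\<close>

lemma test_fun_diffquot_tendsto:
  fixes f :: "'a::euclidean_space \<Rightarrow> real" and \<Phi> :: "real \<Rightarrow> real"
  assumes f: "test_fun UNIV f" and \<Phi>: "continuous_on UNIV \<Phi>" "\<Phi> 0 = 0"
  shows "(\<lambda>n. LINT x|lborel. \<Phi> (real (Suc n) * (f (x + (1 / real (Suc n)) *\<^sub>R h) - f x)))
    \<longlonglongrightarrow> (LINT x|lborel. \<Phi> (grad f x \<bullet> h))"
proof -
  obtain S where S: "compact S" "\<And>x. x \<notin> S \<Longrightarrow> f x = 0" and sm: "smooth f"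
    using f by (auto simp: test_fun_iff)
  obtain B where B: "0 \<le> B" "\<And>x. norm (grad f x) \<le> B"
    using cont_csupp_bounded[OF test_fun_cont_csupp_grad[OF f]] by metis
  have lip: "\<bar>f x - f y\<bar> \<le> B * norm (x - y)" for x y
  proof -
    have "norm (f x - f y) \<le> B * norm (x - y)"
    proof (rule differentiable_bound[where S = UNIV and f' = "\<lambda>x h. grad f x \<bullet> h"])
      fix x
      show "(f has_derivative (\<bullet>) (grad f x)) (at x)" by (rule smooth_has_grad[OF sm])
      show "onorm ((\<bullet>) (grad f x)) \<le> B"
      proof (rule onorm_bound[OF B(1)])
        fix y
        have "norm (grad f x \<bullet> y) \<le> norm (grad f x) * norm y" by (simp add: Cauchy_Schwarz_ineq2)
        also have "\<dots> \<le> B * norm y" by (intro mult_right_mono B) auto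
        finally show "norm (grad f x \<bullet> y) \<le> B * norm y" .
      qed
    qed auto
    then show ?thesis by simp
  qed
  define D where "D n x = real (Suc n) * (f (x + (1 / real (Suc n)) *\<^sub>R h) - f x)" for n x
  have Db: "\<bar>D n x\<bar> \<le> B * norm h" for n x
  proof -
    have "\<bar>D n x\<bar> = real (Suc n) * \<bar>f (x + (1 / real (Suc n)) *\<^sub>R h) - f x\<bar>"
      by (simp add: D_def abs_mult)
    also have "\<dots> \<le> real (Suc n) * (B * norm ((1 / real (Suc n)) *\<^sub>R h))"
      using lip[of "x + (1 / real (Suc n)) *\<^sub>R h" x] by (intro mult_left_mono) auto
    also have "\<dots> = B * norm h" by (simp add: field_simps)
    finally show ?thesis .
  qed
  have "compact (\<Phi> ` {- (B * norm h)..B * norm h})"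
    by (intro compact_continuous_image continuous_on_subset[OF \<Phi>(1)]) auto
  then obtain C where C0: "\<And>y. y \<in> \<Phi> ` {- (B * norm h)..B * norm h} \<Longrightarrow> norm y \<le> C"
    using compact_imp_bounded bounded_pos by metis
  have C: "\<bar>\<Phi> t\<bar> \<le> C" if "\<bar>t\<bar> \<le> B * norm h" for t
  proof -
    have "\<Phi> t \<in> \<Phi> ` {- (B * norm h)..B * norm h}" using that by (intro imageI) auto
    from C0[OF this] show ?thesis by simp
  qed
  \<comment> \<open>Every step \<open>(1 / real (Suc n)) *\<^sub>R h\<close> has length at most
    \<open>norm h\<close>, so this thickening of \<open>S\<close> works for all \<open>n\<close> at
    once.\<close>
  define T where "T = {x + y | x y. x \<in> S \<and> y \<in> cball 0 (norm h)}"
  have T: "compact T" unfolding T_def by (intro compact_sums S compact_cball)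
  have D0: "D n x = 0" if x: "x \<notin> T" for n x
  proof -
    have "x \<notin> S" using x by (force simp: T_def)
    moreover have "x + (1 / real (Suc n)) *\<^sub>R h \<notin> S"
    proof
      assume *: "x + (1 / real (Suc n)) *\<^sub>R h \<in> S"
      have "x = (x + (1 / real (Suc n)) *\<^sub>R h) + - ((1 / real (Suc n)) *\<^sub>R h)" by simp
      moreover have "- ((1 / real (Suc n)) *\<^sub>R h) \<in> cball 0 (norm h)"
        by (simp add: field_simps mult_left_le_one_le)
      ultimately have "x \<in> T" unfolding T_def using * by blast
      then show False using x by simp
    qed
    ultimately show ?thesis by (simp add: D_def S)
  qed
  have cf: "continuous_on UNIV f" by (rule smooth_continuous[OF sm])
  have cD: "continuous_on UNIV (D n)" for n
    unfolding D_def by (intro continuous_intros continuous_on_compose2[OF cf]) auto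
  show ?thesis
    unfolding D_def[symmetric]
  proof (rule integral_dominated_convergence[where w = "\<lambda>x. C * indicator T x"])
    show "(\<lambda>x. \<Phi> (grad f x \<bullet> h)) \<in> borel_measurable lborel"
      using continuous_on_compose2[OF \<Phi>(1) smooth_continuous[OF smooth_grad_inner[OF sm, of h]], of UNIV]
      by (simp add: borel_measurable_continuous_onI)
    show "(\<lambda>x. \<Phi> (D n x)) \<in> borel_measurable lborel" for n
      using continuous_on_compose2[OF \<Phi>(1) cD] by (simp add: borel_measurable_continuous_onI)
    show "integrable lborel (\<lambda>x. C * indicator T x)"
      using T emeasure_compact_finite[OF T] borel_compact[OF T]
      by (intro integrable_mult_right integrable_real_indicator) auto
    show "AE x in lborel. norm (\<Phi> (D n x)) \<le> C * indicator T x" for n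
    proof (rule AE_I2)
      fix x
      show "norm (\<Phi> (D n x)) \<le> C * indicator T x"
        using C[OF Db[of n x]] D0[of x n] \<Phi>(2) by (cases "x \<in> T") auto
    qed
    show "AE x in lborel. (\<lambda>n. \<Phi> (D n x)) \<longlonglongrightarrow> \<Phi> (grad f x \<bullet> h)"
    proof (rule AE_I2)
      fix x
      have "((\<lambda>t. x + t *\<^sub>R h) has_derivative (\<lambda>t. t *\<^sub>R h)) (at 0)"
        by (auto intro!: derivative_eq_intros)
      from has_derivative_compose[OF this, of f "\<lambda>v. grad f x \<bullet> v"] smooth_has_grad[OF sm, of x]
      have "((\<lambda>t. f (x + t *\<^sub>R h)) has_derivative (\<lambda>t. grad f x \<bullet> (t *\<^sub>R h))) (at 0)" by simp
      then have "DERIV (\<lambda>t. f (x + t *\<^sub>R h)) 0 :> grad f x \<bullet> h"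
        by (simp add: has_field_derivative_def mult_commute_abs)
      then have lim: "((\<lambda>t. (f (x + t *\<^sub>R h) - f x) / t) \<longlongrightarrow> grad f x \<bullet> h) (at 0)"
        by (simp add: DERIV_def)
      have "filterlim (\<lambda>n. 1 / real (Suc n)) (at 0) sequentially"
        by (rule filterlim_atI) (use LIMSEQ_inverse_real_of_nat in \<open>auto simp: inverse_eq_divide\<close>)
      from filterlim_compose[OF lim this]
      have "(\<lambda>n. D n x) \<longlonglongrightarrow> grad f x \<bullet> h" by (simp add: D_def mult.commute)
      then show "(\<lambda>n. \<Phi> (D n x)) \<longlonglongrightarrow> \<Phi> (grad f x \<bullet> h)"
        by (rule continuous_on_tendsto_compose[OF \<Phi>(1)]) auto
    qed
  qed
qed

text \<open>Translation invariance makes the integral of every difference quotient zero, and this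
  survives the limit.\<close>

lemma test_fun_integral_grad:
  fixes f :: "'a::euclidean_space \<Rightarrow> real"
  assumes f: "test_fun UNIV f"
  shows "(LINT x|lebesgue. grad f x \<bullet> h) = 0"
proof -
  have cc: "cont_csupp f" using f by (rule test_fun_cont_csupp)
  have "(LINT x|lborel. real (Suc n) * (f (x + (1 / real (Suc n)) *\<^sub>R h) - f x)) = 0" for n
    using cont_csupp_integral_translate[OF cc, of "(1 / real (Suc n)) *\<^sub>R h"]
    by (simp add: cont_csupp_lebesgue_lborel cc cont_csupp_translate cont_csupp_integrable_lborel)
  then have "(LINT x|lborel. grad f x \<bullet> h) = 0"
    using test_fun_diffquot_tendsto[OF f, of "\<lambda>t. t" h] by (simp add: LIMSEQ_const_iff)
  moreover have "cont_csupp (\<lambda>x. grad f x \<bullet> h)"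
    by (rule cont_csupp_compose[OF test_fun_cont_csupp_grad[OF f]])
       (auto intro: smooth_continuous smooth_grad_inner test_fun_smooth f)
  ultimately show ?thesis by (simp add: cont_csupp_lebesgue_lborel)
qed

lemma cont_csupp_square: "cont_csupp f \<Longrightarrow> cont_csupp (\<lambda>x. (f x)\<^sup>2)" for f :: "'a::euclidean_space \<Rightarrow> real"
  by (rule cont_csupp_compose) (auto simp: cont_csupp_def intro!: continuous_intros)

lemma cont_csupp_diff:
  assumes "cont_csupp f" "cont_csupp g" shows "cont_csupp (\<lambda>x. f x - g x)"
  using cont_csupp_add[OF assms(1), of "\<lambda>x. - g x"] assms(2)
  by (simp add: cont_csupp_def continuous_on_minus)

lemma cont_csupp_norm2: "cont_csupp f \<Longrightarrow> cont_csupp (\<lambda>x. (norm (f x))\<^sup>2)"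
  by (rule cont_csupp_compose) (auto simp: cont_csupp_def intro!: continuous_intros)

text \<open>Split the translation by \<open>h\<close> into \<open>n\<close> steps: each contributes the same \<open>L\<^sup>2\<close> increment, and
  \<open>n\<close> times that increment converges to the directional derivative.\<close>

lemma test_fun_translation_estimate:
  fixes f :: "'a::euclidean_space \<Rightarrow> real"
  assumes f: "test_fun UNIV f"
  shows "(LINT x|lebesgue. (f (x + h) - f x)\<^sup>2) \<le> (norm h)\<^sup>2 * (LINT x|lebesgue. (norm (grad f x))\<^sup>2)"
proof -
  have cc: "cont_csupp f" using f by (rule test_fun_cont_csupp)
  have ccg: "cont_csupp (grad f)" using f by (rule test_fun_cont_csupp_grad)
  have cd: "cont_csupp (\<lambda>x. (f (x + k) - f x)\<^sup>2)" for k
    by (intro cont_csupp_square cont_csupp_diff cont_csupp_translate cc)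
  have le: "(LINT x|lebesgue. (f (x + h) - f x)\<^sup>2) \<le>
      (LINT x|lborel. (real (Suc n) * (f (x + (1 / real (Suc n)) *\<^sub>R h) - f x))\<^sup>2)" for n
  proof -
    define k where "k = (1 / real (Suc n)) *\<^sub>R h"
    define d where "d x = f (x + k) - f x" for x
    have kh: "real (Suc n) *\<^sub>R k = h" by (simp add: k_def)
    have ci: "cont_csupp (\<lambda>x. (d (x + real i *\<^sub>R k))\<^sup>2)" for i
      unfolding d_def using cont_csupp_translate[OF cd] by simp
    have "(f (x + h) - f x)\<^sup>2 \<le> real (Suc n) * (\<Sum>i<Suc n. (d (x + real i *\<^sub>R k))\<^sup>2)" for x
    proof -
      have "(\<Sum>i<Suc n. d (x + real i *\<^sub>R k)) = (\<Sum>i<Suc n. f (x + real (Suc i) *\<^sub>R k) - f (x + real i *\<^sub>R k))"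
        by (intro sum.cong) (simp_all add: d_def algebra_simps)
      also have "\<dots> = f (x + h) - f x"
        unfolding sum_lessThan_telescope[of "\<lambda>i. f (x + real i *\<^sub>R k)"] kh by simp
      finally have "(f (x + h) - f x)\<^sup>2 = (\<Sum>i<Suc n. d (x + real i *\<^sub>R k))\<^sup>2" by simp
      \<comment> \<open>Cauchy-Schwarz costs one factor \<open>Suc n\<close> and the sum of equal
        integrals another; together they are exactly absorbed by the scaling of the difference
        quotient.\<close>
      also have "\<dots> \<le> (\<Sum>i<Suc n. (d (x + real i *\<^sub>R k))\<^sup>2) * card {..<Suc n}"
        by (rule sum_squared_le_sum_of_squares)
      finally show ?thesis by (simp add: mult.commute)
    qed
    then have "(LINT x|lebesgue. (f (x + h) - f x)\<^sup>2) \<le>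
        (LINT x|lebesgue. real (Suc n) * (\<Sum>i<Suc n. (d (x + real i *\<^sub>R k))\<^sup>2))"
      by (intro integral_mono integrable_mult_right Bochner_Integration.integrable_sum cont_csupp_integrable cd ci) auto
    also have "\<dots> = real (Suc n) * (\<Sum>i<Suc n. LINT x|lebesgue. (d (x + real i *\<^sub>R k))\<^sup>2)"
      by (subst integral_mult_right_zero, subst Bochner_Integration.integral_sum) (auto intro: cont_csupp_integrable ci)
    also have "\<dots> = real (Suc n) * (\<Sum>i<Suc n. LINT x|lebesgue. (d x)\<^sup>2)"
      using cont_csupp_integral_translate[OF cd[of k]] unfolding d_def by simp
    also have "\<dots> = (real (Suc n))\<^sup>2 * (LINT x|lebesgue. (d x)\<^sup>2)"
      by (simp add: power2_eq_square)
    also have "\<dots> = (LINT x|lborel. (real (Suc n) * d x)\<^sup>2)"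
      unfolding d_def by (simp add: cont_csupp_lebesgue_lborel[OF cd] power_mult_distrib)
    finally show ?thesis by (simp add: d_def k_def)
  qed
  have "(\<lambda>n. LINT x|lborel. (real (Suc n) * (f (x + (1 / real (Suc n)) *\<^sub>R h) - f x))\<^sup>2)
      \<longlonglongrightarrow> (LINT x|lborel. (grad f x \<bullet> h)\<^sup>2)"
    by (rule test_fun_diffquot_tendsto[OF f, of "\<lambda>t. t\<^sup>2"]) (auto intro!: continuous_intros)
  then have "(LINT x|lebesgue. (f (x + h) - f x)\<^sup>2) \<le> (LINT x|lborel. (grad f x \<bullet> h)\<^sup>2)"
    by (rule LIMSEQ_le_const) (use le in auto)
  also have "\<dots> \<le> (LINT x|lborel. (norm h)\<^sup>2 * (norm (grad f x))\<^sup>2)"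
  proof (rule integral_mono)
    have "cont_csupp (\<lambda>x. grad f x \<bullet> h)"
      by (rule cont_csupp_compose[OF ccg]) (auto intro: smooth_continuous smooth_grad_inner test_fun_smooth f)
    then show "integrable lborel (\<lambda>x. (grad f x \<bullet> h)\<^sup>2)"
      by (intro cont_csupp_integrable_lborel cont_csupp_square)
    show "integrable lborel (\<lambda>x. (norm h)\<^sup>2 * (norm (grad f x))\<^sup>2)"
      by (intro integrable_mult_right cont_csupp_integrable_lborel cont_csupp_norm2 ccg)
    fix x
    have "\<bar>grad f x \<bullet> h\<bar>\<^sup>2 \<le> (norm (grad f x) * norm h)\<^sup>2"
      by (intro power_mono Cauchy_Schwarz_ineq2) auto
    then show "(grad f x \<bullet> h)\<^sup>2 \<le> (norm h)\<^sup>2 * (norm (grad f x))\<^sup>2"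
      by (simp add: power_mult_distrib mult.commute)
  qed
  also have "\<dots> = (norm h)\<^sup>2 * (LINT x|lebesgue. (norm (grad f x))\<^sup>2)"
    by (simp add: cont_csupp_lebesgue_lborel cont_csupp_norm2 ccg)
  finally show ?thesis .
qed

section \<open>The Laplacian and integration by parts\<close>

definition laplacian :: "('a::euclidean_space \<Rightarrow> real) \<Rightarrow> 'a \<Rightarrow> real" where
  "laplacian f x = (\<Sum>b\<in>Basis. grad (\<lambda>y. grad f y \<bullet> b) x \<bullet> b)"

lemma test_fun_laplacian:
  assumes "test_fun \<Omega> f" shows "test_fun \<Omega> (laplacian f)"
  unfolding laplacian_def[abs_def]
  by (intro test_fun_sum finite_Basis test_fun_grad_inner[OF test_fun_grad_inner[OF assms]])

lemma integral_laplacian: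
  assumes "test_fun \<Omega> f" shows "(LINT x|lebesgue. laplacian f x) = 0"
proof -
  note t = test_fun_grad_inner[OF test_fun_mono[OF assms subset_UNIV]]
  have "(LINT x|lebesgue. laplacian f x) = (\<Sum>b\<in>Basis. LINT x|lebesgue. grad (\<lambda>y. grad f y \<bullet> b) x \<bullet> b)"
    unfolding laplacian_def
    by (rule Bochner_Integration.integral_sum) (rule test_fun_integrable[OF test_fun_grad_inner[OF t]])
  then show ?thesis by (simp add: test_fun_integral_grad t)
qed

text \<open>The field \<open>f *\<^sub>R grad g\<close> has compact support, so the integral of its
  divergence \<open>f * laplacian g + grad f \<bullet> grad g\<close> is zero, component by
  component.\<close>

lemma test_fun_integral_by_parts:
  fixes f g :: "'a::euclidean_space \<Rightarrow> real"
  assumes f: "test_fun \<Omega> f" and g: "test_fun \<Omega> g"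
  shows "(LINT x|lebesgue. grad f x \<bullet> grad g x) = - (LINT x|lebesgue. f x * laplacian g x)"
proof -
  have sf: "smooth f" and sg: "smooth g" using f g by (auto intro: test_fun_smooth)
  define F where "F b = (\<lambda>x. f x * (grad g x \<bullet> b))" for b
  have F: "test_fun UNIV (F b)" for b
    unfolding F_def
    by (rule test_fun_compose[OF test_fun_mono[OF f subset_UNIV]],
        rule smooth_mult[OF sf smooth_grad_inner[OF sg]]) simp
  have gF: "grad (F b) x \<bullet> b = f x * (grad (\<lambda>y. grad g y \<bullet> b) x \<bullet> b) + (grad g x \<bullet> b) * (grad f x \<bullet> b)" for b x
    unfolding F_def by (simp add: grad_mult[OF sf smooth_grad_inner[OF sg]] inner_add_left)
  have "(\<Sum>b\<in>Basis. grad (F b) x \<bullet> b) = f x * laplacian g x + grad f x \<bullet> grad g x" for x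
    using euclidean_inner[of "grad f x" "grad g x"]
    by (simp add: gF sum.distrib laplacian_def sum_distrib_left mult.commute)
  then have "(LINT x|lebesgue. f x * laplacian g x + grad f x \<bullet> grad g x)
      = (LINT x|lebesgue. (\<Sum>b\<in>Basis. grad (F b) x \<bullet> b))" by simp
  also have "\<dots> = (\<Sum>b\<in>Basis. LINT x|lebesgue. grad (F b) x \<bullet> b)"
    by (rule Bochner_Integration.integral_sum) (rule test_fun_integrable[OF test_fun_grad_inner[OF F]])
  also have "\<dots> = 0" by (simp add: test_fun_integral_grad F)
  finally have "(LINT x|lebesgue. f x * laplacian g x + grad f x \<bullet> grad g x) = 0" .
  moreover have "integrable lebesgue (\<lambda>x. f x * laplacian g x)"
    using L2_integrable_inner[OF test_fun_L2[OF f] test_fun_L2[OF test_fun_laplacian[OF g]]] by simp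
  ultimately show ?thesis
    using L2_integrable_inner[OF test_fun_L2_grad[OF f] test_fun_L2_grad[OF g]] by simp
qed

section \<open>The first eigenvalue and the torsion function\<close>

lemma H01_L2:
  assumes "H01 \<Omega> u g" shows "L2 lebesgue u" "L2 lebesgue g"
  using assms by (auto simp: H01_def L2_def)

lemma H01_approx:
  assumes "H01 \<Omega> u g"
  obtains \<phi> where "\<And>n. test_fun \<Omega> (\<phi> n)"
    "(\<lambda>n. LINT x|lebesgue. (norm (\<phi> n x - u x))\<^sup>2) \<longlonglongrightarrow> 0"
    "(\<lambda>n. LINT x|lebesgue. (norm (grad (\<phi> n) x - g x))\<^sup>2) \<longlonglongrightarrow> 0"
  using assms by (auto simp: H01_def)

lemma H01_I:
  assumes "L2 lebesgue u" "L2 lebesgue g" "\<And>n. test_fun \<Omega> (\<phi> n)"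
    "(\<lambda>n. LINT x|lebesgue. (norm (\<phi> n x - u x))\<^sup>2) \<longlonglongrightarrow> 0"
    "(\<lambda>n. LINT x|lebesgue. (norm (grad (\<phi> n) x - g x))\<^sup>2) \<longlonglongrightarrow> 0"
  shows "H01 \<Omega> u g"
  using assms unfolding H01_def L2_def by auto

lemma test_fun_H01: "test_fun \<Omega> \<phi> \<Longrightarrow> H01 \<Omega> \<phi> (grad \<phi>)"
  by (rule H01_I[where \<phi> = "\<lambda>_. \<phi>"]) (auto intro: test_fun_L2 test_fun_L2_grad)

lemma lambda1_bdd_below:
  "bdd_below {(LINT x|lebesgue. (norm (g x))\<^sup>2) / (LINT x|lebesgue. (u x)\<^sup>2) | u g.
       H01 \<Omega> u g \<and> (LINT x|lebesgue. (u x)\<^sup>2) \<noteq> 0}"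
  by (rule bdd_belowI[of _ 0]) auto

lemma lambda1_le:
  assumes "H01 \<Omega> u g"
  shows "lambda1 \<Omega> * (LINT x|lebesgue. (u x)\<^sup>2) \<le> (LINT x|lebesgue. (norm (g x))\<^sup>2)"
proof (cases "(LINT x|lebesgue. (u x)\<^sup>2) = 0")
  case False
  have "0 \<le> (LINT x|lebesgue. (u x)\<^sup>2)" by simp
  with False have "0 < (LINT x|lebesgue. (u x)\<^sup>2)" by linarith
  moreover have "lambda1 \<Omega> \<le> (LINT x|lebesgue. (norm (g x))\<^sup>2) / (LINT x|lebesgue. (u x)\<^sup>2)"
    unfolding lambda1_def by (rule cInf_lower[OF _ lambda1_bdd_below]) (use assms False in blast)
  ultimately show ?thesis by (simp add: field_simps)
qed simp

lemma ex_test_fun_pos: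
  assumes "open \<Omega>" "\<Omega> \<noteq> {}"
  obtains \<phi> where "test_fun \<Omega> \<phi>" "0 < (LINT x|lebesgue. \<phi> x)" "0 < (LINT x|lebesgue. (\<phi> x)\<^sup>2)"
proof -
  obtain a where "a \<in> \<Omega>" using assms by auto
  with assms(1) obtain \<phi> where \<phi>: "test_fun \<Omega> \<phi>" "\<And>x. 0 \<le> \<phi> x" "\<phi> a = 1" by (rule ex_test_fun) (rule that)
  note c = test_fun_cont_csupp[OF \<phi>(1)]
  show ?thesis
  proof (rule that[OF \<phi>(1)])
    show "0 < (LINT x|lebesgue. \<phi> x)" by (rule cont_csupp_integral_pos[OF c, of a]) (simp_all add: \<phi>)
    show "0 < (LINT x|lebesgue. (\<phi> x)\<^sup>2)"
      by (rule cont_csupp_integral_pos[OF cont_csupp_square[OF c], of a]) (simp_all add: \<phi>)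
  qed
qed

text \<open>Functions in \<open>H01\<close> are limits of test functions in the full norm, so both
  sides of the inequality pass to the limit. The bump function is there because the infimum of a set
  of reals is meaningful only for a nonempty set.\<close>

lemma lambda1_greatest:
  assumes "open \<Omega>" "\<Omega> \<noteq> {}"
    and le: "\<And>\<phi>. test_fun \<Omega> \<phi> \<Longrightarrow> c * (LINT x|lebesgue. (\<phi> x)\<^sup>2) \<le> (LINT x|lebesgue. (norm (grad \<phi> x))\<^sup>2)"
  shows "c \<le> lambda1 \<Omega>"
  unfolding lambda1_def
proof (rule cInf_greatest)
  obtain \<phi> where \<phi>: "test_fun \<Omega> \<phi>" "0 < (LINT x|lebesgue. \<phi> x)" "0 < (LINT x|lebesgue. (\<phi> x)\<^sup>2)"
    by (rule ex_test_fun_pos[OF assms(1,2)]) (rule that)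
  then have "(LINT x|lebesgue. (\<phi> x)\<^sup>2) \<noteq> 0" by simp
  then show "{(LINT x|lebesgue. (norm (g x))\<^sup>2) / (LINT x|lebesgue. (u x)\<^sup>2) | u g.
       H01 \<Omega> u g \<and> (LINT x|lebesgue. (u x)\<^sup>2) \<noteq> 0} \<noteq> {}"
    using test_fun_H01[OF \<phi>(1)] by blast
next
  fix t
  assume "t \<in> {(LINT x|lebesgue. (norm (g x))\<^sup>2) / (LINT x|lebesgue. (u x)\<^sup>2) | u g.
       H01 \<Omega> u g \<and> (LINT x|lebesgue. (u x)\<^sup>2) \<noteq> 0}"
  then obtain u g where t: "t = (LINT x|lebesgue. (norm (g x))\<^sup>2) / (LINT x|lebesgue. (u x)\<^sup>2)"
    and ug: "H01 \<Omega> u g" and n0: "(LINT x|lebesgue. (u x)\<^sup>2) \<noteq> 0" by blast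
  obtain \<phi> where \<phi>: "\<And>n. test_fun \<Omega> (\<phi> n)"
    "(\<lambda>n. LINT x|lebesgue. (norm (\<phi> n x - u x))\<^sup>2) \<longlonglongrightarrow> 0"
    "(\<lambda>n. LINT x|lebesgue. (norm (grad (\<phi> n) x - g x))\<^sup>2) \<longlonglongrightarrow> 0" by (rule H01_approx[OF ug]) (rule that)
  have "(\<lambda>n. c * (LINT x|lebesgue. (norm (\<phi> n x))\<^sup>2)) \<longlonglongrightarrow> c * (LINT x|lebesgue. (norm (u x))\<^sup>2)"
    by (rule tendsto_mult_left[OF L2_norm_tendsto[OF test_fun_L2[OF \<phi>(1)] H01_L2(1)[OF ug] \<phi>(2)]])
  moreover have "(\<lambda>n. LINT x|lebesgue. (norm (grad (\<phi> n) x))\<^sup>2) \<longlonglongrightarrow> (LINT x|lebesgue. (norm (g x))\<^sup>2)"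
    by (rule L2_norm_tendsto[OF test_fun_L2_grad[OF \<phi>(1)] H01_L2(2)[OF ug] \<phi>(3)])
  ultimately have "c * (LINT x|lebesgue. (norm (u x))\<^sup>2) \<le> (LINT x|lebesgue. (norm (g x))\<^sup>2)"
    by (rule LIMSEQ_le) (use le[OF \<phi>(1)] in auto)
  moreover have "0 \<le> (LINT x|lebesgue. (u x)\<^sup>2)" by simp
  with n0 have "0 < (LINT x|lebesgue. (u x)\<^sup>2)" by linarith
  ultimately show "c \<le> t" by (simp add: t field_simps)
qed

lemma lambda1_nonneg: "open \<Omega> \<Longrightarrow> \<Omega> \<noteq> {} \<Longrightarrow> 0 \<le> lambda1 \<Omega>"
  by (rule lambda1_greatest) auto

lemma L2_indicator:
  assumes "\<Omega> \<in> sets M" "emeasure M \<Omega> < \<infinity>"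
  shows "L2 M (indicator \<Omega> :: 'a \<Rightarrow> real)" "(LINT x|M. (indicator \<Omega> x :: real)\<^sup>2) = measure M \<Omega>"
proof -
  have [simp]: "(indicator \<Omega> x :: real)\<^sup>2 = indicator \<Omega> x" for x by (simp add: indicator_def)
  show "L2 M (indicator \<Omega> :: 'a \<Rightarrow> real)" "(LINT x|M. (indicator \<Omega> x :: real)\<^sup>2) = measure M \<Omega>"
    using assms by (auto simp: L2_def)
qed

text \<open>The approximating test functions vanish off \<open>\<Omega>\<close>, so the mass of
  \<open>u\<close> there is at most its squared distance to each of them.\<close>

lemma H01_AE_zero_outside:
  assumes ug: "H01 \<Omega> u g" and [measurable]: "\<Omega> \<in> sets lebesgue"
  shows "AE x in lebesgue. x \<notin> \<Omega> \<longrightarrow> u x = 0"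
proof -
  obtain \<phi> where \<phi>: "\<And>n. test_fun \<Omega> (\<phi> n)"
    "(\<lambda>n. LINT x|lebesgue. (norm (\<phi> n x - u x))\<^sup>2) \<longlonglongrightarrow> 0"
    "(\<lambda>n. LINT x|lebesgue. (norm (grad (\<phi> n) x - g x))\<^sup>2) \<longlonglongrightarrow> 0" by (rule H01_approx[OF ug]) (rule that)
  have u: "L2 lebesgue u" using H01_L2[OF ug] by simp
  note [measurable] = L2_measurable[OF u]
  have i: "integrable lebesgue (\<lambda>x. indicator (- \<Omega>) x * (u x)\<^sup>2)"
    by (rule Bochner_Integration.integrable_bound[OF L2_integrable_norm[OF u]])
       (auto simp: indicator_def)
  have "(LINT x|lebesgue. indicator (- \<Omega>) x * (u x)\<^sup>2) \<le> (LINT x|lebesgue. (norm (\<phi> n x - u x))\<^sup>2)" for n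
    by (rule integral_mono[OF i L2_integrable_norm[OF L2_diff[OF test_fun_L2[OF \<phi>(1)] u]]])
       (auto simp: indicator_def test_fun_zero_outside[OF \<phi>(1)])
  then have "(LINT x|lebesgue. indicator (- \<Omega>) x * (u x)\<^sup>2) \<le> 0"
    by (intro LIMSEQ_le_const[OF \<phi>(2)]) auto
  moreover have "0 \<le> (LINT x|lebesgue. indicator (- \<Omega>) x * (u x)\<^sup>2)"
    by (rule Bochner_Integration.integral_nonneg) auto
  ultimately have "(LINT x|lebesgue. indicator (- \<Omega>) x * (u x)\<^sup>2) = 0" by linarith
  then have "AE x in lebesgue. indicator (- \<Omega>) x * (u x)\<^sup>2 = 0"
    by (subst (asm) integral_nonneg_eq_0_iff_AE[OF i]) auto
  then show ?thesis by eventually_elim (auto simp: indicator_def split: if_splits)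
qed

text \<open>Writing the integral as an inner product with \<open>indicator \<Omega>\<close>, which
  is square integrable, makes it continuous under mean square convergence and accessible to
  Cauchy-Schwarz.\<close>

lemma H01_integral:
  assumes ug: "H01 \<Omega> u g" and \<Omega>: "\<Omega> \<in> sets lebesgue" "emeasure lebesgue \<Omega> < \<infinity>"
  shows "(LINT x|lebesgue. u x) = (LINT x|lebesgue. u x \<bullet> indicator \<Omega> x)"
proof (rule integral_cong_AE)
  show "u \<in> borel_measurable lebesgue" using H01_L2[OF ug] by (auto simp: L2_def)
  show "(\<lambda>x. u x \<bullet> indicator \<Omega> x) \<in> borel_measurable lebesgue"
    using L2_integrable_inner[OF H01_L2(1)[OF ug] L2_indicator(1)[OF \<Omega>]] by (rule borel_measurable_integrable)
  show "AE x in lebesgue. u x = u x \<bullet> indicator \<Omega> x"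
    using H01_AE_zero_outside[OF ug \<Omega>(1)] by eventually_elim (auto simp: indicator_def)
qed

text \<open>The weak equation is tested with the approximants of \<open>v\<close>; in the limit
  \<open>v\<close> itself becomes an admissible test function.\<close>

lemma torsion_energy:
  assumes v: "H01 \<Omega> v gv" and \<Omega>: "\<Omega> \<in> sets lebesgue" "emeasure lebesgue \<Omega> < \<infinity>"
    and eq: "\<And>\<phi>. test_fun \<Omega> \<phi> \<Longrightarrow> (LINT x|lebesgue. gv x \<bullet> grad \<phi> x) = (LINT x|lebesgue. \<phi> x)"
  shows "(LINT x|lebesgue. (norm (gv x))\<^sup>2) = (LINT x|lebesgue. v x)"
proof -
  obtain \<phi> where \<phi>: "\<And>n. test_fun \<Omega> (\<phi> n)"
    "(\<lambda>n. LINT x|lebesgue. (norm (\<phi> n x - v x))\<^sup>2) \<longlonglongrightarrow> 0"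
    "(\<lambda>n. LINT x|lebesgue. (norm (grad (\<phi> n) x - gv x))\<^sup>2) \<longlonglongrightarrow> 0" by (rule H01_approx[OF v]) (rule that)
  note L = H01_L2[OF v]
  have "(\<lambda>n. LINT x|lebesgue. grad (\<phi> n) x \<bullet> gv x) \<longlonglongrightarrow> (LINT x|lebesgue. gv x \<bullet> gv x)"
    by (rule L2_inner_tendsto[OF test_fun_L2_grad[OF \<phi>(1)] L(2) L(2) \<phi>(3)])
  moreover have "(\<lambda>n. LINT x|lebesgue. \<phi> n x \<bullet> indicator \<Omega> x) \<longlonglongrightarrow> (LINT x|lebesgue. v x \<bullet> indicator \<Omega> x)"
    by (rule L2_inner_tendsto[OF test_fun_L2[OF \<phi>(1)] L(1) L2_indicator(1)[OF \<Omega>] \<phi>(2)])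
  moreover have "(LINT x|lebesgue. \<phi> n x \<bullet> indicator \<Omega> x) = (LINT x|lebesgue. grad (\<phi> n) x \<bullet> gv x)" for n
    using H01_integral[OF test_fun_H01[OF \<phi>(1)] \<Omega>, of n] eq[OF \<phi>(1), of n] by (simp add: inner_commute)
  ultimately have "(LINT x|lebesgue. gv x \<bullet> gv x) = (LINT x|lebesgue. v x \<bullet> indicator \<Omega> x)"
    by (simp add: LIMSEQ_unique)
  then show ?thesis using H01_integral[OF v \<Omega>] by (simp add: power2_norm_eq_inner)
qed

text \<open>Dirichlet's principle. The functional \<open>J\<close>, energy minus twice the integral,
  is bounded below on test functions by the Poincare inequality that \<open>lambda1\<close>
  provides; the parallelogram identity makes a minimizing sequence Cauchy, and the weak equation is
  the vanishing of the first variation at its limit.\<close>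

lemma torsion_exists:
  fixes \<Omega> :: "'a::euclidean_space set"
  assumes pos: "0 < lambda1 \<Omega>" and \<Omega>: "\<Omega> \<in> sets lebesgue" "emeasure lebesgue \<Omega> < \<infinity>"
  shows "\<exists>v. is_torsion \<Omega> v"
proof -
  define E where "E \<phi> = (LINT x|lebesgue. (norm (grad \<phi> x))\<^sup>2)" for \<phi> :: "'a \<Rightarrow> real"
  define I where "I \<phi> = (LINT x|lebesgue. \<phi> x)" for \<phi> :: "'a \<Rightarrow> real"
  define J where "J \<phi> = E \<phi> - 2 * I \<phi>" for \<phi>
  define V where "V = {\<phi>. test_fun \<Omega> \<phi>}"
  have V0: "(\<lambda>_. 0) \<in> V" by (auto simp: V_def test_fun_iff intro!: exI[of _ "{}"])
  have poincare: "(LINT x|lebesgue. (norm (\<phi> x))\<^sup>2) \<le> E \<phi> / lambda1 \<Omega>" if "\<phi> \<in> V" for \<phi>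
    using lambda1_le[OF test_fun_H01, of \<Omega> \<phi>] that pos by (simp add: V_def E_def field_simps)
  have CS: "(I \<phi>)\<^sup>2 \<le> E \<phi> / lambda1 \<Omega> * measure lebesgue \<Omega>" if "\<phi> \<in> V" for \<phi>
  proof -
    have t: "test_fun \<Omega> \<phi>" using that by (simp add: V_def)
    have "(I \<phi>)\<^sup>2 \<le> (LINT x|lebesgue. (norm (\<phi> x))\<^sup>2) * (LINT x|lebesgue. (norm (indicator \<Omega> x :: real))\<^sup>2)"
      unfolding I_def H01_integral[OF test_fun_H01[OF t] \<Omega>]
      by (rule L2_Cauchy_Schwarz[OF test_fun_L2[OF t] L2_indicator(1)[OF \<Omega>]])
    also have "\<dots> \<le> E \<phi> / lambda1 \<Omega> * measure lebesgue \<Omega>"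
      using mult_right_mono[OF poincare[OF that], of "measure lebesgue \<Omega>"] by (simp add: L2_indicator[OF \<Omega>])
    finally show ?thesis .
  qed
  have bdd: "bdd_below (J ` V)"
  proof (rule bdd_belowI2)
    fix \<phi> assume "\<phi> \<in> V"
    define K where "K = measure lebesgue \<Omega> / lambda1 \<Omega>"
    have K: "0 \<le> K" using pos by (simp add: K_def)
    have e: "0 \<le> E \<phi>" by (simp add: E_def)
    have "(I \<phi>)\<^sup>2 \<le> E \<phi> * K" using CS[OF \<open>\<phi> \<in> V\<close>] by (simp add: K_def)
    \<comment> \<open>The arithmetic-geometric mean inequality, chosen so that
      \<open>2 * I \<phi>\<close> costs exactly one \<open>E \<phi>\<close> and leaves
      \<open>J \<phi> \<ge> - K\<close>.\<close>
    also have "\<dots> \<le> ((E \<phi> + K) / 2)\<^sup>2"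
      using sum_squares_bound[of "E \<phi>" K] by (simp add: power2_eq_square field_simps)
    finally have "I \<phi> \<le> (E \<phi> + K) / 2"
      by (rule power2_le_imp_le) (use K e in simp)
    then show "- K \<le> J \<phi>" by (simp add: J_def)
  qed
  define j where "j = Inf (J ` V)"
  have jle: "j \<le> J \<phi>" if "\<phi> \<in> V" for \<phi>
    unfolding j_def by (rule cInf_lower[OF _ bdd]) (use that in simp)
  have "\<exists>\<phi>\<in>V. J \<phi> < j + 1 / real (Suc n)" for n
    using cInf_lessD[of "J ` V" "j + 1 / real (Suc n)"] V0 unfolding j_def by auto
  then obtain \<phi> where \<phi>V: "\<And>n. \<phi> n \<in> V" and \<phi>J: "\<And>n. J (\<phi> n) < j + 1 / real (Suc n)" by metis
  have t: "test_fun \<Omega> (\<phi> n)" for n using \<phi>V by (simp add: V_def)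
  have J_add: "J (\<lambda>x. a x + s * b x) = J a + 2 * s * ((LINT x|lebesgue. grad a x \<bullet> grad b x) - I b) + s\<^sup>2 * E b"
    if "a \<in> V" "b \<in> V" for a b s
  proof -
    have ab: "test_fun \<Omega> a" "test_fun \<Omega> b" using that by (auto simp: V_def)
    have "grad (\<lambda>x. a x + s * b x) x = grad a x + s *\<^sub>R grad b x" for x
      using grad_add[OF test_fun_smooth[OF ab(1)] test_fun_smooth[OF test_fun_cmult[OF ab(2)]], of s x]
        grad_cmult[OF test_fun_smooth[OF ab(2)], of s x] by simp
    then have "E (\<lambda>x. a x + s * b x) = E a + 2 * s * (LINT x|lebesgue. grad a x \<bullet> grad b x) + s\<^sup>2 * E b"
      unfolding E_def using L2_norm_add_scale[OF test_fun_L2_grad[OF ab(1)] test_fun_L2_grad[OF ab(2)], of s] by simp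
    moreover have "I (\<lambda>x. a x + s * b x) = I a + s * I b"
      unfolding I_def using test_fun_integrable[OF ab(1)] test_fun_integrable[OF ab(2)] by simp
    ultimately show ?thesis by (simp add: J_def algebra_simps)
  qed
  have V_add: "(\<lambda>x. a x + s * b x) \<in> V" if "a \<in> V" "b \<in> V" for a b s
    using that by (auto simp: V_def intro: test_fun_add test_fun_cmult)
  define d where "d m n = (\<lambda>x. \<phi> m x - \<phi> n x)" for m n
  have dV: "d m n \<in> V" for m n unfolding d_def using V_add[OF \<phi>V \<phi>V, of m "-1" n] by simp
  have Ed: "E (d m n) \<le> 2 * (1 / real (Suc m) + 1 / real (Suc n))" for m n
  proof -
    have 1: "J (\<phi> m) = J (\<phi> n) + 2 * ((LINT x|lebesgue. grad (\<phi> n) x \<bullet> grad (d m n) x) - I (d m n)) + E (d m n)"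
      using J_add[OF \<phi>V dV, of n 1 m n] by (simp add: d_def)
    have 2: "J (\<lambda>x. \<phi> n x + (1/2) * d m n x) = J (\<phi> n) + ((LINT x|lebesgue. grad (\<phi> n) x \<bullet> grad (d m n) x) - I (d m n)) + E (d m n) / 4"
      using J_add[OF \<phi>V dV, of n "1/2" m n] by (simp add: power2_eq_square)
    have 3: "j \<le> J (\<lambda>x. \<phi> n x + (1/2) * d m n x)" by (intro jle V_add \<phi>V dV)
    \<comment> \<open>Here \<open>p\<close> and \<open>q\<close> are the values of \<open>J\<close>
      at the two functions and \<open>r\<close> the value at their midpoint. The assumptions give
      \<open>e = 2 * (p + q - 2 * r)\<close>, and the midpoint cannot go below the infimum
      \<open>j\<close>.\<close>
    have "e \<le> 2 * (a + b)" if "p = q + 2 * x + e" "r = q + x + e / 4" "p < j + a" "q < j + b" "j \<le> r"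
      for e a b p q x r :: real
      using that by (simp add: field_simps)
    from this[OF 1 2 \<phi>J \<phi>J 3] show ?thesis .
  qed
  have grad_d: "grad (d m n) x = grad (\<phi> m) x - grad (\<phi> n) x" for m n x
    unfolding d_def by (rule grad_diff) (rule test_fun_smooth[OF t])+
  have small: "\<exists>N. \<forall>m\<ge>N. \<forall>n\<ge>N. E (d m n) < e" if e0: "0 < e" for e
  proof -
    obtain N where N: "1 / real (Suc N) < e / 4"
      using reals_Archimedean[of "e / 4"] e0 by (auto simp: inverse_eq_divide)
    have "E (d m n) < e" if "m \<ge> N" "n \<ge> N" for m n
    proof -
      have "1 / real (Suc m) \<le> 1 / real (Suc N)" "1 / real (Suc n) \<le> 1 / real (Suc N)"
        using that by (auto intro!: divide_left_mono)
      with N Ed[of m n] show ?thesis by argo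
    qed
    then show ?thesis by blast
  qed
  obtain g where g: "L2 lebesgue g" "(\<lambda>n. LINT x|lebesgue. (norm (grad (\<phi> n) x - g x))\<^sup>2) \<longlonglongrightarrow> 0"
  proof (rule L2_complete[of lebesgue "\<lambda>n. grad (\<phi> n)"])
    show "\<exists>N. \<forall>m\<ge>N. \<forall>n\<ge>N. (LINT x|lebesgue. (norm (grad (\<phi> m) x - grad (\<phi> n) x))\<^sup>2) < e" if "0 < e" for e
      using small[OF that] by (simp add: E_def grad_d)
  qed (rule test_fun_L2_grad[OF t])
  obtain v where v: "L2 lebesgue v" "(\<lambda>n. LINT x|lebesgue. (norm (\<phi> n x - v x))\<^sup>2) \<longlonglongrightarrow> 0"
  proof (rule L2_complete[of lebesgue \<phi>])
    show "\<exists>N. \<forall>m\<ge>N. \<forall>n\<ge>N. (LINT x|lebesgue. (norm (\<phi> m x - \<phi> n x))\<^sup>2) < e" if "0 < e" for e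
    proof -
      have "0 < e * lambda1 \<Omega>" using that pos by simp
      from small[OF this] obtain N where N: "\<And>m n. m \<ge> N \<Longrightarrow> n \<ge> N \<Longrightarrow> E (d m n) < e * lambda1 \<Omega>" by blast
      have "(LINT x|lebesgue. (norm (\<phi> m x - \<phi> n x))\<^sup>2) < e" if "m \<ge> N" "n \<ge> N" for m n
      proof -
        have "(LINT x|lebesgue. (norm (\<phi> m x - \<phi> n x))\<^sup>2) \<le> E (d m n) / lambda1 \<Omega>"
          using poincare[OF dV, of m n] by (simp add: d_def)
        also have "\<dots> < e" using N[OF that] pos by (simp add: field_simps)
        finally show ?thesis .
      qed
      then show ?thesis by blast
    qed
  qed (rule test_fun_L2[OF t])
  have H: "H01 \<Omega> v g" by (rule H01_I[OF v(1) g(1) t v(2) g(2)])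
  have "(LINT x|lebesgue. g x \<bullet> grad \<psi> x) = (LINT x|lebesgue. \<psi> x)" if \<psi>: "test_fun \<Omega> \<psi>" for \<psi>
  proof -
    define B where "B = (LINT x|lebesgue. g x \<bullet> grad \<psi> x) - I \<psi>"
    have \<psi>V: "\<psi> \<in> V" using \<psi> by (simp add: V_def)
    \<comment> \<open>Minimality up to \<open>1 / real (Suc n)\<close> bounds the change of
      \<open>J\<close> in the direction \<open>\<psi>\<close> from below. In the limit the quadratic
      in \<open>s\<close> has no constant term, so its linear coefficient \<open>B\<close> must
      vanish.\<close>
    have "0 \<le> 0 + 2 * s * B + s\<^sup>2 * E \<psi>" for s
    proof (rule LIMSEQ_le_const)
      have "(\<lambda>n. LINT x|lebesgue. grad (\<phi> n) x \<bullet> grad \<psi> x) \<longlonglongrightarrow> (LINT x|lebesgue. g x \<bullet> grad \<psi> x)"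
        by (rule L2_inner_tendsto[OF test_fun_L2_grad[OF t] g(1) test_fun_L2_grad[OF \<psi>] g(2)])
      moreover have "(\<lambda>n. 1 / real (Suc n)) \<longlonglongrightarrow> 0"
        using LIMSEQ_inverse_real_of_nat by (simp add: inverse_eq_divide)
      ultimately show "(\<lambda>n. 1 / real (Suc n) + 2 * s * ((LINT x|lebesgue. grad (\<phi> n) x \<bullet> grad \<psi> x) - I \<psi>) + s\<^sup>2 * E \<psi>)
         \<longlonglongrightarrow> 0 + 2 * s * B + s\<^sup>2 * E \<psi>"
        unfolding B_def by (intro tendsto_intros)
      have "0 \<le> 1 / real (Suc n) + 2 * s * ((LINT x|lebesgue. grad (\<phi> n) x \<bullet> grad \<psi> x) - I \<psi>) + s\<^sup>2 * E \<psi>" for n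
        using J_add[OF \<phi>V \<psi>V, of n s] jle[OF V_add[OF \<phi>V \<psi>V], of n s] \<phi>J[of n] by linarith
      then show "\<exists>N. \<forall>n\<ge>N. 0 \<le> 1 / real (Suc n) + 2 * s * ((LINT x|lebesgue. grad (\<phi> n) x \<bullet> grad \<psi> x) - I \<psi>) + s\<^sup>2 * E \<psi>"
        by blast
    qed
    then have "B\<^sup>2 \<le> 0 * E \<psi>"
      by (rule quadratic_nonneg_imp_discriminant) (simp add: E_def)
    then show ?thesis by (simp add: B_def I_def)
  qed
  then show ?thesis using H unfolding is_torsion_def by blast
qed

section \<open>The functional is less than one\<close>

text \<open>The tangent at \<open>1\<close> of the convex function \<open>t powr q\<close>, obtained
  from Young's inequality for \<open>t powr q\<close> and \<open>1\<close> with weights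
  \<open>1 / q\<close> and \<open>1 - 1 / q\<close>.\<close>

lemma powr_ge_tangent:
  fixes t q :: real assumes "0 \<le> t" "1 \<le> q"
  shows "1 + q * (t - 1) \<le> t powr q"
proof (cases "t = 0")
  case True
  then show ?thesis using assms by simp
next
  case False
  then have t: "0 < t" using assms by simp
  have "(t powr q) powr (1 / q) * 1 powr (1 - 1 / q) \<le> 1 / q * t powr q + (1 - 1 / q) * 1"
    by (rule Youngs_inequality_0) (use assms t in auto)
  then have "t \<le> 1 / q * t powr q + (1 - 1 / q)"
    using assms t by (simp add: powr_powr)
  then have "q * t \<le> q * (1 / q * t powr q + (1 - 1 / q))"
    using assms by (intro mult_left_mono) auto
  also have "\<dots> = t powr q + q - 1" using assms by (simp add: algebra_simps)
  finally show ?thesis by (simp add: algebra_simps)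
qed

text \<open>Jensen's inequality by integrating the tangent bound at \<open>f x / A\<close>, where
  \<open>A\<close> is the mean of \<open>f\<close> over \<open>\<Omega>\<close>; with this
  normalization the linear terms cancel after integration.\<close>

lemma power_mean_le:
  fixes f :: "'a \<Rightarrow> real"
  assumes \<Omega>: "\<Omega> \<in> sets M" "emeasure M \<Omega> < \<infinity>" "0 < measure M \<Omega>" and q: "1 \<le> q"
    and f: "\<And>x. 0 \<le> f x" "integrable M (\<lambda>x. indicator \<Omega> x * f x)"
      "integrable M (\<lambda>x. indicator \<Omega> x * f x powr q)"
  shows "((LINT x|M. indicator \<Omega> x * f x) / measure M \<Omega>) powr q
     \<le> (LINT x|M. indicator \<Omega> x * f x powr q) / measure M \<Omega>"
proof -
  define A where "A = (LINT x|M. indicator \<Omega> x * f x) / measure M \<Omega>"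
  have A0: "0 \<le> A" unfolding A_def using f(1) by (intro divide_nonneg_nonneg Bochner_Integration.integral_nonneg) auto
  show ?thesis
  proof (cases "A = 0")
    case True
    then show ?thesis unfolding A_def[symmetric] using f(1)
      by (auto intro!: divide_nonneg_nonneg Bochner_Integration.integral_nonneg)
  next
    case False
    then have A: "0 < A" using A0 by simp
    have iO: "integrable M (indicator \<Omega> :: 'a \<Rightarrow> real)" using \<Omega> by (intro integrable_real_indicator) auto
    have "(LINT x|M. indicator \<Omega> x * (1 - q) + (q / A) * (indicator \<Omega> x * f x))
        \<le> (LINT x|M. (1 / A powr q) * (indicator \<Omega> x * f x powr q))"
    proof (rule integral_mono)
      fix x
      have "1 + q * (f x / A - 1) \<le> (f x / A) powr q"
        by (rule powr_ge_tangent) (use f A q in auto)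
      then show "indicator \<Omega> x * (1 - q) + (q / A) * (indicator \<Omega> x * f x) \<le> (1 / A powr q) * (indicator \<Omega> x * f x powr q)"
        using A f(1)[of x] by (auto simp: indicator_def powr_divide algebra_simps)
    qed (intro Bochner_Integration.integrable_add integrable_mult_left integrable_mult_right iO f)+
    also have "(LINT x|M. indicator \<Omega> x * (1 - q) + (q / A) * (indicator \<Omega> x * f x))
        = measure M \<Omega> * (1 - q) + (q / A) * (LINT x|M. indicator \<Omega> x * f x)"
      using iO f(2) \<Omega> by simp
    also have "\<dots> = measure M \<Omega>"
      using A \<Omega>(3) by (simp add: A_def field_simps)
    also have "(LINT x|M. (1 / A powr q) * (indicator \<Omega> x * f x powr q))
        = (1 / A powr q) * (LINT x|M. indicator \<Omega> x * f x powr q)" by simp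
    finally have "A powr q * measure M \<Omega> \<le> (LINT x|M. indicator \<Omega> x * f x powr q)"
      using A by (simp add: field_simps)
    then show ?thesis unfolding A_def[symmetric] using \<Omega>(3) by (simp add: field_simps)
  qed
qed

text \<open>Two power mean steps, from exponent \<open>1\<close> to \<open>p\<close> and from
  \<open>p\<close> to \<open>2\<close>; the second applies the exponent \<open>2 / p \<ge> 1\<close>
  to \<open>\<bar>v x\<bar> powr p\<close>. Integrability of the intermediate powers comes from
  \<open>\<bar>t\<bar> powr r \<le> 1 + t^2\<close> and the finite measure.\<close>

lemma Lp_norm_on_bounds:
  fixes v :: "'a::euclidean_space \<Rightarrow> real"
  assumes v: "L2 lebesgue v" and p: "1 \<le> p" "p \<le> 2"
    and \<Omega>: "\<Omega> \<in> sets lebesgue" "emeasure lebesgue \<Omega> < \<infinity>" "0 < measure lebesgue \<Omega>"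
  shows "(LINT x|lebesgue. indicator \<Omega> x * \<bar>v x\<bar>) / measure lebesgue \<Omega>
      \<le> Lp_norm_on p \<Omega> v / measure lebesgue \<Omega> powr (1 / p)" (is "?A \<le> ?P")
    and "Lp_norm_on p \<Omega> v / measure lebesgue \<Omega> powr (1 / p)
      \<le> sqrt ((LINT x|lebesgue. (v x)\<^sup>2) / measure lebesgue \<Omega>)" (is "_ \<le> ?B")
proof -
  note [measurable] = \<Omega>(1) L2_measurable[OF v]
  have iO: "integrable lebesgue (indicator \<Omega> :: 'a \<Rightarrow> real)" using \<Omega> by (intro integrable_real_indicator) auto
  have i2: "integrable lebesgue (\<lambda>x. (v x)\<^sup>2)" using L2_integrable_norm[OF v] by simp
  have bound: "\<bar>t\<bar> powr r \<le> 1 + t\<^sup>2" if "0 \<le> r" "r \<le> 2" for t r :: real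
  proof (cases "\<bar>t\<bar> \<le> 1")
    case True
    then have "\<bar>t\<bar> powr r \<le> 1" using that by (intro powr_le1) auto
    then show ?thesis by (simp add: add_increasing2)
  next
    case False
    then have "\<bar>t\<bar> powr r \<le> \<bar>t\<bar> powr 2" using that by (intro powr_mono) auto
    then show ?thesis using False by simp
  qed
  have int: "integrable lebesgue (\<lambda>x. indicator \<Omega> x * \<bar>v x\<bar> powr r)" if r: "0 \<le> r" "r \<le> 2" for r
  proof (rule Bochner_Integration.integrable_bound)
    show "integrable lebesgue (\<lambda>x. indicator \<Omega> x + (v x)\<^sup>2)" using iO i2 by simp
    show "AE x in lebesgue. norm (indicator \<Omega> x * \<bar>v x\<bar> powr r) \<le> norm (indicator \<Omega> x + (v x)\<^sup>2)"
      using bound[OF r] by (auto simp: indicator_def)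
  qed measurable
  have i1: "integrable lebesgue (\<lambda>x. indicator \<Omega> x * \<bar>v x\<bar>)" using int[of 1] by simp
  define I where "I = (LINT x|lebesgue. indicator \<Omega> x * \<bar>v x\<bar> powr p)"
  have I0: "0 \<le> I" unfolding I_def by (rule Bochner_Integration.integral_nonneg) auto
  have P: "?P = (I / measure lebesgue \<Omega>) powr (1 / p)"
    unfolding Lp_norm_on_def I_def[symmetric] using I0 \<Omega>(3) by (simp add: powr_divide)
  have A0: "0 \<le> ?A" by (intro divide_nonneg_nonneg Bochner_Integration.integral_nonneg) auto
  have "?A powr p \<le> I / measure lebesgue \<Omega>"
    unfolding I_def by (rule power_mean_le[OF \<Omega> p(1) _ i1 int]) (use p in auto)
  then have "(?A powr p) powr (1 / p) \<le> (I / measure lebesgue \<Omega>) powr (1 / p)"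
    using p by (intro powr_mono2) auto
  then show "?A \<le> ?P" unfolding P using p A0 by (simp add: powr_powr)
  have pp: "(\<bar>v x\<bar> powr p) powr (2 / p) = (v x)\<^sup>2" for x
    using p by (simp add: powr_powr)
  have iO2: "integrable lebesgue (\<lambda>x. indicator \<Omega> x * (v x)\<^sup>2)"
    by (rule Bochner_Integration.integrable_bound[OF i2]) (auto simp: indicator_def)
  have "(I / measure lebesgue \<Omega>) powr (2 / p) \<le> (LINT x|lebesgue. indicator \<Omega> x * (\<bar>v x\<bar> powr p) powr (2 / p)) / measure lebesgue \<Omega>"
    unfolding I_def using p iO2 int[of p] by (intro power_mean_le[OF \<Omega>]) (auto simp: pp)
  also have "\<dots> \<le> (LINT x|lebesgue. (v x)\<^sup>2) / measure lebesgue \<Omega>"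
    unfolding pp using \<Omega>(3)
    by (intro divide_right_mono integral_mono i2 iO2) (auto simp: indicator_def)
  finally have "((I / measure lebesgue \<Omega>) powr (1 / p))\<^sup>2 \<le> (LINT x|lebesgue. (v x)\<^sup>2) / measure lebesgue \<Omega>"
    using p by (simp add: powr_powr flip: powr_realpow')
  then show "?P \<le> ?B" unfolding P by (rule real_le_rsqrt)
qed

lemma is_torsion_torsion: "\<exists>v. is_torsion \<Omega> v \<Longrightarrow> is_torsion \<Omega> (torsion \<Omega>)"
  unfolding torsion_def by (rule someI_ex[of "is_torsion \<Omega>"])

text \<open>Pair with the Laplacian of a bump \<open>\<phi>\<close> of positive integral. A constant
  on \<open>\<Omega>\<close> gives \<open>0\<close>, since a Laplacian of compact support integrates
  to zero, while the weak equation gives minus the integral of \<open>\<phi>\<close>.\<close>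

lemma torsion_not_constant:
  fixes \<Omega> :: "'a::euclidean_space set"
  assumes \<Omega>: "open \<Omega>" "\<Omega> \<noteq> {}" "emeasure lebesgue \<Omega> < \<infinity>"
    and v: "H01 \<Omega> v gv"
    and eq: "\<And>\<phi>. test_fun \<Omega> \<phi> \<Longrightarrow> (LINT x|lebesgue. gv x \<bullet> grad \<phi> x) = (LINT x|lebesgue. \<phi> x)"
  shows "(LINT x|lebesgue. (norm (v x - c * indicator \<Omega> x))\<^sup>2) \<noteq> 0"
proof
  assume 0: "(LINT x|lebesgue. (norm (v x - c * indicator \<Omega> x))\<^sup>2) = 0"
  have S: "\<Omega> \<in> sets lebesgue" using \<Omega>(1) by simp
  obtain \<phi> where \<phi>: "test_fun \<Omega> \<phi>" "0 < (LINT x|lebesgue. \<phi> x)" "0 < (LINT x|lebesgue. (\<phi> x)\<^sup>2)"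
    by (rule ex_test_fun_pos[OF \<Omega>(1,2)]) (rule that)
  obtain \<phi>n where \<phi>n: "\<And>n. test_fun \<Omega> (\<phi>n n)"
    "(\<lambda>n. LINT x|lebesgue. (norm (\<phi>n n x - v x))\<^sup>2) \<longlonglongrightarrow> 0"
    "(\<lambda>n. LINT x|lebesgue. (norm (grad (\<phi>n n) x - gv x))\<^sup>2) \<longlonglongrightarrow> 0" by (rule H01_approx[OF v]) (rule that)
  note L = H01_L2[OF v]
  note lap = test_fun_laplacian[OF \<phi>(1)]
  \<comment> \<open>The function is written as \<open>0 + c * indicator\<close>, with
    \<open>0\<close> as the difference of two indicators.\<close>
  have iO: "L2 lebesgue (\<lambda>x. c * indicator \<Omega> x :: real)"
    using L2_add_scale[OF L2_diff[OF L2_indicator(1) L2_indicator(1)] L2_indicator(1), OF S \<Omega>(3) S \<Omega>(3) S \<Omega>(3), of c] by simp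
  have "(\<lambda>n. LINT x|lebesgue. grad (\<phi>n n) x \<bullet> grad \<phi> x) \<longlonglongrightarrow> (LINT x|lebesgue. gv x \<bullet> grad \<phi> x)"
    by (rule L2_inner_tendsto[OF test_fun_L2_grad[OF \<phi>n(1)] L(2) test_fun_L2_grad[OF \<phi>(1)] \<phi>n(3)])
  moreover have "(\<lambda>n. - (LINT x|lebesgue. \<phi>n n x \<bullet> laplacian \<phi> x)) \<longlonglongrightarrow> - (LINT x|lebesgue. v x \<bullet> laplacian \<phi> x)"
    by (intro tendsto_minus L2_inner_tendsto[OF test_fun_L2[OF \<phi>n(1)] L(1) test_fun_L2[OF lap] \<phi>n(2)])
  moreover have "(LINT x|lebesgue. grad (\<phi>n n) x \<bullet> grad \<phi> x) = - (LINT x|lebesgue. \<phi>n n x \<bullet> laplacian \<phi> x)" for n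
    using test_fun_integral_by_parts[OF \<phi>n(1) \<phi>(1)] by simp
  ultimately have e: "(LINT x|lebesgue. gv x \<bullet> grad \<phi> x) = - (LINT x|lebesgue. v x \<bullet> laplacian \<phi> x)"
    by (simp add: LIMSEQ_unique)
  have "(LINT x|lebesgue. (v x - c * indicator \<Omega> x) \<bullet> laplacian \<phi> x)\<^sup>2 \<le> 0"
    using L2_Cauchy_Schwarz[OF L2_diff[OF L(1) iO] test_fun_L2[OF lap]] unfolding 0 by simp
  then have "(LINT x|lebesgue. v x \<bullet> laplacian \<phi> x) = (LINT x|lebesgue. (c * indicator \<Omega> x) \<bullet> laplacian \<phi> x)"
    using L2_integrable_inner[OF L(1) test_fun_L2[OF lap]] L2_integrable_inner[OF iO test_fun_L2[OF lap]]
    by (simp add: left_diff_distrib)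
  also have "\<dots> = c * (LINT x|lebesgue. laplacian \<phi> x)"
    using H01_integral[OF test_fun_H01[OF lap] S \<Omega>(3)] by (simp add: mult.assoc mult.commute[of "indicator \<Omega> _"])
  also have "\<dots> = 0" by (simp add: integral_laplacian[OF \<phi>(1)])
  finally show False using e eq[OF \<phi>(1)] \<phi>(2) by simp
qed

text \<open>For \<open>lambda1 \<Omega> = 0\<close> the quotient is \<open>0\<close> whatever
  \<open>torsion\<close> denotes; only a positive eigenvalue makes \<open>torsion_exists\<close>
  available. Otherwise strictness comes from the variance of \<open>v\<close> over
  \<open>\<Omega>\<close>, which measures the defect in Cauchy-Schwarz.\<close>

lemma Fp_less_1:
  fixes \<Omega> :: "'a::euclidean_space set"
  assumes \<Omega>: "open \<Omega>" "\<Omega> \<noteq> {}" "emeasure lebesgue \<Omega> < \<infinity>" and p: "1 \<le> p" "p \<le> 2"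
  shows "Fp p \<Omega> < 1"
proof (cases "lambda1 \<Omega> = 0")
  case True
  then show ?thesis by (simp add: Fp_def)
next
  case False
  define \<mu> where "\<mu> = lambda1 \<Omega>"
  define m where "m = measure lebesgue \<Omega>"
  have \<mu>: "0 < \<mu>" using False lambda1_nonneg[OF \<Omega>(1,2)] by (simp add: \<mu>_def)
  have S: "\<Omega> \<in> sets lebesgue" using \<Omega>(1) by simp
  have m: "0 < m"
  proof -
    have "emeasure lebesgue \<Omega> \<noteq> 0"
      using \<Omega>(1,2) open_not_negligible[of \<Omega>] by (auto simp: negligible_iff_emeasure0 S)
    then show ?thesis using \<Omega>(3) by (simp add: m_def measure_def enn2real_positive_iff zero_less_iff_neq_zero)
  qed
  define v where "v = torsion \<Omega>"
  have "is_torsion \<Omega> v"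
    unfolding v_def
    by (rule is_torsion_torsion[OF torsion_exists[OF _ S \<Omega>(3)]]) (use \<mu> in \<open>simp add: \<mu>_def\<close>)
  then obtain gv where gv: "H01 \<Omega> v gv"
    and eq: "\<And>\<phi>. test_fun \<Omega> \<phi> \<Longrightarrow> (LINT x|lebesgue. gv x \<bullet> grad \<phi> x) = (LINT x|lebesgue. \<phi> x)"
    unfolding is_torsion_def by blast
  note L = H01_L2[OF gv]
  define A where "A = (LINT x|lebesgue. (v x)\<^sup>2)"
  define T where "T = (LINT x|lebesgue. v x)"
  have A0: "0 \<le> A" by (simp add: A_def)
  have T: "T = (LINT x|lebesgue. v x \<bullet> indicator \<Omega> x)"
    unfolding T_def by (rule H01_integral[OF gv S \<Omega>(3)])
  have 1: "\<mu> * A \<le> T"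
    using lambda1_le[OF gv] torsion_energy[OF gv S \<Omega>(3) eq] by (simp add: \<mu>_def A_def T_def)
  \<comment> \<open>\<open>T / m\<close> is the mean of \<open>v\<close> over
    \<open>\<Omega>\<close>, so this is the variance of \<open>v\<close> times the measure of
    \<open>\<Omega>\<close>. It is nonzero because \<open>v\<close> is not constant.\<close>
  have "(LINT x|lebesgue. (norm (v x - (T / m) * indicator \<Omega> x))\<^sup>2) = A - T\<^sup>2 / m"
  proof -
    have "(LINT x|lebesgue. (norm (v x + (- T / m) *\<^sub>R indicator \<Omega> x))\<^sup>2) =
      A + 2 * (- T / m) * T + (- T / m)\<^sup>2 * m"
      using L2_norm_add_scale[OF L(1) L2_indicator(1)[OF S \<Omega>(3)], of "- T / m"]
      by (simp add: A_def T m_def L2_indicator[OF S \<Omega>(3)])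
    also have "\<dots> = A - T\<^sup>2 / m" using m by (simp add: field_simps power2_eq_square)
    finally show ?thesis by simp
  qed
  moreover have "0 \<le> (LINT x|lebesgue. (norm (v x - (T / m) * indicator \<Omega> x))\<^sup>2)" by simp
  moreover have "(LINT x|lebesgue. (norm (v x - (T / m) * indicator \<Omega> x))\<^sup>2) \<noteq> 0"
    by (rule torsion_not_constant[OF \<Omega> gv eq])
  ultimately have "0 < A - T\<^sup>2 / m" by linarith
  then have 2: "T\<^sup>2 < A * m" using m by (simp add: field_simps)
  then have A: "0 < A" using A0 m by (cases "A = 0") auto
  have "\<mu>\<^sup>2 * A * A \<le> T\<^sup>2"
    using power_mono[OF 1, of 2] \<mu> A by (simp add: power2_eq_square algebra_simps)
  with 2 have "\<mu>\<^sup>2 * A * A < m * A" by (simp add: mult.commute)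
  then have "\<mu>\<^sup>2 * A < m" using A by simp
  then have "\<mu>\<^sup>2 * (A / m) < 1" using m by (simp add: field_simps)
  moreover have "(\<mu> * sqrt (A / m))\<^sup>2 = \<mu>\<^sup>2 * (A / m)"
    using A m by (simp add: power_mult_distrib)
  ultimately have "(\<mu> * sqrt (A / m))\<^sup>2 < 1\<^sup>2" by simp
  then have "\<mu> * sqrt (A / m) < 1" by (rule power2_less_imp_less) simp
  moreover have "Fp p \<Omega> \<le> \<mu> * sqrt (A / m)"
  proof -
    have "Fp p \<Omega> = \<mu> * (Lp_norm_on p \<Omega> v / m powr (1 / p))"
      by (simp add: Fp_def v_def \<mu>_def m_def)
    also have "\<dots> \<le> \<mu> * sqrt (A / m)"
      using Lp_norm_on_bounds(2)[OF L(1) p S \<Omega>(3)] m \<mu> by (intro mult_left_mono) (auto simp: m_def A_def)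
    finally show ?thesis .
  qed
  ultimately show ?thesis by linarith
qed

text \<open>A test function bounds the torsional rigidity from below, by Cauchy-Schwarz in the weak equation.\<close>

lemma Fp_lower_bound:
  fixes \<Omega> :: "'a::euclidean_space set"
  assumes \<Omega>: "open \<Omega>" "\<Omega> \<noteq> {}" "emeasure lebesgue \<Omega> < \<infinity>" and p: "1 \<le> p" "p \<le> 2"
    and \<mu>: "0 < \<mu>" "\<mu> \<le> lambda1 \<Omega>" and u: "test_fun \<Omega> u" and E: "(LINT x|lebesgue. (norm (grad u x))\<^sup>2) \<le> E" "0 < E"
    and M: "measure lebesgue \<Omega> \<le> M"
  shows "\<mu> * (LINT x|lebesgue. u x)\<^sup>2 / (E * M) \<le> Fp p \<Omega>"
proof -
  define m where "m = measure lebesgue \<Omega>"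
  have S: "\<Omega> \<in> sets lebesgue" using \<Omega>(1) by simp
  have m: "0 < m"
  proof -
    have "emeasure lebesgue \<Omega> \<noteq> 0"
      using \<Omega>(1,2) open_not_negligible[of \<Omega>] by (auto simp: negligible_iff_emeasure0 S)
    then show ?thesis using \<Omega>(3) by (simp add: m_def measure_def enn2real_positive_iff zero_less_iff_neq_zero)
  qed
  define v where "v = torsion \<Omega>"
  have "is_torsion \<Omega> v"
    unfolding v_def
    by (rule is_torsion_torsion[OF torsion_exists[OF _ S \<Omega>(3)]]) (use \<mu> in simp)
  then obtain gv where gv: "H01 \<Omega> v gv"
    and eq: "\<And>\<phi>. test_fun \<Omega> \<phi> \<Longrightarrow> (LINT x|lebesgue. gv x \<bullet> grad \<phi> x) = (LINT x|lebesgue. \<phi> x)"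
    unfolding is_torsion_def by blast
  note L = H01_L2[OF gv]
  define T where "T = (LINT x|lebesgue. v x)"
  have T: "T = (LINT x|lebesgue. v x \<bullet> indicator \<Omega> x)"
    unfolding T_def by (rule H01_integral[OF gv S \<Omega>(3)])
  have en: "(LINT x|lebesgue. (norm (gv x))\<^sup>2) = T"
    unfolding T_def by (rule torsion_energy[OF gv S \<Omega>(3) eq])
  then have T0: "0 \<le> T" by (metis Bochner_Integration.integral_nonneg zero_le_power2)
  have "(LINT x|lebesgue. u x)\<^sup>2 \<le> T * (LINT x|lebesgue. (norm (grad u x))\<^sup>2)"
    using L2_Cauchy_Schwarz[OF L(2) test_fun_L2_grad[OF u]] by (simp add: eq[OF u] en)
  also have "\<dots> \<le> T * E" using E T0 by (intro mult_left_mono) auto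
  finally have 1: "(LINT x|lebesgue. u x)\<^sup>2 / E \<le> T" using E by (simp add: field_simps)
  have "T \<le> (LINT x|lebesgue. indicator \<Omega> x * \<bar>v x\<bar>)"
    unfolding T
  proof (rule integral_mono)
    show i: "integrable lebesgue (\<lambda>x. v x \<bullet> indicator \<Omega> x)"
      by (rule L2_integrable_inner[OF L(1) L2_indicator(1)[OF S \<Omega>(3)]])
    show "integrable lebesgue (\<lambda>x. indicator \<Omega> x * \<bar>v x\<bar>)"
      using integrable_norm[OF i] by (simp add: abs_mult mult.commute)
  qed (auto simp: indicator_def)
  then have "T / m \<le> Lp_norm_on p \<Omega> v / m powr (1 / p)"
    using order_trans[OF divide_right_mono Lp_norm_on_bounds(1)[OF L(1) p S \<Omega>(3)]] m
    by (simp add: m_def)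
  have "\<mu> * (LINT x|lebesgue. u x)\<^sup>2 / (E * M) = \<mu> * ((LINT x|lebesgue. u x)\<^sup>2 / E / M)" by simp
  also have "\<dots> \<le> \<mu> * (T / m)"
    using 1 T0 m M \<mu> by (intro mult_left_mono frac_le) (auto simp: m_def)
  also have "\<dots> \<le> lambda1 \<Omega> * (Lp_norm_on p \<Omega> v / m powr (1 / p))"
    by (rule mult_mono) (use \<open>T / m \<le> _\<close> \<mu> T0 m in auto)
  also have "\<dots> = Fp p \<Omega>" by (simp add: Fp_def v_def m_def)
  finally show ?thesis .
qed

section \<open>Functions with small Rayleigh quotient\<close>

abbreviation dirichlet :: "('a::euclidean_space \<Rightarrow> real) \<Rightarrow> real" where
  "dirichlet f \<equiv> LINT x|lebesgue. (norm (grad f x))\<^sup>2"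

abbreviation mass :: "('a::euclidean_space \<Rightarrow> real) \<Rightarrow> real" where
  "mass f \<equiv> LINT x|lebesgue. (f x)\<^sup>2"

lemma mass_affine:
  fixes f :: "'a::euclidean_space \<Rightarrow> real"
  assumes "test_fun \<Omega> f" "c > 0"
  shows "mass (\<lambda>x. f (c *\<^sub>R x + a)) = mass f / c ^ DIM('a)"
  by (rule cont_csupp_integral_affine[OF cont_csupp_square[OF test_fun_cont_csupp]]) (rule assms)+

lemma dirichlet_affine:
  fixes f :: "'a::euclidean_space \<Rightarrow> real"
  assumes "test_fun \<Omega> f" "c > 0"
  shows "dirichlet (\<lambda>x. f (c *\<^sub>R x + a)) = c\<^sup>2 * dirichlet f / c ^ DIM('a)"
proof -
  have "dirichlet (\<lambda>x. f (c *\<^sub>R x + a)) = (LINT x|lebesgue. c\<^sup>2 * (norm (grad f (c *\<^sub>R x + a)))\<^sup>2)"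
    using assms by (simp add: grad_affine[OF test_fun_smooth[OF assms(1)]] power_mult_distrib)
  also have "\<dots> = c\<^sup>2 * (dirichlet f / c ^ DIM('a))"
    using cont_csupp_integral_affine[OF cont_csupp_norm2[OF test_fun_cont_csupp_grad[OF assms(1)]] assms(2), of a]
    by simp
  finally show ?thesis by simp
qed

lemma test_fun_UNIV_affine: "test_fun \<Omega> f \<Longrightarrow> c \<noteq> 0 \<Longrightarrow> test_fun UNIV (\<lambda>x. f (c *\<^sub>R x + a))"
  by (rule test_fun_mono[OF test_fun_affine]) auto

text \<open>Points have zero capacity in dimension at least two: average \<open>n\<close> rescaled copies of a cutoff
  whose gradients live on disjoint annuli. By scaling, no copy has more energy than the original, so the
  average has energy at most \<open>1/n\<close> times that of one copy.\<close>

lemma point_capacity_zero: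
  assumes dim: "DIM('a::euclidean_space) \<ge> 2"
  obtains \<eta> :: "nat \<Rightarrow> 'a::euclidean_space \<Rightarrow> real" and r :: "nat \<Rightarrow> real" where
    "\<And>n. test_fun UNIV (\<eta> n)" "\<And>n. 0 < r n" "\<And>n x. norm x \<le> r n \<Longrightarrow> \<eta> n x = 1"
    "(\<lambda>n. mass (\<eta> n)) \<longlonglongrightarrow> 0" "(\<lambda>n. dirichlet (\<eta> n)) \<longlonglongrightarrow> 0"
proof -
  obtain h :: "'a \<Rightarrow> real" where h: "test_fun (cball 0 2) h" "\<And>x. 0 \<le> h x" "\<And>x. norm x \<le> 1 \<Longrightarrow> h x = 1"
    using ex_cutoff by blast
  define A where "A = mass h"
  define E where "E = dirichlet h"
  have A0: "0 \<le> A" and E0: "0 \<le> E" by (simp_all add: A_def E_def)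
  have sh: "smooth h" by (rule test_fun_smooth[OF h(1)])
  have g_out: "grad h x = 0" if "norm x > 2" for x
    by (rule grad_eq_0_outside[of "cball 0 2"]) (use that test_fun_zero_outside[OF h(1)] in auto)
  have g_in: "grad h x = 0" if "norm x < 1" for x
  proof -
    have "grad (\<lambda>y. h y - 1) x = 0"
      by (rule grad_eq_0_outside[of "- ball 0 1"]) (use that h(3) in auto)
    moreover have "grad (\<lambda>y. h y - 1) x = grad h x - grad (\<lambda>_. 1) x"
      by (rule grad_diff[OF sh smooth_const])
    moreover have "grad (\<lambda>_. 1::real) x = 0" by (rule grad_eqI) simp
    ultimately show ?thesis by simp
  qed
  \<comment> \<open>The gradient of \<open>H j\<close> lives where
    \<open>1 \<le> 4^j * norm x \<le> 2\<close>. The ratio \<open>4\<close> exceeds the ratio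
    \<open>2\<close> of the radii, so these annuli are disjoint. The summand \<open>0\<close>
    matches the form of the affine lemmas.\<close>
  define H where "H j x = h ((4::real) ^ j *\<^sub>R x + 0)" for j :: nat and x
  have H: "test_fun UNIV (H j)" for j
    unfolding H_def[abs_def] by (rule test_fun_UNIV_affine[OF h(1)]) simp
  have sH: "smooth (H j)" for j by (rule test_fun_smooth[OF H])
  have gH: "grad (H j) x = 4 ^ j *\<^sub>R grad h (4 ^ j *\<^sub>R x)" for j x
    unfolding H_def[abs_def] using grad_affine[OF sh, of "4 ^ j" 0 x] by simp
  have massH: "mass (H j) \<le> A * (1/4) ^ j" for j
  proof -
    have "(4::real) ^ j \<le> (4 ^ j) ^ DIM('a)" using dim by (intro self_le_power) auto
    then have "A / (4 ^ j) ^ DIM('a) \<le> A / 4 ^ j" using A0 by (intro divide_left_mono) auto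
    then show ?thesis unfolding H_def[abs_def] using mass_affine[OF h(1), of "4 ^ j" 0]
      by (simp add: A_def power_divide)
  qed
  have dirH: "dirichlet (H j) \<le> E" for j
  proof -
    \<comment> \<open>The step where dimension at least two is decisive: the energy of the rescaled
      copy carries the factor \<open>(4^j)^(2 - DIM('a))\<close>.\<close>
    have "((4::real) ^ j)\<^sup>2 \<le> (4 ^ j) ^ DIM('a)" using dim by (intro power_increasing) auto
    then have "((4::real) ^ j)\<^sup>2 * E / (4 ^ j) ^ DIM('a) \<le> E"
      using E0 by (simp add: divide_le_eq mult_left_mono mult.commute)
    then show ?thesis unfolding H_def[abs_def] using dirichlet_affine[OF h(1), of "4 ^ j" 0]
      by (simp add: E_def)
  qed
  have orth: "grad (H i) x \<bullet> grad (H j) x = 0" if "i < j" for i j x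
  proof (rule ccontr)
    assume "\<not> ?thesis"
    then have "grad h (4 ^ i *\<^sub>R x) \<noteq> 0" "grad h (4 ^ j *\<^sub>R x) \<noteq> 0" by (auto simp: gH)
    then have 1: "1 \<le> norm (4 ^ i *\<^sub>R x)" "norm (4 ^ j *\<^sub>R x) \<le> 2" using g_out g_in by (meson not_less)+
    have "(4::real) ^ Suc i \<le> 4 ^ j" using that by (intro power_increasing) auto
    then have "4 ^ Suc i * norm x \<le> 4 ^ j * norm x" by (intro mult_right_mono) auto
    then show False using 1 by simp
  qed
  define \<eta> where "\<eta> n x = (1 / real (Suc n)) * (\<Sum>j<Suc n. H j x)" for n x
  have \<eta>: "test_fun UNIV (\<eta> n)" for n
    unfolding \<eta>_def[abs_def] by (intro test_fun_cmult test_fun_sum H finite_lessThan)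
  have g\<eta>: "grad (\<eta> n) x = (1 / real (Suc n)) *\<^sub>R (\<Sum>j<Suc n. grad (H j) x)" for n x
    unfolding \<eta>_def[abs_def] using grad_cmult[OF smooth_sum[of "{..<Suc n}" H], of "1 / real (Suc n)" x] grad_sum[of "{..<Suc n}" H x] sH
    by simp
  have iH: "integrable lebesgue (\<lambda>x. (H j x)\<^sup>2)" "integrable lebesgue (\<lambda>x. (norm (grad (H j) x))\<^sup>2)" for j
    using L2_integrable_norm[OF test_fun_L2[OF H]] L2_integrable_norm[OF test_fun_L2_grad[OF H]] by auto
  have i\<eta>: "integrable lebesgue (\<lambda>x. (\<eta> n x)\<^sup>2)" for n
    using L2_integrable_norm[OF test_fun_L2[OF \<eta>]] by simp
  have mass\<eta>: "mass (\<eta> n) \<le> 2 * A / real (Suc n)" for n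
  proof -
    have "(\<eta> n x)\<^sup>2 \<le> (1 / real (Suc n)) * (\<Sum>j<Suc n. (H j x)\<^sup>2)" for x
    proof -
      have "(\<Sum>j<Suc n. H j x)\<^sup>2 \<le> (\<Sum>j<Suc n. (H j x)\<^sup>2) * card {..<Suc n}"
        by (rule sum_squared_le_sum_of_squares)
      then have "(1 / real (Suc n))\<^sup>2 * (\<Sum>j<Suc n. H j x)\<^sup>2 \<le> (1 / real (Suc n))\<^sup>2 * ((\<Sum>j<Suc n. (H j x)\<^sup>2) * real (Suc n))"
        by (intro mult_left_mono) auto
      also have "\<dots> = (1 / real (Suc n)) * (\<Sum>j<Suc n. (H j x)\<^sup>2)"
        by (simp add: power2_eq_square del: of_nat_Suc)
      finally show ?thesis unfolding \<eta>_def power_mult_distrib .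
    qed
    then have "mass (\<eta> n) \<le> (LINT x|lebesgue. (1 / real (Suc n)) * (\<Sum>j<Suc n. (H j x)\<^sup>2))"
      by (intro integral_mono integrable_mult_right Bochner_Integration.integrable_sum iH i\<eta>)
    also have "\<dots> = (1 / real (Suc n)) * (\<Sum>j<Suc n. mass (H j))"
      by (subst integral_mult_right_zero, subst Bochner_Integration.integral_sum) (auto intro: iH)
    also have "\<dots> \<le> (1 / real (Suc n)) * (2 * A)"
    proof (rule mult_left_mono)
      have "(\<Sum>j<Suc n. mass (H j)) \<le> (\<Sum>j<Suc n. A * (1/4) ^ j)" by (intro sum_mono massH)
      also have "\<dots> = A * (\<Sum>j<Suc n. (1/4) ^ j)" by (simp only: sum_distrib_left)
      also have "\<dots> \<le> A * 2"
      proof (rule mult_left_mono[OF _ A0])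
        have "(\<Sum>j<Suc n. (1/4::real) ^ j) \<le> (\<Sum>j. (1/4) ^ j)"
          by (rule sum_le_suminf) (auto intro: summable_geometric)
        also have "\<dots> \<le> 2" by (subst suminf_geometric) auto
        finally show "(\<Sum>j<Suc n. (1/4::real) ^ j) \<le> 2" .
      qed
      finally show "(\<Sum>j<Suc n. mass (H j)) \<le> 2 * A" by simp
    qed simp
    finally show ?thesis by simp
  qed
  have dir\<eta>: "dirichlet (\<eta> n) \<le> E / real (Suc n)" for n
  proof -
    have "(norm (grad (\<eta> n) x))\<^sup>2 = (1 / real (Suc n))\<^sup>2 * (\<Sum>j<Suc n. (norm (grad (H j) x))\<^sup>2)" for x
    proof -
      have "pairwise (\<lambda>i j. orthogonal (grad (H i) x) (grad (H j) x)) {..<Suc n}"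
        unfolding pairwise_def orthogonal_def
      proof (intro ballI impI)
        fix i j :: nat assume "i \<noteq> j"
        then show "grad (H i) x \<bullet> grad (H j) x = 0"
          using orth[of i j x] orth[of j i x] by (cases "i < j") (auto simp: inner_commute)
      qed
      then have "(norm (\<Sum>j<Suc n. grad (H j) x))\<^sup>2 = (\<Sum>j<Suc n. (norm (grad (H j) x))\<^sup>2)"
        by (intro norm_sum_Pythagorean) auto
      then show ?thesis unfolding g\<eta> norm_scaleR power_mult_distrib by simp
    qed
    then have "dirichlet (\<eta> n) = (1 / real (Suc n))\<^sup>2 * (\<Sum>j<Suc n. dirichlet (H j))"
      by (simp only: integral_mult_right_zero, subst Bochner_Integration.integral_sum) (auto intro: iH)
    also have "\<dots> \<le> (1 / real (Suc n))\<^sup>2 * (\<Sum>j<Suc n. E)"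
      by (intro mult_left_mono sum_mono dirH) auto
    also have "\<dots> = E / real (Suc n)" by (simp add: power2_eq_square del: of_nat_Suc)
    finally show ?thesis .
  qed
  have lim0: "(\<lambda>n. c / real (Suc n)) \<longlonglongrightarrow> 0" for c
    using tendsto_mult_right_zero[OF LIMSEQ_inverse_real_of_nat, of c] by (simp add: divide_inverse)
  show ?thesis
  \<comment> \<open>The smallest of the radii on which the copies \<open>H 0\<close>, ...,
    \<open>H n\<close> equal \<open>1\<close>, so their average is \<open>1\<close> there.\<close>
  proof (rule that[of \<eta> "\<lambda>n. (1/4) ^ n"])
    show "\<eta> n x = 1" if x: "norm x \<le> (1/4) ^ n" for n x
    proof -
      have "H j x = 1" if "j < Suc n" for j
      proof -
        have "(4::real) ^ j * norm x \<le> 4 ^ n * (1/4) ^ n"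
          using that x by (intro mult_mono power_increasing) auto
        then show ?thesis by (simp add: H_def h(3) power_one_over)
      qed
      then show ?thesis by (simp add: \<eta>_def)
    qed
    show "(\<lambda>n. mass (\<eta> n)) \<longlonglongrightarrow> 0"
      by (rule tendsto_sandwich[OF _ _ tendsto_const lim0[of "2 * A"]]) (use mass\<eta> in auto)
    show "(\<lambda>n. dirichlet (\<eta> n)) \<longlonglongrightarrow> 0"
      by (rule tendsto_sandwich[OF _ _ tendsto_const lim0[of E]]) (use dir\<eta> in auto)
  qed (auto intro: \<eta>)
qed

text \<open>Multiply \<open>\<phi>\<close> by one minus a cutoff at \<open>a\<close> of small
  capacity. Since \<open>\<phi>\<close> and its gradient are bounded, the removed part
  \<open>\<omega> n\<close> tends to \<open>0\<close> in mass and energy, and the strict Rayleigh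
  inequality survives for large \<open>n\<close>.\<close>

lemma rayleigh_remove_point:
  fixes \<phi> :: "'a::euclidean_space \<Rightarrow> real"
  assumes dim: "DIM('a) \<ge> 2" and \<phi>: "test_fun UNIV \<phi>" and less: "dirichlet \<phi> < e * mass \<phi>"
  obtains \<psi> r where "0 < r" "test_fun UNIV \<psi>" "\<And>x. \<phi> x = 0 \<Longrightarrow> \<psi> x = 0"
    "\<And>x. dist x a \<le> r \<Longrightarrow> \<psi> x = 0" "dirichlet \<psi> < e * mass \<psi>"
proof -
  obtain \<eta> :: "nat \<Rightarrow> 'a \<Rightarrow> real" and r :: "nat \<Rightarrow> real" where
    \<eta>: "\<And>n. test_fun UNIV (\<eta> n)" "\<And>n. 0 < r n" "\<And>n x. norm x \<le> r n \<Longrightarrow> \<eta> n x = 1"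
    "(\<lambda>n. mass (\<eta> n)) \<longlonglongrightarrow> 0" "(\<lambda>n. dirichlet (\<eta> n)) \<longlonglongrightarrow> 0"
    by (rule point_capacity_zero[OF dim]) (rule that)
  define \<theta> where "\<theta> n x = \<eta> n (1 *\<^sub>R x + - a)" for n x
  have \<theta>: "test_fun UNIV (\<theta> n)" for n
    unfolding \<theta>_def[abs_def] by (rule test_fun_UNIV_affine[OF \<eta>(1)]) simp
  have m\<theta>: "mass (\<theta> n) = mass (\<eta> n)" for n
    unfolding \<theta>_def[abs_def] using mass_affine[OF \<eta>(1), of 1 n "- a"] by simp
  have d\<theta>: "dirichlet (\<theta> n) = dirichlet (\<eta> n)" for n
    unfolding \<theta>_def[abs_def] using dirichlet_affine[OF \<eta>(1), of 1 n "- a"] by simp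
  obtain B where B: "0 \<le> B" "\<And>x. norm (\<phi> x) \<le> B"
    by (rule cont_csupp_bounded[OF test_fun_cont_csupp[OF \<phi>]]) (rule that)
  obtain C where C: "0 \<le> C" "\<And>x. norm (grad \<phi> x) \<le> C"
    by (rule cont_csupp_bounded[OF test_fun_cont_csupp_grad[OF \<phi>]]) (rule that)
  define \<omega> where "\<omega> n x = \<phi> x * \<theta> n x" for n x
  define \<psi> where "\<psi> n x = \<phi> x - \<omega> n x" for n x
  have s: "smooth \<phi>" "smooth (\<theta> n)" for n using \<phi> \<theta> by (auto intro: test_fun_smooth)
  have \<omega>: "test_fun UNIV (\<omega> n)" for n
    unfolding \<omega>_def[abs_def] by (rule test_fun_compose[OF \<phi>], rule smooth_mult[OF s]) simp
  have \<psi>: "test_fun UNIV (\<psi> n)" for n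
    unfolding \<psi>_def[abs_def] by (rule test_fun_diff[OF \<phi> \<omega>])
  have i\<theta>: "integrable lebesgue (\<lambda>x. (\<theta> n x)\<^sup>2)" "integrable lebesgue (\<lambda>x. (norm (grad (\<theta> n) x))\<^sup>2)" for n
    using L2_integrable_norm[OF test_fun_L2[OF \<theta>]] L2_integrable_norm[OF test_fun_L2_grad[OF \<theta>]] by auto
  have i\<omega>: "integrable lebesgue (\<lambda>x. (\<omega> n x)\<^sup>2)" "integrable lebesgue (\<lambda>x. (norm (grad (\<omega> n) x))\<^sup>2)" for n
    using L2_integrable_norm[OF test_fun_L2[OF \<omega>]] L2_integrable_norm[OF test_fun_L2_grad[OF \<omega>]] by auto
  have m\<omega>: "mass (\<omega> n) \<le> B\<^sup>2 * mass (\<eta> n)" for n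
  proof -
    have "mass (\<omega> n) \<le> (LINT x|lebesgue. B\<^sup>2 * (\<theta> n x)\<^sup>2)"
    proof (intro integral_mono i\<omega> integrable_mult_right i\<theta>)
      fix x
      have "(\<phi> x)\<^sup>2 \<le> B\<^sup>2" using power_mono[OF B(2)[of x], of 2] by simp
      then show "(\<omega> n x)\<^sup>2 \<le> B\<^sup>2 * (\<theta> n x)\<^sup>2" by (simp add: \<omega>_def power_mult_distrib mult_right_mono)
    qed
    then show ?thesis by (simp add: m\<theta>)
  qed
  have d\<omega>: "dirichlet (\<omega> n) \<le> 2 * B\<^sup>2 * dirichlet (\<eta> n) + 2 * C\<^sup>2 * mass (\<eta> n)" for n
  proof -
    have "dirichlet (\<omega> n) \<le> (LINT x|lebesgue. 2 * B\<^sup>2 * (norm (grad (\<theta> n) x))\<^sup>2 + 2 * C\<^sup>2 * (\<theta> n x)\<^sup>2)"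
    proof (intro integral_mono i\<omega> Bochner_Integration.integrable_add integrable_mult_right i\<theta>)
      fix x
      have "norm (grad (\<omega> n) x) \<le> B * norm (grad (\<theta> n) x) + C * \<bar>\<theta> n x\<bar>"
      proof -
        have "norm (grad (\<omega> n) x) = norm (\<phi> x *\<^sub>R grad (\<theta> n) x + \<theta> n x *\<^sub>R grad \<phi> x)"
          unfolding \<omega>_def[abs_def] by (simp add: grad_mult[OF s])
        also have "\<dots> \<le> \<bar>\<phi> x\<bar> * norm (grad (\<theta> n) x) + \<bar>\<theta> n x\<bar> * norm (grad \<phi> x)"
          using norm_triangle_ineq[of "\<phi> x *\<^sub>R grad (\<theta> n) x" "\<theta> n x *\<^sub>R grad \<phi> x"] by simp
        also have "\<dots> \<le> B * norm (grad (\<theta> n) x) + \<bar>\<theta> n x\<bar> * C"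
          using B(2)[of x] C(2)[of x] by (intro add_mono mult_right_mono mult_left_mono) auto
        finally show ?thesis by (simp add: mult.commute)
      qed
      then have "(norm (grad (\<omega> n) x))\<^sup>2 \<le> (B * norm (grad (\<theta> n) x) + C * \<bar>\<theta> n x\<bar>)\<^sup>2"
        by (intro power_mono) auto
      also have "\<dots> \<le> 2 * (B * norm (grad (\<theta> n) x))\<^sup>2 + 2 * (C * \<bar>\<theta> n x\<bar>)\<^sup>2"
        using sum_squares_bound[of "B * norm (grad (\<theta> n) x)" "C * \<bar>\<theta> n x\<bar>"] by (simp add: power2_sum)
      finally show "(norm (grad (\<omega> n) x))\<^sup>2 \<le> 2 * B\<^sup>2 * (norm (grad (\<theta> n) x))\<^sup>2 + 2 * C\<^sup>2 * (\<theta> n x)\<^sup>2"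
        by (simp add: power_mult_distrib)
    qed
    also have "\<dots> = 2 * B\<^sup>2 * dirichlet (\<eta> n) + 2 * C\<^sup>2 * mass (\<eta> n)"
      using i\<theta>[of n] by (simp add: m\<theta> d\<theta>)
    finally show ?thesis .
  qed
  have "(\<lambda>n. B\<^sup>2 * mass (\<eta> n)) \<longlonglongrightarrow> 0" by (rule tendsto_mult_right_zero[OF \<eta>(4)])
  then have "(\<lambda>n. mass (\<omega> n)) \<longlonglongrightarrow> 0"
    by (rule Lim_null_comparison[rotated]) (use m\<omega> in auto)
  then have 1: "(\<lambda>n. LINT x|lebesgue. (norm (\<psi> n x - \<phi> x))\<^sup>2) \<longlonglongrightarrow> 0"
    by (simp add: \<psi>_def)
  have "(\<lambda>n. 2 * B\<^sup>2 * dirichlet (\<eta> n) + 2 * C\<^sup>2 * mass (\<eta> n)) \<longlonglongrightarrow> 0"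
    using tendsto_add[OF tendsto_mult_right_zero[OF \<eta>(5), of "2 * B\<^sup>2"] tendsto_mult_right_zero[OF \<eta>(4), of "2 * C\<^sup>2"]] by simp
  then have "(\<lambda>n. dirichlet (\<omega> n)) \<longlonglongrightarrow> 0"
    by (rule Lim_null_comparison[rotated]) (use d\<omega> in auto)
  moreover have "grad (\<psi> n) x - grad \<phi> x = - grad (\<omega> n) x" for n x
    unfolding \<psi>_def[abs_def] by (simp add: grad_diff[OF s(1) test_fun_smooth[OF \<omega>]])
  ultimately have 2: "(\<lambda>n. LINT x|lebesgue. (norm (grad (\<psi> n) x - grad \<phi> x))\<^sup>2) \<longlonglongrightarrow> 0"
    by simp
  have "(\<lambda>n. mass (\<psi> n)) \<longlonglongrightarrow> mass \<phi>"
    using L2_norm_tendsto[OF test_fun_L2[OF \<psi>] test_fun_L2[OF \<phi>] 1] by simp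
  moreover have "(\<lambda>n. dirichlet (\<psi> n)) \<longlonglongrightarrow> dirichlet \<phi>"
    by (rule L2_norm_tendsto[OF test_fun_L2_grad[OF \<psi>] test_fun_L2_grad[OF \<phi>] 2])
  ultimately have "(\<lambda>n. e * mass (\<psi> n) - dirichlet (\<psi> n)) \<longlonglongrightarrow> e * mass \<phi> - dirichlet \<phi>"
    by (intro tendsto_diff tendsto_mult_left)
  then have "\<forall>\<^sub>F n in sequentially. 0 < e * mass (\<psi> n) - dirichlet (\<psi> n)"
    by (rule order_tendstoD) (use less in simp)
  then obtain n where n: "0 < e * mass (\<psi> n) - dirichlet (\<psi> n)"
    by (meson eventually_sequentially order_refl)
  show ?thesis
  proof (rule that[of "r n" "\<psi> n"])
    show "\<psi> n x = 0" if "dist x a \<le> r n" for x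
      using \<eta>(3)[of "x - a" n] that by (simp add: \<psi>_def \<omega>_def \<theta>_def dist_norm)
    show "\<psi> n x = 0" if "\<phi> x = 0" for x using that by (simp add: \<psi>_def \<omega>_def)
  qed (use n \<psi> \<eta>(2) in auto)
qed

text \<open>Each removal preserves the existing zero set, so earlier holes stay open while the
  induction adds one more; only the common radius shrinks.\<close>

lemma rayleigh_remove_finite:
  fixes \<phi> :: "'a::euclidean_space \<Rightarrow> real"
  assumes dim: "DIM('a) \<ge> 2" and K: "finite K" and \<phi>: "test_fun UNIV \<phi>" and less: "dirichlet \<phi> < e * mass \<phi>"
  shows "\<exists>\<psi> r. 0 < r \<and> test_fun UNIV \<psi> \<and> (\<forall>x. \<phi> x = 0 \<longrightarrow> \<psi> x = 0) \<and>
    (\<forall>k\<in>K. \<forall>x. dist x k \<le> r \<longrightarrow> \<psi> x = 0) \<and> dirichlet \<psi> < e * mass \<psi>"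
  using K
proof (induction K rule: finite_induct)
  case empty
  show ?case using \<phi> less by (intro exI[of _ \<phi>] exI[of _ 1]) auto
next
  case (insert a K)
  then obtain \<psi> r where \<psi>: "0 < r" "test_fun UNIV \<psi>" "\<And>x. \<phi> x = 0 \<Longrightarrow> \<psi> x = 0"
    "\<And>k x. k \<in> K \<Longrightarrow> dist x k \<le> r \<Longrightarrow> \<psi> x = 0" "dirichlet \<psi> < e * mass \<psi>" by blast
  obtain \<psi>' r' where \<psi>': "0 < r'" "test_fun UNIV \<psi>'" "\<And>x. \<psi> x = 0 \<Longrightarrow> \<psi>' x = 0"
    "\<And>x. dist x a \<le> r' \<Longrightarrow> \<psi>' x = 0" "dirichlet \<psi>' < e * mass \<psi>'"
    by (rule rayleigh_remove_point[OF dim \<psi>(2,5), of a]) (rule that)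
  show ?case
  proof (intro exI[of _ \<psi>'] exI[of _ "min r r'"] conjI ballI allI impI)
    show "\<psi>' x = 0" if "k \<in> insert a K" "dist x k \<le> min r r'" for k x
      using that \<psi>'(3,4) \<psi>(4) by auto
  qed (use \<psi> \<psi>' in auto)
qed

lemma ex_small_rayleigh:
  assumes "0 < e"
  obtains \<phi> :: "'a::euclidean_space \<Rightarrow> real" where "test_fun UNIV \<phi>" "dirichlet \<phi> < e * mass \<phi>"
proof -
  obtain h :: "'a \<Rightarrow> real" where h: "test_fun UNIV h" "0 < (LINT x|lebesgue. h x)" "0 < mass h"
    by (rule ex_test_fun_pos[OF open_UNIV UNIV_not_empty]) (rule that)
  \<comment> \<open>Stretching by \<open>1 / c\<close> multiplies the Rayleigh quotient by
    \<open>c^2\<close>. The added \<open>1\<close> keeps the denominator positive and yields the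
    strict inequality.\<close>
  define c where "c = sqrt (e * mass h / (dirichlet h + 1))"
  have d0: "0 \<le> dirichlet h" by simp
  have c: "0 < c" using assms h(3) d0 by (simp add: c_def add_nonneg_pos)
  have "c\<^sup>2 * dirichlet h < e * mass h"
  proof -
    have "c\<^sup>2 = e * mass h / (dirichlet h + 1)" using assms h(3) d0 by (simp add: c_def)
    then have "c\<^sup>2 + c\<^sup>2 * dirichlet h = e * mass h" using d0 by (simp add: field_simps)
    moreover have "0 < c\<^sup>2" using c by simp
    ultimately show ?thesis by linarith
  qed
  then have "dirichlet (\<lambda>x. h (c *\<^sub>R x + 0)) < e * mass (\<lambda>x. h (c *\<^sub>R x + 0))"
    unfolding dirichlet_affine[OF h(1) c] mass_affine[OF h(1) c] using c by (simp add: divide_strict_right_mono)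
  then show ?thesis using c by (intro that[of "\<lambda>x. h (c *\<^sub>R x + 0)"] test_fun_UNIV_affine[OF h(1)]) auto
qed

section \<open>Periodically perforated space\<close>

definition lattice :: "'a::euclidean_space set" where
  "lattice = {x. \<forall>b\<in>Basis. x \<bullet> b \<in> \<int>}"

lemma zero_in_lattice [simp]: "0 \<in> lattice"
  by (simp add: lattice_def)

lemma lattice_diff: "x \<in> lattice \<Longrightarrow> y \<in> lattice \<Longrightarrow> x - y \<in> lattice"
  by (simp add: lattice_def inner_diff_left)

lemma finite_lattice_cball: "finite (lattice \<inter> cball (0::'a::euclidean_space) R)"
proof (rule finite_subset)
  let ?Z = "real_of_int ` {- \<lceil>R\<rceil>..\<lceil>R\<rceil>}"
  let ?F = "\<lambda>f. \<Sum>b\<in>Basis. f b *\<^sub>R (b::'a)"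
  show "finite (?F ` (Basis \<rightarrow>\<^sub>E ?Z))" by (intro finite_imageI finite_PiE) auto
  show "lattice \<inter> cball (0::'a) R \<subseteq> ?F ` (Basis \<rightarrow>\<^sub>E ?Z)"
  proof
    fix x :: 'a assume x: "x \<in> lattice \<inter> cball 0 R"
    have m: "(\<lambda>b\<in>Basis. x \<bullet> b) \<in> (Basis \<rightarrow>\<^sub>E ?Z)"
    proof (rule restrict_PiE_iff[THEN iffD2], rule ballI)
      fix b :: 'a assume b: "b \<in> Basis"
      then obtain i where i: "x \<bullet> b = of_int i" using x by (auto simp: lattice_def elim: Ints_cases)
      have "\<bar>x \<bullet> b\<bar> \<le> R" using x Basis_le_norm[OF b, of x] by simp
      then have "\<bar>i\<bar> \<le> \<lceil>R\<rceil>" unfolding i by linarith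
      then show "x \<bullet> b \<in> ?Z" unfolding i by (intro imageI) auto
    qed
    have "x = ?F (\<lambda>b\<in>Basis. x \<bullet> b)"
      by (simp add: euclidean_representation cong: sum.cong)
    from image_eqI[where f = ?F, OF this m] show "x \<in> ?F ` (Basis \<rightarrow>\<^sub>E ?Z)" .
  qed
qed

lemma norm_le_DIM_if_coords_le_1:
  fixes x :: "'a::euclidean_space"
  assumes "\<And>b. b \<in> Basis \<Longrightarrow> \<bar>x \<bullet> b\<bar> \<le> 1"
  shows "(norm x)\<^sup>2 \<le> real DIM('a)" "norm x \<le> real DIM('a)"
proof -
  have "(norm x)\<^sup>2 = (\<Sum>b\<in>Basis. (x \<bullet> b) * (x \<bullet> b))"
    unfolding power2_norm_eq_inner by (rule euclidean_inner)
  also have "\<dots> \<le> (\<Sum>b\<in>(Basis::'a set). 1)"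
    using assms by (intro sum_mono) (simp add: abs_le_square_iff flip: power2_eq_square abs_square_le_1)
  finally show "(norm x)\<^sup>2 \<le> real DIM('a)" by simp
  have "norm x \<le> (\<Sum>b\<in>Basis. \<bar>x \<bullet> b\<bar>)" by (rule norm_le_l1)
  also have "\<dots> \<le> (\<Sum>b\<in>(Basis::'a set). 1)" using assms by (intro sum_mono) auto
  finally show "norm x \<le> real DIM('a)" by simp
qed

lemma lattice_near:
  fixes x :: "'a::euclidean_space"
  obtains k where "k \<in> lattice" "norm (x - k) \<le> real DIM('a)"
proof -
  define k where "k = (\<Sum>b\<in>Basis. real_of_int \<lfloor>x \<bullet> b\<rfloor> *\<^sub>R b)"
  have k: "k \<bullet> b = real_of_int \<lfloor>x \<bullet> b\<rfloor>" if "b \<in> Basis" for b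
    using that by (simp add: k_def inner_sum_left inner_Basis if_distrib cong: if_cong)
  have "k \<in> lattice" by (simp add: lattice_def k)
  moreover have "norm (x - k) \<le> real DIM('a)"
  proof (rule norm_le_DIM_if_coords_le_1)
    fix b :: 'a assume "b \<in> Basis"
    then show "\<bar>(x - k) \<bullet> b\<bar> \<le> 1" unfolding inner_diff_left using k[of b] by linarith
  qed
  ultimately show ?thesis by (rule that)
qed

definition perforated :: "real \<Rightarrow> 'a::euclidean_space set" where
  "perforated r = {x. r < infdist x lattice}"

lemma open_perforated: "open (perforated r)"
  unfolding perforated_def by (intro open_Collect_less continuous_intros)

text \<open>Subtracting \<open>k\<close> maps the lattice into itself, so each distance from
  \<open>x + k\<close> is also a distance from \<open>x\<close>. This invariance keeps the
  translates of \<open>\<phi>\<close> inside the perforated space.\<close>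

lemma perforated_translate:
  assumes "k \<in> lattice" "x \<in> perforated r" shows "x + k \<in> perforated r"
proof -
  have "infdist x lattice \<le> infdist (x + k) lattice"
    unfolding infdist_notempty[of lattice, OF ex_in_conv[THEN iffD1, OF exI, OF zero_in_lattice]]
  proof (rule cINF_greatest)
    fix a assume a: "a \<in> (lattice :: 'a set)"
    have "(INF a\<in>lattice. dist x a) \<le> dist x (a - k)"
      by (rule cINF_lower) (use lattice_diff[OF a assms(1)] in \<open>auto intro: bdd_belowI2[of _ 0]\<close>)
    then show "(INF a\<in>lattice. dist x a) \<le> dist (x + k) a" by (simp add: dist_norm algebra_simps)
  qed (use zero_in_lattice in blast)
  then show ?thesis using assms(2) by (simp add: perforated_def)
qed

text \<open>A compactly supported function of small Rayleigh quotient meets only finitely many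
  holes: lattice points of norm above \<open>R + 1\<close> are at distance at least \<open>1\<close>
  from its support, and the finitely many others are removed at small cost.\<close>

lemma perforated_small_rayleigh:
  assumes dim: "DIM('a::euclidean_space) \<ge> 2" and "0 < e"
  obtains r and \<phi> :: "'a::euclidean_space \<Rightarrow> real" where "0 < r" "test_fun (perforated r) \<phi>" "dirichlet \<phi> < e * mass \<phi>"
proof -
  obtain \<phi>0 :: "'a \<Rightarrow> real" where \<phi>0: "test_fun UNIV \<phi>0" "dirichlet \<phi>0 < e * mass \<phi>0"
    by (rule ex_small_rayleigh[OF assms(2)]) (rule that)
  obtain S where S: "compact S" "\<And>x. x \<notin> S \<Longrightarrow> \<phi>0 x = 0" using \<phi>0(1) by (auto simp: test_fun_iff)
  obtain R where R: "\<And>x. x \<in> S \<Longrightarrow> norm x \<le> R" using compact_imp_bounded[OF S(1)] by (auto simp: bounded_iff)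
  let ?K = "lattice \<inter> cball (0::'a) (R + 1)"
  obtain \<psi> r where \<psi>: "0 < r" "test_fun UNIV \<psi>" "\<And>x. \<phi>0 x = 0 \<Longrightarrow> \<psi> x = 0"
    "\<And>k x. k \<in> ?K \<Longrightarrow> dist x k \<le> r \<Longrightarrow> \<psi> x = 0" "dirichlet \<psi> < e * mass \<psi>"
    using rayleigh_remove_finite[OF dim finite_lattice_cball \<phi>0, of "R + 1"] by blast
  define q where "q = min r 1"
  have q: "0 < q" using \<psi>(1) by (simp add: q_def)
  have ne: "(lattice :: 'a set) \<noteq> {}" using zero_in_lattice by blast
  have far: "q \<le> infdist x lattice" if "\<psi> x \<noteq> 0" for x
    unfolding infdist_notempty[OF ne]
  proof (rule cINF_greatest[OF ne])
    fix k assume k: "k \<in> (lattice :: 'a set)"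
    show "q \<le> dist x k"
    proof (cases "norm k \<le> R + 1")
      case True
      then have "\<not> dist x k \<le> r" using \<psi>(4)[of k x] k that by auto
      then show ?thesis by (simp add: q_def)
    next
      case False
      have "x \<in> S" using that \<psi>(3) S(2) by blast
      then have "norm x \<le> R" by (rule R)
      then have "1 \<le> dist x k" using False norm_triangle_ineq2[of k x] by (simp add: dist_norm norm_minus_commute)
      then show ?thesis by (simp add: q_def)
    qed
  qed
  have "closure {x. \<psi> x \<noteq> 0} \<subseteq> {x. q \<le> infdist x lattice}"
    by (rule closure_minimal) (use far in \<open>auto intro!: closed_Collect_le continuous_intros\<close>)
  \<comment> \<open>Halving turns the closed condition, which the closure of the support inherits,
    into the strict inequality that defines \<open>perforated\<close>.\<close>
  also have "\<dots> \<subseteq> perforated (q / 2)" using q by (auto simp: perforated_def)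
  finally have "test_fun (perforated (q / 2)) \<psi>" using \<psi>(2) by (simp add: test_fun_def)
  then show ?thesis using q \<psi>(5) by (intro that[of "q / 2" \<psi>]) auto
qed

lemma nn_integral_translation_estimate:
  fixes f :: "'a::euclidean_space \<Rightarrow> real"
  assumes f: "test_fun UNIV f"
  shows "(\<integral>\<^sup>+x. ennreal ((f (x + h) - f x)\<^sup>2) \<partial>lborel) \<le> ennreal ((norm h)\<^sup>2 * dirichlet f)"
proof -
  note cc = test_fun_cont_csupp[OF f]
  have c: "cont_csupp (\<lambda>x. (f (x + h) - f x)\<^sup>2)"
    by (intro cont_csupp_square cont_csupp_diff cont_csupp_translate cc)
  have "(\<integral>\<^sup>+x. ennreal ((f (x + h) - f x)\<^sup>2) \<partial>lborel) = ennreal (LINT x|lborel. (f (x + h) - f x)\<^sup>2)"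
    by (intro nn_integral_eq_integral cont_csupp_integrable_lborel c) auto
  also have "\<dots> \<le> ennreal ((norm h)\<^sup>2 * dirichlet f)"
    using test_fun_translation_estimate[OF f, of h] by (intro ennreal_leI) (simp add: cont_csupp_lebesgue_lborel[OF c])
  finally show ?thesis .
qed

text \<open>From any \<open>x\<close>, shifts \<open>h\<close> with \<open>norm h \<le> R\<close>
  cover a whole hole, a ball of radius \<open>r\<close> on which \<open>\<phi>\<close> vanishes.
  Hence \<open>b r\<close> times the square of \<open>\<phi> x\<close> is at most the integral of
  the squared increments over these shifts. Integrating in \<open>x\<close>, swapping the integrals
  and using the translation estimate gives \<open>c\<close>.\<close>

lemma perforated_poincare:
  assumes r: "0 < r"
  shows "\<exists>c>0. \<forall>\<phi>. test_fun (perforated r :: 'a::euclidean_space set) \<phi> \<longrightarrow> c * mass \<phi> \<le> dirichlet \<phi>"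
proof -
  define R where "R = real DIM('a) + r"
  have R: "0 < R" using r by (simp add: R_def add_nonneg_pos)
  define b where "b s = measure lborel (cball (0::'a) s)" for s
  have b: "0 < b s" if "0 < s" for s using content_cball_pos[OF that, of "0::'a"] by (simp add: b_def)
  have eb: "emeasure lborel (cball a s) = ennreal (b s)" if "0 \<le> s" for a :: 'a and s
    using that by (simp add: b_def measure_def emeasure_cball)
  define c where "c = b r / (b R * R\<^sup>2)"
  have "c * mass \<phi> \<le> dirichlet \<phi>" if \<phi>: "test_fun (perforated r :: 'a set) \<phi>" for \<phi>
  proof -
    have \<phi>U: "test_fun UNIV \<phi>" using test_fun_mono[OF \<phi>] by simp
    have cont: "continuous_on UNIV \<phi>" by (rule smooth_continuous[OF test_fun_smooth[OF \<phi>]])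
    have [measurable]: "\<phi> \<in> borel_measurable borel" using cont by (rule borel_measurable_continuous_onI)
    have [measurable]: "cball (0::'a) R \<in> sets borel" by simp
    note c2 = cont_csupp_square[OF test_fun_cont_csupp[OF \<phi>]]
    have inner: "ennreal (b r) * ennreal ((\<phi> x)\<^sup>2) \<le> (\<integral>\<^sup>+h. indicator (cball 0 R) h * ennreal ((\<phi> (x + h) - \<phi> x)\<^sup>2) \<partial>lborel)" for x
    proof -
      obtain k where k: "k \<in> lattice" "norm (x - k) \<le> real DIM('a)" by (rule lattice_near)
      have "ennreal (b r) * ennreal ((\<phi> x)\<^sup>2) = (\<integral>\<^sup>+h. ennreal ((\<phi> x)\<^sup>2) * indicator (cball (k - x) r) h \<partial>lborel)"
        using r by (simp add: nn_integral_cmult_indicator eb mult.commute)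
      also have "\<dots> \<le> (\<integral>\<^sup>+h. indicator (cball 0 R) h * ennreal ((\<phi> (x + h) - \<phi> x)\<^sup>2) \<partial>lborel)"
      proof (rule nn_integral_mono)
        fix h
        show "ennreal ((\<phi> x)\<^sup>2) * indicator (cball (k - x) r) h \<le> indicator (cball 0 R) h * ennreal ((\<phi> (x + h) - \<phi> x)\<^sup>2)"
        proof (cases "h \<in> cball (k - x) r")
          case True
          then have hr: "norm (k - x - h) \<le> r" by (simp add: dist_norm)
          have "norm h \<le> norm (k - x) + norm (k - x - h)"
            using norm_triangle_ineq4[of "k - x" "k - x - h"] by simp
          then have "h \<in> cball 0 R" using hr k(2) by (simp add: R_def norm_minus_commute)
          moreover have "infdist (x + h) lattice \<le> dist (x + h) k" by (rule infdist_le[OF k(1)])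
          then have "x + h \<notin> perforated r"
            using hr by (simp add: perforated_def dist_norm norm_minus_commute algebra_simps)
          then have "\<phi> (x + h) = 0" by (rule test_fun_zero_outside[OF \<phi>])
          ultimately show ?thesis using True by simp
        qed simp
      qed
      finally show ?thesis .
    qed
    have "ennreal (b r * mass \<phi>) = (\<integral>\<^sup>+x. ennreal (b r) * ennreal ((\<phi> x)\<^sup>2) \<partial>lborel)"
      using b[OF r] by (simp add: nn_integral_cmult nn_integral_eq_integral cont_csupp_integrable_lborel[OF c2]
        cont_csupp_lebesgue_lborel[OF c2] ennreal_mult)
    also have "\<dots> \<le> (\<integral>\<^sup>+x. (\<integral>\<^sup>+h. indicator (cball 0 R) h * ennreal ((\<phi> (x + h) - \<phi> x)\<^sup>2) \<partial>lborel) \<partial>lborel)"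
      by (rule nn_integral_mono) (rule inner)
    also have "\<dots> = (\<integral>\<^sup>+h. (\<integral>\<^sup>+x. indicator (cball 0 R) h * ennreal ((\<phi> (x + h) - \<phi> x)\<^sup>2) \<partial>lborel) \<partial>lborel)"
      by (rule lborel_pair.Fubini') measurable
    also have "\<dots> \<le> (\<integral>\<^sup>+h. ennreal (R\<^sup>2 * dirichlet \<phi>) * indicator (cball (0::'a) R) h \<partial>lborel)"
    proof (rule nn_integral_mono)
      fix h :: 'a
      show "(\<integral>\<^sup>+x. indicator (cball 0 R) h * ennreal ((\<phi> (x + h) - \<phi> x)\<^sup>2) \<partial>lborel) \<le> ennreal (R\<^sup>2 * dirichlet \<phi>) * indicator (cball 0 R) h"
      proof (cases "h \<in> cball 0 R")
        case True
        have "(norm h)\<^sup>2 * dirichlet \<phi> \<le> R\<^sup>2 * dirichlet \<phi>"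
          using True by (intro mult_right_mono power_mono) auto
        then show ?thesis using True nn_integral_translation_estimate[OF \<phi>U, of h]
          by (auto intro: order_trans ennreal_leI)
      qed simp
    qed
    also have "\<dots> = ennreal (R\<^sup>2 * dirichlet \<phi>) * ennreal (b R)"
      using R by (simp add: nn_integral_cmult_indicator eb)
    also have "\<dots> = ennreal (R\<^sup>2 * dirichlet \<phi> * b R)"
      using b[OF R] by (simp add: ennreal_mult)
    finally have "b r * mass \<phi> \<le> R\<^sup>2 * dirichlet \<phi> * b R"
      using b[OF R] by (subst (asm) ennreal_le_iff) auto
    then show ?thesis using b[OF R] R by (simp add: c_def field_simps)
  qed
  moreover have "0 < c" using b[OF r] b[OF R] R by (simp add: c_def)
  ultimately show ?thesis by blast
qed

text \<open>Half-open, so that a point never lies in two distinct lattice translates.\<close>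

definition unit_cube :: "'a::euclidean_space set" where
  "unit_cube = {x. \<forall>b\<in>Basis. 0 \<le> x \<bullet> b \<and> x \<bullet> b < 1}"

lemma unit_cube_measurable [measurable]: "unit_cube \<in> sets borel"
  unfolding unit_cube_def by measurable

lemma emeasure_unit_cube: "emeasure lborel (unit_cube :: 'a::euclidean_space set) = 1"
proof (rule antisym)
  have "emeasure lborel (unit_cube :: 'a set) \<le> emeasure lborel (cbox 0 (One::'a))"
    by (rule emeasure_mono) (auto simp: unit_cube_def mem_box less_imp_le)
  also have "\<dots> = 1" by (subst emeasure_lborel_cbox_eq) (simp add: inner_diff_left)
  finally show "emeasure lborel (unit_cube :: 'a set) \<le> 1" .
  have "1 = emeasure lborel (box 0 (One::'a))" by (subst emeasure_lborel_box_eq) (simp add: inner_diff_left)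
  also have "\<dots> \<le> emeasure lborel (unit_cube :: 'a set)"
    by (rule emeasure_mono) (auto simp: unit_cube_def mem_box less_imp_le)
  finally show "1 \<le> emeasure lborel (unit_cube :: 'a set)" .
qed

text \<open>Average \<open>\<integral>(u(x+h) - u(x))\<^sup>2 dx \<le> |h|\<^sup>2 \<integral>|\<nabla>u|\<^sup>2\<close> over the unit cube: a function with small Dirichlet
  energy whose local \<open>L\<^sup>2\<close> norms are at most \<open>\<surd>L\<close> has integral almost as large as a constant \<open>\<surd>L\<close>.\<close>

lemma integral_lower_bound:
  fixes u :: "'a::euclidean_space \<Rightarrow> real"
  assumes u: "test_fun UNIV u" "\<And>x. 0 \<le> u x" and L: "0 \<le> L"
    and local_mass: "\<And>x. (\<integral>\<^sup>+h. indicator unit_cube h * ennreal ((u (x + h))\<^sup>2) \<partial>lborel) \<le> ennreal L"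
  shows "mass u - real DIM('a) / 2 * dirichlet u \<le> sqrt L * (LINT x|lebesgue. u x)"
proof -
  note cc = test_fun_cont_csupp[OF u(1)]
  have cont: "continuous_on UNIV u" by (rule smooth_continuous[OF test_fun_smooth[OF u(1)]])
  have [measurable]: "u \<in> borel_measurable borel" using cont by (rule borel_measurable_continuous_onI)
  have cp: "cont_csupp (\<lambda>x. u x * u (x + h))" for h
    by (rule cont_csupp_compose[OF cc])
       (auto intro!: continuous_intros continuous_on_compose2[OF cont] cont)
  \<comment> \<open>Possibly negative, in which case \<open>ennreal I\<close> is \<open>0\<close>;
    the final comparison still returns the real inequality because its right-hand side is
    nonnegative.\<close>
  define I where "I = mass u - real DIM('a) / 2 * dirichlet u"
  \<comment> \<open>Expanding the squared increment gives the autocorrelation as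
    \<open>mass u\<close> minus half of the integrated increment; on the unit cube the squared
    length of the shift is at most \<open>DIM('a)\<close>, which explains the factor in
    \<open>I\<close>.\<close>
  have corr: "ennreal I \<le> (\<integral>\<^sup>+x. ennreal (u x * u (x + h)) \<partial>lborel)" if h: "h \<in> unit_cube" for h
  proof -
    have "(norm h)\<^sup>2 \<le> real DIM('a)"
      by (rule norm_le_DIM_if_coords_le_1) (use h in \<open>auto simp: unit_cube_def\<close>)
    then have 1: "(norm h)\<^sup>2 * dirichlet u \<le> real DIM('a) * dirichlet u" by (intro mult_right_mono) auto
    have "(LINT x|lebesgue. (u (x + h) - u x)\<^sup>2) = (LINT x|lebesgue. (u (x + h))\<^sup>2 - 2 * (u x * u (x + h)) + (u x)\<^sup>2)"
      by (simp add: power2_eq_square algebra_simps)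
    also have "\<dots> = (LINT x|lebesgue. (u (x + h))\<^sup>2) - 2 * (LINT x|lebesgue. u x * u (x + h)) + mass u"
      using cont_csupp_integrable[OF cp[of h]] cont_csupp_integrable[OF cont_csupp_square[OF cc]]
        cont_csupp_integrable[OF cont_csupp_translate[OF cont_csupp_square[OF cc]], of h] by simp
    also have "(LINT x|lebesgue. (u (x + h))\<^sup>2) = mass u"
      by (rule cont_csupp_integral_translate[OF cont_csupp_square[OF cc]])
    finally have "2 * (LINT x|lebesgue. u x * u (x + h)) = 2 * mass u - (LINT x|lebesgue. (u (x + h) - u x)\<^sup>2)" by simp
    then have "I \<le> (LINT x|lborel. u x * u (x + h))"
      using test_fun_translation_estimate[OF u(1), of h] 1 by (simp add: I_def cont_csupp_lebesgue_lborel[OF cp])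
    then have "ennreal I \<le> ennreal (LINT x|lborel. u x * u (x + h))" by (rule ennreal_leI)
    also have "\<dots> = (\<integral>\<^sup>+x. ennreal (u x * u (x + h)) \<partial>lborel)"
      by (intro nn_integral_eq_integral[symmetric] cont_csupp_integrable_lborel cp) (auto simp: u(2))
    finally show ?thesis .
  qed
  \<comment> \<open>The cube has measure one, so the mean of \<open>u\<close> over a translated cell
    is at most its root mean square there. Averaging \<open>corr\<close> over \<open>h\<close> and
    swapping integrals then replaces one factor \<open>u\<close> by the constant
    \<open>sqrt L\<close>.\<close>
  have avg: "(\<integral>\<^sup>+h. indicator unit_cube h * ennreal (u (x + h)) \<partial>lborel) \<le> ennreal (sqrt L)" for x
  proof -
    let ?f = "\<lambda>h::'a. indicator unit_cube h :: real" and ?g = "\<lambda>h::'a. indicator unit_cube h * u (x + h)"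
    have f: "L2 lborel ?f" "(LINT h|lborel. (?f h)\<^sup>2) = 1"
      using L2_indicator[of unit_cube "lborel :: 'a measure"] by (simp_all add: measure_def emeasure_unit_cube)
    have m2: "(\<integral>\<^sup>+h. ennreal ((?g h)\<^sup>2) \<partial>lborel) \<le> ennreal L"
    proof -
      have "(\<integral>\<^sup>+h. ennreal ((?g h)\<^sup>2) \<partial>lborel) = (\<integral>\<^sup>+h. indicator unit_cube h * ennreal ((u (x + h))\<^sup>2) \<partial>lborel)"
        by (rule nn_integral_cong) (simp add: indicator_def)
      then show ?thesis using local_mass[of x] by simp
    qed
    have ig: "integrable lborel (\<lambda>h. (?g h)\<^sup>2)"
    proof (rule integrableI_bounded)
      show "(\<integral>\<^sup>+h. ennreal (norm ((?g h)\<^sup>2)) \<partial>lborel) < \<infinity>"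
        using m2 by (simp add: le_less_trans)
    qed measurable
    then have g: "L2 lborel ?g" by (simp add: L2_def)
    have mg: "(LINT h|lborel. (?g h)\<^sup>2) \<le> L"
      using m2 L by (subst (asm) nn_integral_eq_integral[OF ig]) auto
    have "(LINT h|lborel. ?f h \<bullet> ?g h)\<^sup>2 \<le> (LINT h|lborel. (norm (?f h))\<^sup>2) * (LINT h|lborel. (norm (?g h))\<^sup>2)"
      by (rule L2_Cauchy_Schwarz[OF f(1) g])
    also have "\<dots> \<le> L" using f(2) mg by simp
    finally have le: "(LINT h|lborel. ?f h \<bullet> ?g h) \<le> sqrt L" by (rule real_le_rsqrt)
    have "(\<integral>\<^sup>+h. indicator unit_cube h * ennreal (u (x + h)) \<partial>lborel) = (\<integral>\<^sup>+h. ennreal (?f h \<bullet> ?g h) \<partial>lborel)"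
      by (rule nn_integral_cong) (simp add: indicator_def)
    also have "\<dots> = ennreal (LINT h|lborel. ?f h \<bullet> ?g h)"
      by (rule nn_integral_eq_integral[OF L2_integrable_inner[OF f(1) g]]) (auto simp: u(2))
    finally show ?thesis using le by (simp add: ennreal_leI)
  qed
  have "ennreal I = (\<integral>\<^sup>+h. ennreal I * indicator (unit_cube :: 'a set) h \<partial>lborel)"
    by (simp add: nn_integral_cmult_indicator emeasure_unit_cube)
  also have "\<dots> \<le> (\<integral>\<^sup>+h. (\<integral>\<^sup>+x. indicator unit_cube h * ennreal (u x * u (x + h)) \<partial>lborel) \<partial>lborel)"
  proof (rule nn_integral_mono)
    fix h :: 'a
    show "ennreal I * indicator unit_cube h \<le> (\<integral>\<^sup>+x. indicator unit_cube h * ennreal (u x * u (x + h)) \<partial>lborel)"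
      using corr[of h] by (cases "h \<in> unit_cube") auto
  qed
  also have "\<dots> = (\<integral>\<^sup>+x. (\<integral>\<^sup>+h. indicator unit_cube h * ennreal (u x * u (x + h)) \<partial>lborel) \<partial>lborel)"
    by (rule lborel_pair.Fubini') measurable
  also have "\<dots> \<le> (\<integral>\<^sup>+x. ennreal (u x) * ennreal (sqrt L) \<partial>lborel)"
  proof (rule nn_integral_mono)
    fix x :: 'a
    have "(\<integral>\<^sup>+h. indicator unit_cube h * ennreal (u x * u (x + h)) \<partial>lborel)
      = (\<integral>\<^sup>+h. ennreal (u x) * (indicator unit_cube h * ennreal (u (x + h))) \<partial>lborel)"
      by (rule nn_integral_cong) (simp add: ennreal_mult u(2) mult.left_commute)
    also have "\<dots> = ennreal (u x) * (\<integral>\<^sup>+h. indicator unit_cube h * ennreal (u (x + h)) \<partial>lborel)"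
      by (rule nn_integral_cmult) measurable
    also have "\<dots> \<le> ennreal (u x) * ennreal (sqrt L)" by (intro mult_left_mono avg) auto
    finally show "(\<integral>\<^sup>+h. indicator unit_cube h * ennreal (u x * u (x + h)) \<partial>lborel) \<le> ennreal (u x) * ennreal (sqrt L)" .
  qed
  also have "\<dots> = ennreal (LINT x|lborel. u x) * ennreal (sqrt L)"
    by (simp add: nn_integral_multc nn_integral_eq_integral[OF cont_csupp_integrable_lborel[OF cc]] u(2))
  also have "\<dots> = ennreal (sqrt L * (LINT x|lebesgue. u x))"
    by (simp add: cont_csupp_lebesgue_lborel[OF cc] ennreal_mult u(2) L mult.commute)
  finally have "I \<le> sqrt L * (LINT x|lebesgue. u x)"
    by (subst (asm) ennreal_le_iff) (auto intro!: mult_nonneg_nonneg Bochner_Integration.integral_nonneg simp: u(2) L)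
  then show ?thesis by (simp add: I_def)
qed

section \<open>Near-extremal domains\<close>

lemma nn_integral_lborel_translate:
  fixes f :: "'a::euclidean_space \<Rightarrow> ennreal"
  assumes [measurable]: "f \<in> borel_measurable borel"
  shows "(\<integral>\<^sup>+x. f (x + a) \<partial>lborel) = (\<integral>\<^sup>+x. f x \<partial>lborel)"
proof -
  have "(\<integral>\<^sup>+x. f x \<partial>lborel) = (\<integral>\<^sup>+x. f x \<partial>distr lborel borel ((+) a))" by (simp add: lborel_distr_plus)
  also have "\<dots> = (\<integral>\<^sup>+x. f (a + x) \<partial>lborel)" by (rule nn_integral_distr) measurable
  finally show ?thesis by (simp add: add.commute)
qed

lemma lattice_unit_cube_unique:
  fixes k l z :: "'a::euclidean_space"
  assumes "k \<in> lattice" "l \<in> lattice" "z + k \<in> unit_cube" "z + l \<in> unit_cube"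
  shows "k = l"
proof (rule euclidean_eqI)
  fix b :: 'a assume b: "b \<in> Basis"
  obtain i where i: "k \<bullet> b = of_int i" using assms(1) b by (auto simp: lattice_def elim: Ints_cases)
  obtain j where j: "l \<bullet> b = of_int j" using assms(2) b by (auto simp: lattice_def elim: Ints_cases)
  have "0 \<le> z \<bullet> b + of_int i" "z \<bullet> b + of_int i < 1" "0 \<le> z \<bullet> b + of_int j" "z \<bullet> b + of_int j < 1"
    using assms(3,4) b i j by (auto simp: unit_cube_def inner_add_left)
  then have "\<bar>real_of_int i - of_int j\<bar> < 1" by linarith
  then have "i = j" by linarith
  then show "k \<bullet> b = l \<bullet> b" by (simp add: i j)
qed

text \<open>Translated cells are disjoint, so at most one summand is \<open>1\<close>. This is why
  overlapping translates of \<open>\<phi>\<close> contribute no more than one full copy of its mass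
  to a cell.\<close>

lemma sum_indicator_unit_cube_le:
  assumes "finite K" "K \<subseteq> lattice"
  shows "(\<Sum>k\<in>K. indicator unit_cube (z + k) :: ennreal) \<le> 1"
proof (cases "\<exists>k\<in>K. z + k \<in> unit_cube")
  case True
  then obtain k where k: "k \<in> K" "z + k \<in> unit_cube" by blast
  have "(\<Sum>l\<in>K. indicator unit_cube (z + l) :: ennreal) = (\<Sum>l\<in>{k}. indicator unit_cube (z + l))"
  proof (rule sum.mono_neutral_right)
    show "\<forall>l\<in>K - {k}. (indicator unit_cube (z + l) :: ennreal) = 0"
      using lattice_unit_cube_unique[of k _ z] k assms(2) by (auto simp: indicator_def)
  qed (use assms k in auto)
  then show ?thesis using k(2) by simp
next
  case False
  then have "(\<Sum>k\<in>K. indicator unit_cube (z + k) :: ennreal) = 0" by (intro sum.neutral) (auto simp: indicator_def)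
  then show ?thesis by simp
qed

lemma norm_sum_scaleR_squared_le:
  fixes g :: "'i \<Rightarrow> 'a::real_inner"
  shows "(norm (\<Sum>k\<in>K. f k *\<^sub>R g k))\<^sup>2 \<le> (\<Sum>k\<in>K. (f k)\<^sup>2) * (\<Sum>k\<in>K. (norm (g k))\<^sup>2)"
proof -
  have "norm (\<Sum>k\<in>K. f k *\<^sub>R g k) \<le> (\<Sum>k\<in>K. \<bar>f k\<bar> * norm (g k))"
    by (rule order_trans[OF norm_sum]) simp
  then have "(norm (\<Sum>k\<in>K. f k *\<^sub>R g k))\<^sup>2 \<le> (\<Sum>k\<in>K. \<bar>f k\<bar> * norm (g k))\<^sup>2"
    by (intro power_mono) auto
  also have "\<dots> \<le> (\<Sum>k\<in>K. \<bar>f k\<bar>\<^sup>2) * (\<Sum>k\<in>K. (norm (g k))\<^sup>2)"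
    by (rule Cauchy_Schwarz_ineq_sum)
  finally show ?thesis by simp
qed

text \<open>The periodization is the regularized Euclidean norm \<open>\<surd>(\<delta>\<^sup>2 + \<Sum>\<^sub>k \<phi>(x - k)\<^sup>2) - \<delta>\<close> of the translates:
  its energy is at most the sum of their energies, while on each unit cell its mass is at most that of \<open>\<phi>\<close>.\<close>

lemma periodization:
  fixes \<phi> :: "'a::euclidean_space \<Rightarrow> real" and K :: "'a set"
  assumes \<phi>: "test_fun (perforated r) \<phi>" and S: "\<And>x. \<phi> x \<noteq> 0 \<Longrightarrow> norm x \<le> N"
    and K: "finite K" "K \<subseteq> lattice" "\<And>k b. k \<in> K \<Longrightarrow> b \<in> Basis \<Longrightarrow> \<bar>k \<bullet> b\<bar> \<le> M" and e: "0 < e"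
  obtains u :: "'a \<Rightarrow> real" where "test_fun (perforated r \<inter> box (- (M + N + 1) *\<^sub>R One) ((M + N + 1) *\<^sub>R One)) u"
    "\<And>x. 0 \<le> u x" "dirichlet u \<le> real (card K) * dirichlet \<phi>" "real (card K) * mass \<phi> - e \<le> mass u"
    "\<And>x. (\<integral>\<^sup>+h. indicator unit_cube h * ennreal ((u (x + h))\<^sup>2) \<partial>lborel) \<le> ennreal (mass \<phi>)"
proof -
  define f where "f k x = \<phi> (1 *\<^sub>R x + - k)" for k x
  have f: "test_fun UNIV (f k)" for k
    unfolding f_def[abs_def] by (rule test_fun_UNIV_affine[OF \<phi>]) simp
  have sf: "smooth (f k)" for k by (rule test_fun_smooth[OF f])
  have mf: "mass (f k) = mass \<phi>" for k
    unfolding f_def[abs_def] using mass_affine[OF \<phi>, of 1 "- k"] by simp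
  have df: "dirichlet (f k) = dirichlet \<phi>" for k
    unfolding f_def[abs_def] using dirichlet_affine[OF \<phi>, of 1 "- k"] by simp
  define s where "s x = (\<Sum>k\<in>K. f k x * f k x)" for x
  have s2: "s x = (\<Sum>k\<in>K. (f k x)\<^sup>2)" for x by (simp add: s_def power2_eq_square)
  have s0: "0 \<le> s x" for x unfolding s2 by (intro sum_nonneg) auto
  have ss: "smooth s" unfolding s_def[abs_def] by (intro smooth_sum smooth_mult sf)
  have ts: "test_fun UNIV s"
    unfolding s_def[abs_def]
  proof (rule test_fun_sum[OF K(1)])
    show "test_fun UNIV (\<lambda>x. f k x * f k x)" for k
      by (rule test_fun_compose[OF f smooth_mult[OF sf sf]]) simp
  qed
  have gs: "grad s x = 2 *\<^sub>R (\<Sum>k\<in>K. f k x *\<^sub>R grad (f k) x)" for x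
  proof -
    have "grad s x = (\<Sum>k\<in>K. grad (\<lambda>x. f k x * f k x) x)"
      unfolding s_def[abs_def] by (rule grad_sum) (rule smooth_mult[OF sf sf])
    also have "\<dots> = (\<Sum>k\<in>K. 2 *\<^sub>R (f k x *\<^sub>R grad (f k) x))"
      by (rule sum.cong[OF refl]) (simp only: grad_mult[OF sf sf] scaleR_2)
    finally show ?thesis by (simp only: scaleR_sum_right)
  qed
  have is_f: "integrable lebesgue (\<lambda>x. (f k x)\<^sup>2)" "integrable lebesgue (\<lambda>x. (norm (grad (f k) x))\<^sup>2)" for k
    using L2_integrable_norm[OF test_fun_L2[OF f]] L2_integrable_norm[OF test_fun_L2_grad[OF f]] by auto
  have int_s: "integrable lebesgue s" by (rule test_fun_integrable[OF ts])
  have total: "(LINT x|lebesgue. s x) = real (card K) * mass \<phi>"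
    unfolding s2 by (subst Bochner_Integration.integral_sum) (auto simp: is_f mf)
  have c_sqrt: "cont_csupp (\<lambda>x. sqrt (s x))"
    by (rule cont_csupp_compose[OF test_fun_cont_csupp[OF ts] continuous_on_real_sqrt[OF smooth_continuous[OF ss]]]) simp
  define Q where "Q = (LINT x|lebesgue. sqrt (s x))"
  have Q0: "0 \<le> Q" unfolding Q_def by (rule Bochner_Integration.integral_nonneg) (simp add: s0)
  \<comment> \<open>The regularization loses at most \<open>2 * \<delta> * Q\<close> of mass, where
    \<open>Q\<close> is the integral of \<open>sqrt (s x)\<close>. The added \<open>1\<close>
    excludes division by zero.\<close>
  define \<delta> where "\<delta> = e / (2 * Q + 1)"
  have \<delta>: "0 < \<delta>" using e Q0 by (simp add: \<delta>_def add_nonneg_pos)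
  have \<delta>Q: "2 * \<delta> * Q \<le> e"
  proof -
    have "2 * \<delta> * Q \<le> \<delta> * (2 * Q + 1)" using \<delta> by (simp add: algebra_simps)
    also have "\<dots> = e" using Q0 by (simp add: \<delta>_def)
    finally show ?thesis .
  qed
  have q: "0 < \<delta>\<^sup>2 + s x" for x using \<delta> s0[of x] by (simp add: add_pos_nonneg)
  \<comment> \<open>The term \<open>\<delta>^2\<close> keeps the root away from its singularity at
    \<open>0\<close>, so \<open>u\<close> is smooth; subtracting \<open>\<delta>\<close> makes
    \<open>u\<close> vanish wherever \<open>s\<close> does, so the support stays compact.\<close>
  define u where "u x = sqrt (\<delta>\<^sup>2 + s x) - \<delta>" for x
  have u0: "0 \<le> u x" for x
    using real_le_rsqrt[of \<delta> "\<delta>\<^sup>2 + s x"] s0[of x] by (simp add: u_def)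
  have u_le: "(u x)\<^sup>2 \<le> s x" for x
  proof -
    have "u x \<le> sqrt (s x)"
      using sqrt_add_le_add_sqrt[of "\<delta>\<^sup>2" "s x"] s0[of x] \<delta> by (simp add: u_def)
    from power_mono[OF this u0, of 2] show ?thesis using s0[of x] by simp
  qed
  have u_ge: "s x - 2 * \<delta> * sqrt (s x) \<le> (u x)\<^sup>2" for x
  proof -
    have "sqrt (\<delta>\<^sup>2 + s x) \<le> \<delta> + sqrt (s x)"
      using sqrt_add_le_add_sqrt[of "\<delta>\<^sup>2" "s x"] s0[of x] \<delta> by simp
    then have "2 * \<delta> * sqrt (\<delta>\<^sup>2 + s x) \<le> 2 * \<delta> * (\<delta> + sqrt (s x))" using \<delta> by (intro mult_left_mono) auto
    moreover have "(u x)\<^sup>2 = (\<delta>\<^sup>2 + s x) - 2 * \<delta> * sqrt (\<delta>\<^sup>2 + s x) + \<delta>\<^sup>2"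
      using q[of x] by (simp add: u_def power2_diff)
    ultimately show ?thesis by (simp add: power2_eq_square algebra_simps)
  qed
  have su: "smooth u"
  proof -
    have "smooth (\<lambda>x. (\<delta>\<^sup>2 + s x) powr (1 / 2) - \<delta>)"
      by (intro smooth_diff smooth_powr smooth_add smooth_const ss q)
    moreover have "(\<lambda>x. (\<delta>\<^sup>2 + s x) powr (1 / 2) - \<delta>) = u"
      using q by (auto simp: u_def powr_half_sqrt less_imp_le)
    ultimately show ?thesis by simp
  qed
  have tu: "test_fun UNIV u"
    by (rule test_fun_compose[OF ts su]) (use \<delta> in \<open>simp add: u_def\<close>)
  have gu: "(norm (grad u x))\<^sup>2 \<le> (\<Sum>k\<in>K. (norm (grad (f k) x))\<^sup>2)" for x
  proof -
    have "((\<lambda>x. \<delta>\<^sup>2 + s x) has_derivative (\<lambda>h. grad s x \<bullet> h)) (at x)"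
      using has_derivative_add[OF has_derivative_const[of "\<delta>\<^sup>2"] smooth_has_grad[OF ss, of x]] by simp
    from has_derivative_diff[OF has_derivative_real_sqrt[OF q this] has_derivative_const[of \<delta>]]
    have "grad u x = (inverse (sqrt (\<delta>\<^sup>2 + s x)) / 2) *\<^sub>R grad s x"
      unfolding u_def[abs_def] by (intro grad_eqI) (simp add: mult.commute)
    also have "\<dots> = inverse (sqrt (\<delta>\<^sup>2 + s x)) *\<^sub>R (\<Sum>k\<in>K. f k x *\<^sub>R grad (f k) x)" by (simp add: gs)
    finally have "(norm (grad u x))\<^sup>2 = (norm (\<Sum>k\<in>K. f k x *\<^sub>R grad (f k) x))\<^sup>2 / (\<delta>\<^sup>2 + s x)"
      using q[of x] by (simp add: power_mult_distrib power_inverse divide_inverse)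
    \<comment> \<open>Cauchy-Schwarz against the vector of values \<open>f k x\<close>, whose
      squared length is \<open>s x\<close>; the quotient \<open>s x / (\<delta>^2 + s x)\<close> is
      below \<open>1\<close>, so the regularization only lowers the energy.\<close>
    also have "\<dots> \<le> (s x * (\<Sum>k\<in>K. (norm (grad (f k) x))\<^sup>2)) / (\<delta>\<^sup>2 + s x)"
      unfolding s2[of x] using q[of x] by (intro divide_right_mono norm_sum_scaleR_squared_le) (simp add: s2)
    also have "\<dots> \<le> (\<Sum>k\<in>K. (norm (grad (f k) x))\<^sup>2)"
    proof -
      have "0 \<le> (\<Sum>k\<in>K. (norm (grad (f k) x))\<^sup>2)" by (intro sum_nonneg) auto
      then have "s x * (\<Sum>k\<in>K. (norm (grad (f k) x))\<^sup>2) \<le> (\<delta>\<^sup>2 + s x) * (\<Sum>k\<in>K. (norm (grad (f k) x))\<^sup>2)"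
        by (intro mult_right_mono) auto
      then show ?thesis using q[of x] by (simp add: divide_le_eq mult.commute)
    qed
    finally show ?thesis .
  qed
  show ?thesis
  proof (rule that[of u])
    show "0 \<le> u x" for x by (rule u0)
    show "test_fun (perforated r \<inter> box (- (M + N + 1) *\<^sub>R One) ((M + N + 1) *\<^sub>R One)) u"
    proof -
      obtain T where T: "compact T" "T \<subseteq> perforated r" "\<And>x. x \<notin> T \<Longrightarrow> \<phi> x = 0"
        using \<phi> by (auto simp: test_fun_iff)
      define T' where "T' = T \<inter> cball 0 N"
      have T': "compact T'" "\<And>x. x \<notin> T' \<Longrightarrow> \<phi> x = 0" using T S by (auto simp: T'_def)
      let ?U = "\<Union>k\<in>K. (\<lambda>x. x + k) ` T'"
      have "compact ?U"
        by (intro compact_UN K(1) ballI compact_continuous_image T' continuous_intros)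
      \<comment> \<open>Coordinates are at most \<open>M\<close> from the shift plus
        \<open>N\<close> from the support; the extra \<open>1\<close> makes membership in the open
        box strict.\<close>
      moreover have "?U \<subseteq> perforated r \<inter> box (- (M + N + 1) *\<^sub>R One) ((M + N + 1) *\<^sub>R One)"
      proof
        fix y assume "y \<in> ?U"
        then obtain k x where k: "k \<in> K" and x: "x \<in> T'" and y: "y = x + k" by auto
        have "y \<in> perforated r"
          unfolding y by (rule perforated_translate) (use k K(2) x T(2) in \<open>auto simp: T'_def\<close>)
        moreover have "y \<in> box (- (M + N + 1) *\<^sub>R One) ((M + N + 1) *\<^sub>R One)"
          unfolding mem_box
        proof (intro ballI)
          fix b :: 'a assume b: "b \<in> Basis"
          have "\<bar>x \<bullet> b\<bar> \<le> N" using x Basis_le_norm[OF b, of x] by (simp add: T'_def)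
          then show "(- (M + N + 1) *\<^sub>R One) \<bullet> b < y \<bullet> b \<and> y \<bullet> b < ((M + N + 1) *\<^sub>R One) \<bullet> b"
            using K(3)[OF k b] b by (simp add: y inner_add_left abs_le_iff)
        qed
        ultimately show "y \<in> perforated r \<inter> box (- (M + N + 1) *\<^sub>R One) ((M + N + 1) *\<^sub>R One)" by simp
      qed
      moreover have "u x = 0" if x: "x \<notin> ?U" for x
      proof -
        have "f k x = 0" if "k \<in> K" for k
        proof -
          have "x - k \<notin> T'"
          proof
            assume "x - k \<in> T'"
            then have "x - k + k \<in> (\<lambda>x. x + k) ` T'" by (rule imageI)
            then show False using x that by auto
          qed
          then show ?thesis using T'(2) by (simp add: f_def)
        qed
        then show ?thesis using \<delta> by (simp add: u_def s_def)
      qed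
      ultimately show ?thesis unfolding test_fun_iff using su by blast
    qed
    show "dirichlet u \<le> real (card K) * dirichlet \<phi>"
    proof -
      have "dirichlet u \<le> (LINT x|lebesgue. (\<Sum>k\<in>K. (norm (grad (f k) x))\<^sup>2))"
        by (rule integral_mono[OF L2_integrable_norm[OF test_fun_L2_grad[OF tu]] Bochner_Integration.integrable_sum[OF is_f(2)] gu])
      also have "\<dots> = real (card K) * dirichlet \<phi>"
        by (subst Bochner_Integration.integral_sum) (auto simp: is_f df)
      finally show ?thesis .
    qed
    show "real (card K) * mass \<phi> - e \<le> mass u"
    proof -
      have "real (card K) * mass \<phi> - e \<le> (LINT x|lebesgue. s x) - 2 * \<delta> * Q"
        using \<delta>Q by (simp add: total)
      also have "\<dots> = (LINT x|lebesgue. s x - 2 * \<delta> * sqrt (s x))"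
        using int_s cont_csupp_integrable[OF c_sqrt] by (simp add: Q_def)
      also have "\<dots> \<le> mass u"
        using L2_integrable_norm[OF test_fun_L2[OF tu]]
        by (intro integral_mono u_ge Bochner_Integration.integrable_diff int_s integrable_mult_right cont_csupp_integrable[OF c_sqrt]) auto
      finally show ?thesis .
    qed
    show "(\<integral>\<^sup>+h. indicator unit_cube h * ennreal ((u (x + h))\<^sup>2) \<partial>lborel) \<le> ennreal (mass \<phi>)" for x
    proof -
      have [measurable]: "\<phi> \<in> borel_measurable borel"
        by (rule borel_measurable_continuous_onI[OF smooth_continuous[OF test_fun_smooth[OF \<phi>]]])
      note c2 = cont_csupp_square[OF test_fun_cont_csupp[OF \<phi>]]
      have "(\<integral>\<^sup>+h. indicator unit_cube h * ennreal ((u (x + h))\<^sup>2) \<partial>lborel)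
          \<le> (\<integral>\<^sup>+h. (\<Sum>k\<in>K. indicator unit_cube h * ennreal ((\<phi> (h + (x - k)))\<^sup>2)) \<partial>lborel)"
      proof (rule nn_integral_mono)
        fix h
        have "ennreal ((u (x + h))\<^sup>2) \<le> ennreal (s (x + h))" by (rule ennreal_leI[OF u_le])
        also have "\<dots> = (\<Sum>k\<in>K. ennreal ((\<phi> (h + (x - k)))\<^sup>2))"
          unfolding s2 by (simp add: f_def sum_ennreal algebra_simps)
        finally show "indicator unit_cube h * ennreal ((u (x + h))\<^sup>2) \<le> (\<Sum>k\<in>K. indicator unit_cube h * ennreal ((\<phi> (h + (x - k)))\<^sup>2))"
          by (simp add: mult_left_mono flip: sum_distrib_left)
      qed
      also have "\<dots> = (\<Sum>k\<in>K. \<integral>\<^sup>+h. indicator unit_cube h * ennreal ((\<phi> (h + (x - k)))\<^sup>2) \<partial>lborel)"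
        by (rule nn_integral_sum) measurable
      \<comment> \<open>Unfolding: the translation is moved from \<open>\<phi>\<close> to the cell,
        so that every summand integrates the same function over a different lattice translate of one
        cube.\<close>
      also have "\<dots> = (\<Sum>k\<in>K. \<integral>\<^sup>+y. indicator unit_cube (- x + y + k) * ennreal ((\<phi> y)\<^sup>2) \<partial>lborel)"
      proof (rule sum.cong[OF refl])
        fix k
        have "(\<integral>\<^sup>+y. indicator unit_cube (- x + y + k) * ennreal ((\<phi> y)\<^sup>2) \<partial>lborel)
            = (\<integral>\<^sup>+h. indicator unit_cube (- x + (h + (x - k)) + k) * ennreal ((\<phi> (h + (x - k)))\<^sup>2) \<partial>lborel)"
          by (rule nn_integral_lborel_translate[symmetric]) measurable
        then show "(\<integral>\<^sup>+h. indicator unit_cube h * ennreal ((\<phi> (h + (x - k)))\<^sup>2) \<partial>lborel)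
            = (\<integral>\<^sup>+y. indicator unit_cube (- x + y + k) * ennreal ((\<phi> y)\<^sup>2) \<partial>lborel)" by simp
      qed
      also have "\<dots> = (\<integral>\<^sup>+y. (\<Sum>k\<in>K. indicator unit_cube (- x + y + k) * ennreal ((\<phi> y)\<^sup>2)) \<partial>lborel)"
        by (rule nn_integral_sum[symmetric]) measurable
      also have "\<dots> \<le> (\<integral>\<^sup>+y. ennreal ((\<phi> y)\<^sup>2) \<partial>lborel)"
      proof (rule nn_integral_mono)
        fix y
        have "(\<Sum>k\<in>K. indicator unit_cube (- x + y + k)) * ennreal ((\<phi> y)\<^sup>2) \<le> 1 * ennreal ((\<phi> y)\<^sup>2)"
          by (intro mult_right_mono sum_indicator_unit_cube_le K) auto
        then show "(\<Sum>k\<in>K. indicator unit_cube (- x + y + k) * ennreal ((\<phi> y)\<^sup>2)) \<le> ennreal ((\<phi> y)\<^sup>2)"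
          by (simp flip: sum_distrib_right)
      qed
      also have "\<dots> = ennreal (mass \<phi>)"
        by (simp add: nn_integral_eq_integral[OF cont_csupp_integrable_lborel[OF c2]] cont_csupp_lebesgue_lborel[OF c2])
      finally show ?thesis .
    qed
  qed
qed

lemma lattice_box:
  obtains K :: "'a::euclidean_space set" where "finite K" "K \<subseteq> lattice"
    "\<And>k b. k \<in> K \<Longrightarrow> b \<in> Basis \<Longrightarrow> \<bar>k \<bullet> b\<bar> \<le> real M" "card K = (2 * M + 1) ^ DIM('a)"
proof -
  let ?Z = "{- int M..int M}"
  let ?F = "\<lambda>f. \<Sum>b\<in>Basis. real_of_int (f b) *\<^sub>R (b::'a)"
  let ?P = "(Basis::'a set) \<rightarrow>\<^sub>E ?Z"
  have F: "?F f \<bullet> b = real_of_int (f b)" if "b \<in> Basis" for f b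
    using that by (simp add: inner_sum_left inner_Basis if_distrib cong: if_cong)
  have "inj_on ?F ?P"
  proof (rule inj_onI)
    fix f g assume f: "f \<in> ?P" and g: "g \<in> ?P" and eq: "?F f = ?F g"
    show "f = g"
    proof (rule PiE_ext[OF f g])
      fix b :: 'a assume "b \<in> Basis"
      then show "f b = g b" using F[of b f] F[of b g] eq by simp
    qed
  qed
  then have "card (?F ` ?P) = card ?P" by (rule card_image)
  also have "\<dots> = (2 * M + 1) ^ DIM('a)" by (simp add: card_PiE nat_add_distrib nat_mult_distrib)
  finally have card: "card (?F ` ?P) = (2 * M + 1) ^ DIM('a)" .
  have coord: "\<bar>k \<bullet> b\<bar> \<le> real M" if k: "k \<in> ?F ` ?P" and b: "b \<in> Basis" for k b
  proof -
    obtain f where f: "f \<in> ?P" "k = ?F f" using k by blast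
    then have "\<bar>f b\<bar> \<le> int M" using b by (force simp: PiE_iff)
    then have "\<bar>real_of_int (f b)\<bar> \<le> real M" by linarith
    then show ?thesis unfolding f(2) F[OF b] .
  qed
  have sub: "?F ` ?P \<subseteq> lattice"
  proof
    fix k assume "k \<in> ?F ` ?P"
    then obtain f where f: "k = ?F f" by blast
    have "k \<bullet> b \<in> \<int>" if "b \<in> Basis" for b
      unfolding f F[OF that] by (rule Ints_of_int)
    then show "k \<in> lattice" by (simp add: lattice_def)
  qed
  have fin: "finite (?F ` ?P)" by (intro finite_imageI finite_PiE) auto
  show ?thesis by (rule that[OF fin sub coord card])
qed

text \<open>A margin of fixed width takes a vanishing share of a large box. With \<open>t\<close>
  the fraction of the side lost to the margin, Bernoulli's inequality gives
  \<open>(1 - t)^D \<ge> 1 - D t\<close>, and \<open>M\<close> is taken large enough for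
  \<open>D t \<le> e\<close>.\<close>

lemma box_fraction:
  fixes N e :: real
  assumes "0 \<le> N" "0 < e"
  obtains M :: nat where "1 - e \<le> real ((2 * M + 1) ^ D) / (2 * (real M + N + 1)) ^ D"
proof -
  obtain M :: nat where M: "real D * (2 * N + 1) / e < real M" using reals_Archimedean2 by blast
  define t where "t = (2 * N + 1) / (2 * (real M + N + 1))"
  have t: "0 \<le> t" "t \<le> 1" using assms by (auto simp: t_def divide_le_eq)
  have "real D * (2 * N + 1) < e * real M" using M assms by (simp add: field_simps)
  also have "\<dots> \<le> e * (2 * (real M + N + 1))" using assms by (intro mult_left_mono) auto
  finally have "real D * t \<le> e" using assms by (simp add: t_def divide_le_eq)
  then have "1 - e \<le> 1 + real D * (- t)" by simp
  also have "\<dots> \<le> (1 + - t) ^ D" by (rule Bernoulli_inequality) (use t in simp)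
  also have "1 + - t = (2 * real M + 1) / (2 * (real M + N + 1))" using assms by (simp add: t_def field_simps)
  finally show ?thesis by (intro that[of M]) (simp add: power_divide add.commute)
qed

text \<open>The factors record the losses. \<open>1 / (1 + e)\<close> comes from
  \<open>\<phi>\<close> being only a near-minimizer, \<open>1 - e\<close> from the margin of the
  box. In the squared factor, \<open>e\<close> is the mass lost to regularization and the last term
  is the energy error of \<open>integral_lower_bound\<close>. That factor must be nonnegative so
  that the bound on the integral of \<open>u\<close> can be squared.\<close>

lemma perforated_near_extremal:
  assumes dim: "DIM('a::euclidean_space) \<ge> 2" and e: "0 < e" "e < 1" and p: "1 \<le> p" "p \<le> 2"
    and q: "0 \<le> 1 - e - real DIM('a) / 2 * (1 + e) * e"
  obtains \<Omega> :: "'a::euclidean_space set" where "open \<Omega>" "\<Omega> \<noteq> {}" "emeasure lebesgue \<Omega> < \<infinity>"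
    "(1 - e) / (1 + e) * (1 - e - real DIM('a) / 2 * (1 + e) * e)\<^sup>2 \<le> Fp p \<Omega>"
proof -
  define Q where "Q = 1 - e - real DIM('a) / 2 * (1 + e) * e"
  obtain r and \<phi>0 :: "'a \<Rightarrow> real" where r: "0 < r" and \<phi>0: "test_fun (perforated r) \<phi>0" "dirichlet \<phi>0 < e * mass \<phi>0"
    by (rule perforated_small_rayleigh[OF dim e(1)]) (rule that)
  obtain c where c: "0 < c" "\<And>\<phi>. test_fun (perforated r :: 'a set) \<phi> \<Longrightarrow> c * mass \<phi> \<le> dirichlet \<phi>"
    using perforated_poincare[OF r, where 'a = 'a] by blast
  \<comment> \<open>The infimum is taken over the whole perforated space, before any box is chosen,
    so that \<open>\<mu>\<close> and the near-minimizer do not depend on the box.\<close>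
  define X where "X = {dirichlet \<phi> / mass \<phi> | \<phi>. test_fun (perforated r :: 'a set) \<phi> \<and> 0 < mass \<phi>}"
  define \<mu> where "\<mu> = Inf X"
  have bdd: "bdd_below X" by (rule bdd_belowI[of _ 0]) (auto simp: X_def)
  have "0 \<le> dirichlet \<phi>0" by simp
  then have "0 < e * mass \<phi>0" using \<phi>0(2) by linarith
  then have m0: "0 < mass \<phi>0" using e(1) by (simp add: zero_less_mult_iff)
  have X0: "dirichlet \<phi>0 / mass \<phi>0 \<in> X" using \<phi>0(1) m0 by (auto simp: X_def)
  have "\<mu> \<le> dirichlet \<phi>0 / mass \<phi>0" unfolding \<mu>_def by (rule cInf_lower[OF X0 bdd])
  also have "\<dots> < e" using \<phi>0(2) m0 by (simp add: divide_less_eq)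
  finally have \<mu>e: "\<mu> < e" .
  have "c \<le> \<mu>" unfolding \<mu>_def
  proof (rule cInf_greatest)
    show "c \<le> x" if "x \<in> X" for x using that c(2) by (auto simp: X_def le_divide_eq)
  qed (use X0 in blast)
  then have \<mu>: "0 < \<mu>" using c(1) by simp
  have ray: "\<mu> * mass \<phi> \<le> dirichlet \<phi>" if t: "test_fun (perforated r :: 'a set) \<phi>" for \<phi>
  proof (cases "mass \<phi> = 0")
    case False
    have "0 \<le> mass \<phi>" by simp
    with False have pos: "0 < mass \<phi>" by linarith
    then have "\<mu> \<le> dirichlet \<phi> / mass \<phi>" unfolding \<mu>_def using t by (intro cInf_lower bdd) (auto simp: X_def)
    then show ?thesis using pos by (simp add: le_divide_eq)
  qed simp
  \<comment> \<open>Positivity of \<open>\<mu>\<close>, from the Poincare inequality, allows a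
    relative error \<open>1 + e\<close>; an additive error would be useless since only the ratio of
    \<open>E\<close> to \<open>\<mu> * A\<close> enters.\<close>
  have "\<mu> < \<mu> * (1 + e)" using \<mu> e by simp
  then obtain x where "x \<in> X" "x < \<mu> * (1 + e)" unfolding \<mu>_def using cInf_lessD[of X] X0 by blast
  then obtain \<phi> where \<phi>: "test_fun (perforated r :: 'a set) \<phi>" and A0: "0 < mass \<phi>"
    and less: "dirichlet \<phi> / mass \<phi> < \<mu> * (1 + e)" by (auto simp: X_def)
  define A where "A = mass \<phi>"
  define E where "E = dirichlet \<phi>"
  have A: "0 < A" using A0 by (simp add: A_def)
  have E_less: "E < \<mu> * (1 + e) * A" using less A0 by (simp add: A_def E_def divide_less_eq)
  have E_ge: "\<mu> * A \<le> E" using ray[OF \<phi>] by (simp add: A_def E_def)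
  have E: "0 < E" using E_ge \<mu> A by (smt (verit) mult_pos_pos)
  obtain S where S: "compact S" "\<And>x. x \<notin> S \<Longrightarrow> \<phi> x = 0" using \<phi> by (auto simp: test_fun_iff)
  obtain N where N: "0 < N" "\<And>x. x \<in> S \<Longrightarrow> norm x \<le> N"
    using compact_imp_bounded[OF S(1)] by (auto simp: bounded_pos)
  obtain M :: nat where M: "1 - e \<le> real ((2 * M + 1) ^ DIM('a)) / (2 * (real M + N + 1)) ^ DIM('a)"
    by (rule box_fraction[of N e]) (use N e in auto)
  obtain K :: "'a set" where K: "finite K" "K \<subseteq> lattice"
    "\<And>k b. k \<in> K \<Longrightarrow> b \<in> Basis \<Longrightarrow> \<bar>k \<bullet> b\<bar> \<le> real M" "card K = (2 * M + 1) ^ DIM('a)"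
    by (rule lattice_box) (rule that)
  define n where "n = real (card K)"
  have n: "0 < n" by (simp add: n_def K(4))
  define \<Omega> where "\<Omega> = perforated r \<inter> box (- (real M + N + 1) *\<^sub>R One) ((real M + N + 1) *\<^sub>R (One::'a))"
  define V where "V = (2 * (real M + N + 1)) ^ DIM('a)"
  have V: "0 < V" using N by (simp add: V_def)
  obtain u where u: "test_fun \<Omega> u"
    "\<And>x. 0 \<le> u x" "dirichlet u \<le> real (card K) * dirichlet \<phi>" "real (card K) * mass \<phi> - e * n * A \<le> mass u"
    "\<And>x. (\<integral>\<^sup>+h. indicator unit_cube h * ennreal ((u (x + h))\<^sup>2) \<partial>lborel) \<le> ennreal (mass \<phi>)"
  proof (rule periodization[OF \<phi> _ K(1,2), where N = N and M = "real M"])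
    show "\<bar>k \<bullet> b\<bar> \<le> real M" if "k \<in> K" "b \<in> Basis" for k b using that by (rule K(3))
    show "0 < e * n * A" using e n A by simp
    show "norm x \<le> N" if "\<phi> x \<noteq> 0" for x using that S(2) N(2) by blast
  qed (rule that[unfolded \<Omega>_def])
  have op: "open \<Omega>" unfolding \<Omega>_def by (intro open_Int open_perforated open_box)
  have em: "emeasure lebesgue \<Omega> \<le> ennreal V"
  proof -
    have "emeasure lebesgue \<Omega> \<le> emeasure lebesgue (box (- (real M + N + 1) *\<^sub>R One) ((real M + N + 1) *\<^sub>R (One::'a)))"
      by (rule emeasure_mono) (auto simp: \<Omega>_def)
    also have "\<dots> = ennreal V"
      using N by (simp add: emeasure_lborel_box_eq inner_diff_left V_def algebra_simps)
    finally show ?thesis .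
  qed
  have fin: "emeasure lebesgue \<Omega> < \<infinity>" using em by (simp add: le_less_trans)
  have meas: "measure lebesgue \<Omega> \<le> V" unfolding measure_def using em V by (simp add: enn2real_leI)
  have mass_u: "n * A * (1 - e) \<le> mass u" using u(4) by (simp add: n_def A_def algebra_simps)
  have ne: "\<Omega> \<noteq> {}"
  proof
    assume "\<Omega> = {}"
    then have "u x = 0" for x using test_fun_zero_outside[OF u(1), of x] by simp
    then have "mass u = 0" by simp
    moreover have "0 < n * A * (1 - e)" using n A e by simp
    ultimately show False using mass_u by linarith
  qed
  define G where "G = (LINT x|lebesgue. u x)"
  have "n * A * Q \<le> sqrt A * G"
  proof -
    have "real DIM('a) / 2 * dirichlet u \<le> real DIM('a) / 2 * (n * ((1 + e) * e * A))"
    proof (rule mult_left_mono)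
      \<comment> \<open>Here the smallness of \<open>\<mu>\<close> is used: relative to the mass,
        the energy error is of order \<open>e\<close>, so \<open>u\<close> is nearly constant on the
        scale of a cell.\<close>
      have "E \<le> (1 + e) * e * A"
      proof -
        have "\<mu> * (1 + e) * A \<le> e * (1 + e) * A" using \<mu>e e A by (intro mult_right_mono) auto
        then show ?thesis using E_less by (simp add: mult.commute)
      qed
      then have "n * E \<le> n * ((1 + e) * e * A)" using n by (intro mult_left_mono) auto
      then show "dirichlet u \<le> n * ((1 + e) * e * A)" using u(3) by (simp add: n_def E_def)
    qed simp
    then have "n * A * Q \<le> mass u - real DIM('a) / 2 * dirichlet u"
    proof -
      have "n * A * Q = n * A * (1 - e) - real DIM('a) / 2 * (n * ((1 + e) * e * A))"
        by (simp add: Q_def algebra_simps)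
      then show ?thesis using mass_u \<open>real DIM('a) / 2 * dirichlet u \<le> _\<close> by linarith
    qed
    also have "\<dots> \<le> sqrt A * G"
      unfolding G_def by (rule integral_lower_bound[OF test_fun_mono[OF u(1) subset_UNIV] u(2)])
        (use A u(5) in \<open>simp_all add: A_def\<close>)
    finally show ?thesis .
  qed
  moreover have "n * A * Q = sqrt A * (n * sqrt A * Q)" using A by simp
  ultimately have "n * sqrt A * Q \<le> G" using A by simp
  moreover have "0 \<le> n * sqrt A * Q" using n A q by (simp add: Q_def)
  ultimately have "(n * sqrt A * Q)\<^sup>2 \<le> G\<^sup>2" by (rule power_mono)
  then have G: "n\<^sup>2 * A * Q\<^sup>2 \<le> G\<^sup>2" using A by (simp add: power_mult_distrib)
  have "\<mu> * G\<^sup>2 / (n * E * V) \<le> Fp p \<Omega>"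
    unfolding G_def
  proof (rule Fp_lower_bound[OF op ne fin p \<mu> _ u(1)])
    show "\<mu> \<le> lambda1 \<Omega>"
      by (rule lambda1_greatest[OF op ne], rule ray, erule test_fun_mono) (simp add: \<Omega>_def)
    show "dirichlet u \<le> n * E" using u(3) by (simp add: n_def E_def)
    show "0 < n * E" using n E by simp
  qed (rule meas)
  moreover have "(1 - e) / (1 + e) * Q\<^sup>2 \<le> \<mu> * G\<^sup>2 / (n * E * V)"
  proof -
    have 1: "1 / (1 + e) \<le> \<mu> * A / E" using E_less E e by (simp add: field_simps)
    have 2: "1 - e \<le> n / V" using M by (simp add: n_def V_def K(4))
    have "(1 - e) / (1 + e) * Q\<^sup>2 = 1 / (1 + e) * (1 - e) * Q\<^sup>2" by simp
    also have "\<dots> \<le> \<mu> * A / E * (n / V) * Q\<^sup>2"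
      using 1 2 e \<mu> A E by (intro mult_right_mono mult_mono) auto
    also have "\<dots> = \<mu> * (n\<^sup>2 * A * Q\<^sup>2) / (n * E * V)"
      using n E V by (simp add: power2_eq_square)
    also have "\<dots> \<le> \<mu> * G\<^sup>2 / (n * E * V)"
      using G \<mu> n E V by (intro divide_right_mono mult_left_mono) auto
    finally show ?thesis .
  qed
  ultimately show ?thesis using that[OF op ne fin] by (simp add: Q_def)
qed

theorem theorem3:
  fixes \<Omega> :: "'a::euclidean_space set" and p :: real
  assumes "DIM('a) \<ge> 2" and "1 \<le> p" and "p \<le> 2"
    and "open \<Omega>" and "\<Omega> \<noteq> {}" and "emeasure lebesgue \<Omega> < \<infinity>"
  shows "ereal (Fp p \<Omega>) \<noteq> Fsup TYPE('a) p"
proof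
  assume eq: "ereal (Fp p \<Omega>) = Fsup TYPE('a) p"
  let ?q = "\<lambda>e. 1 - e - real DIM('a) / 2 * (1 + e) * e"
  let ?g = "\<lambda>e. (1 - e) / (1 + e) * (?q e)\<^sup>2"
  have lt: "Fp p \<Omega> < 1" by (rule Fp_less_1) (rule assms)+
  \<comment> \<open>As \<open>e\<close> decreases to \<open>0\<close>, both \<open>?q e\<close> and
    \<open>?g e\<close> tend to \<open>1\<close>, so a small \<open>e\<close> makes
    \<open>?q e\<close> positive and pushes \<open>?g e\<close> above \<open>Fp p \<Omega>\<close>,
    which is below \<open>1\<close>.\<close>
  have "(?q \<longlongrightarrow> 1 - 0 - real DIM('a) / 2 * (1 + 0) * 0) (at_right 0)"
    by (intro tendsto_intros)
  then have "\<forall>\<^sub>F e in at_right 0. 0 < ?q e" by (rule order_tendstoD) simp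
  moreover have "(?g \<longlongrightarrow> (1 - 0) / (1 + 0) * (1 - 0 - real DIM('a) / 2 * (1 + 0) * 0)\<^sup>2) (at_right 0)"
    by (intro tendsto_intros) simp
  then have "\<forall>\<^sub>F e in at_right 0. Fp p \<Omega> < ?g e" by (rule order_tendstoD) (use lt in simp)
  moreover have "\<forall>\<^sub>F e in at_right (0::real). 0 < e" by (rule eventually_at_right_less)
  moreover have "\<forall>\<^sub>F e in at_right (0::real). e < 1" by (rule order_tendstoD(2)[OF tendsto_ident_at]) simp
  ultimately have "\<forall>\<^sub>F e in at_right 0. 0 < ?q e \<and> Fp p \<Omega> < ?g e \<and> 0 < e \<and> e < 1"
    by eventually_elim simp
  then obtain e where e: "0 < ?q e" "Fp p \<Omega> < ?g e" "0 < e" "e < 1"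
    using eventually_happens'[OF trivial_limit_at_right_real] by blast
  obtain U :: "'a set" where U: "open U" "U \<noteq> {}" "emeasure lebesgue U < \<infinity>" "?g e \<le> Fp p U"
    by (rule perforated_near_extremal[OF assms(1) e(3,4) assms(2,3) less_imp_le[OF e(1)]]) (rule that)
  \<comment> \<open>\<open>Fsup\<close> ranges over sets of positive measure, so the nonempty open
    set \<open>U\<close> must be shown to qualify.\<close>
  have "emeasure lebesgue U \<noteq> 0"
    using open_not_negligible[OF U(1,2)] U(1) by (simp add: negligible_iff_emeasure0)
  then have "ereal (Fp p U) \<le> Fsup TYPE('a) p"
    unfolding Fsup_def using U by (intro SUP_upper) (simp add: zero_less_iff_neq_zero)
  then have "Fp p U \<le> Fp p \<Omega>" by (simp flip: eq)
  then show False using e(2) U(4) by linarith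
qed

end
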